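(* Let $G:\mathbb R\to\mathbb R$ be defined by \[ G(v)=\sum_{j=1}^{\infty}\sum_{d\mid j}a(d)\,b\!\left(\frac{j}{d}\right)\left(\frac{j}{d^{2}}\right)^{\frac14}G(v,d,j),\qquad G(v,d,j)=\left(\frac{j}{d^{2}}\right)^{-\frac14}e^{\frac v2}\exp\!\left[-\pi\left(d\,e^{v}+\frac{j}{d}\,e^{-v}\right)\right], \] and let $\hat G(t)=\int_{-\infty}^{\infty}e^{itv}G(v)\,dv$ for complex $t$. Then for every nonreal zero $\rho=\frac12+i\gamma$ of the Riemann zeta function ($\gamma\in\mathbb C$ not assumed real), \[ \hat G(\gamma)=\sum_{j=1}^{\infty}\sum_{d\mid j}a(d)\,b\!\left(\frac{j}{d}\right)\left(\frac{j}{d^{2}}\right)^{\frac14+\frac{i\gamma}{2}}2K_{\frac12+i\gamma}\!\left(2\pi\sqrt{j}\right)=0; \] consequently $\sum_{\gamma}\hat G(\gamma)=0$, the sum running over all nonreal zeros $\rho=\frac12+i\gamma$ of $\zeta$.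
   Context: $K_s(x)$ is the modified Bessel function of the second kind. $\sigma_1(n)$ is the sum of divisors of $n$. The arithmetic functions $a,b$ are multiplicative, determined by: $a(n)=\sigma_1(n)$ for odd $n$ and $a(2^m)=2^m$ for $m\ge0$; $b(n)=\sigma_1(n)$ for odd $n$ and $b(2^m)=0$ for $m\ge1$. Equivalently $G(v)=e^{v/2}\alpha(e^v)\beta(e^{-v})$ with $\alpha(u)=\sum_{k\ge1}a(k)e^{-\pi k u}$, $\beta(u)=\sum_{l\ge1}b(l)e^{-\pi l u}$ for $u>0$; $\hat G$ extends to an entire function. *)

theory Defs
  imports "HOL-Complex_Analysis.Complex_Analysis"
begin

definition sigma1 :: "nat \<Rightarrow> nat" where
  "sigma1 n = (\<Sum>d | d dvd n. d)"

text \<open>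
  The multiplicative functions \<open>a\<close> and \<open>b\<close>, written out on \<open>n = 2 ^ m * k\<close> with \<open>k\<close> odd, where
  multiplicativity forces \<open>a n = a (2 ^ m) * a k\<close> and \<open>b n = b (2 ^ m) * b k\<close>.
  The lemmas below confirm that these are the multiplicative functions with the prescribed values.
  The value at \<open>0\<close> is irrelevant.
\<close>

definition a_coeff :: "nat \<Rightarrow> nat" where
  "a_coeff n = 2 ^ multiplicity 2 n * sigma1 (n div 2 ^ multiplicity 2 n)"

definition b_coeff :: "nat \<Rightarrow> nat" where
  "b_coeff n = (if odd n then sigma1 n else 0)"

lemma sigma1_1 [simp]: "sigma1 (Suc 0) = 1"
  by (simp add: sigma1_def)

lemma sigma1_mult:
  assumes "coprime m n"
  shows "sigma1 (m * n) = sigma1 m * sigma1 n"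
proof -
  have "bij_betw (\<lambda>(x, y). x * y) ({d. d dvd m} \<times> {d. d dvd n}) {d. d dvd m * n}"
  proof (intro bij_betwI[where g = "\<lambda>d. (gcd d m, gcd d n)"])
    show "(\<lambda>(x, y). x * y) \<in> {d. d dvd m} \<times> {d. d dvd n} \<rightarrow> {d. d dvd m * n}"
      by (auto intro: mult_dvd_mono)
  next
    fix p assume "p \<in> {d. d dvd m} \<times> {d. d dvd n}"
    then obtain x y where p: "p = (x, y)" "x dvd m" "y dvd n" by auto
    have "coprime y m" "coprime x n"
      using assms p coprime_divisors[of y n m m] coprime_divisors[of x m n n]
      by (auto simp: coprime_commute)
    then have "gcd (x * y) m = x" "gcd (x * y) n = y"
      using p by (auto simp: gcd_mult_left_right_cancel gcd_mult_left_left_cancel coprime_commute)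
    then show "(\<lambda>d. (gcd d m, gcd d n)) (case p of (x, y) \<Rightarrow> x * y) = p"
      using p by auto
  next
    fix d assume "d \<in> {d. d dvd m * n}"
    then have "d dvd m * n" by simp
    then obtain x y where d: "d = x * y" "x dvd m" "y dvd n" using division_decomp by blast
    have "coprime y m" "coprime x n"
      using assms d coprime_divisors[of y n m m] coprime_divisors[of x m n n]
      by (auto simp: coprime_commute)
    then show "(case (gcd d m, gcd d n) of (x, y) \<Rightarrow> x * y) = d"
      using d by (auto simp: gcd_mult_left_right_cancel gcd_mult_left_left_cancel coprime_commute)
  qed auto
  then have "sigma1 (m * n) = (\<Sum>(x, y)\<in>{d. d dvd m} \<times> {d. d dvd n}. x * y)"
    unfolding sigma1_def by (subst sum.reindex_bij_betw[symmetric]) (auto simp: case_prod_unfold)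
  then show ?thesis
    by (simp add: sigma1_def sum_product sum.cartesian_product)
qed

lemma a_coeff_odd: "odd n \<Longrightarrow> a_coeff n = sigma1 n"
  by (simp add: a_coeff_def not_dvd_imp_multiplicity_0)

lemma a_coeff_power_2: "a_coeff (2 ^ m) = 2 ^ m"
  by (simp add: a_coeff_def)

lemma a_coeff_mult:
  assumes "coprime m n"
  shows "a_coeff (m * n) = a_coeff m * a_coeff n"
proof -
  have *: "a_coeff (m * n) = a_coeff m * a_coeff n" if "coprime m n" "odd n" for m n
  proof (cases "m = 0")
    case True
    then show ?thesis using that by (simp add: a_coeff_odd)
  next
    case False
    define k where "k = multiplicity 2 m"
    have dvd: "2 ^ k dvd m" by (simp add: k_def multiplicity_dvd)
    have k: "multiplicity 2 (m * n) = k"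
      using False that
      by (auto simp: k_def prime_elem_multiplicity_mult_distrib not_dvd_imp_multiplicity_0
          odd_pos)
    have "coprime (m div 2 ^ k) n"
      using that(1) dvd coprime_divisors[of "m div 2 ^ k" m n n] by (simp add: div_dvd_iff_mult)
    moreover have "m * n div 2 ^ k = (m div 2 ^ k) * n"
      using dvd by (simp add: div_mult_swap mult.commute)
    ultimately have "a_coeff (m * n) = a_coeff m * sigma1 n"
      unfolding a_coeff_def k by (simp add: k_def[symmetric] sigma1_mult)
    then show ?thesis using that by (simp add: a_coeff_odd)
  qed
  have "odd m \<or> odd n"
    using assms coprime_common_divisor[of m n 2] by auto
  then show ?thesis
    using *[of m n] *[of n m] assms by (auto simp: mult.commute coprime_commute)
qed

lemma b_coeff_odd: "odd n \<Longrightarrow> b_coeff n = sigma1 n"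
  by (simp add: b_coeff_def)

lemma b_coeff_power_2: "m \<ge> 1 \<Longrightarrow> b_coeff (2 ^ m) = 0"
  by (simp add: b_coeff_def)

lemma b_coeff_mult: "coprime m n \<Longrightarrow> b_coeff (m * n) = b_coeff m * b_coeff n"
  by (simp add: b_coeff_def sigma1_mult)

text \<open>
  The Riemann zeta function: the analytic continuation of \<open>\<Sum>n\<ge>1. n powr (-s)\<close> to the plane
  without \<open>1\<close>. The condition at the pole \<open>1\<close> only serves to make the function unique.
\<close>

definition zeta :: "complex \<Rightarrow> complex" where
  "zeta = (THE f. f holomorphic_on (- {1}) \<and>
                  (\<forall>s. Re s > 1 \<longrightarrow> (\<lambda>n. of_nat (Suc n) powr (- s)) sums f s) \<and>
                  f 1 = 0)"

text \<open>
  Modified Bessel functions. The reciprocal Gamma function makes the series of \<open>bessel_I\<close>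
  meaningful also when \<open>\<nu>\<close> is a negative integer. As usual, \<open>bessel_K\<close> at an integer order is
  the limit over non-integer orders.
\<close>

definition bessel_I :: "complex \<Rightarrow> complex \<Rightarrow> complex" where
  "bessel_I \<nu> z = (\<Sum>k. (z / 2) powr (\<nu> + 2 * of_nat k) * rGamma (\<nu> + of_nat k + 1) / fact k)"

definition bessel_K :: "complex \<Rightarrow> complex \<Rightarrow> complex" where
  "bessel_K \<nu> z =
     (let K = (\<lambda>\<mu>. of_real pi / 2 * (bessel_I (- \<mu>) z - bessel_I \<mu> z) / sin (of_real pi * \<mu>))
      in if \<nu> \<in> \<int> then Lim (at \<nu>) K else K \<nu>)"

definition G_term :: "real \<Rightarrow> nat \<Rightarrow> nat \<Rightarrow> real" where
  "G_term v d j =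
     (real j / real d ^ 2) powr (- 1 / 4) * exp (v / 2) *
     exp (- pi * (real d * exp v + real j / real d * exp (- v)))"

definition G_summand :: "real \<Rightarrow> nat \<Rightarrow> real" where
  "G_summand v j =
     (\<Sum>d | d dvd j. real (a_coeff d) * real (b_coeff (j div d)) *
        (real j / real d ^ 2) powr (1 / 4) * G_term v d j)"

definition G :: "real \<Rightarrow> real" where
  "G v = (\<Sum>j. G_summand v (Suc j))"

definition Ghat_integrand :: "complex \<Rightarrow> real \<Rightarrow> complex" where
  "Ghat_integrand t v = exp (\<i> * t * of_real v) * of_real (G v)"

definition Ghat :: "complex \<Rightarrow> complex" where
  "Ghat t = (LINT v|lborel. Ghat_integrand t v)"

definition bessel_summand :: "complex \<Rightarrow> nat \<Rightarrow> complex" where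
  "bessel_summand \<gamma> j =
     (\<Sum>d | d dvd j. of_nat (a_coeff d) * of_nat (b_coeff (j div d)) *
        of_real (real j / real d ^ 2) powr (1 / 4 + \<i> * \<gamma> / 2) *
        (2 * bessel_K (1 / 2 + \<i> * \<gamma>) (of_real (2 * pi * sqrt (real j)))))"

definition nonreal_zeta_zeros :: "complex set" where
  "nonreal_zeta_zeros = {\<rho>. zeta \<rho> = 0 \<and> \<rho> \<notin> \<real>}"

end

theory Submission
  imports Defs "HOL-Probability.Probability" "HOL-Real_Asymp.Real_Asymp"
begin

text \<open>
  Put \<open>s = 1/2 + i t\<close> and \<open>q = exp (- pi u)\<close>. Then \<open>Ghat t\<close> is the integral of
  \<open>exp (s v) \<alpha>(exp v) \<beta>(exp (- v))\<close> over the real line. The Jacobi theta function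
  \<open>\<theta>4 = \<Sum> (-1)^n q^(n^2)\<close> satisfies \<open>d\<theta>4/du = 2 pi \<alpha> \<theta>4\<close> (logarithmic derivative of its product), and
  \<open>\<beta> = \<theta>2^4 / 16\<close>, so theta inversion gives \<open>\<beta>(1/u) = u^2 \<theta>4(u)^4 / 16\<close>. Hence \<open>\<alpha>(u) \<beta>(1/u)\<close> is
  \<open>u^2 / (128 pi)\<close> times the derivative of \<open>\<theta>4^4\<close>, and an integration by parts for \<open>Re s < -3\<close> turns
  \<open>Ghat\<close> into the Mellin transform of \<open>\<beta>\<close> at \<open>1 - s\<close>. This is
  \<open>\<Gamma>(1-s) \<zeta>(1-s) \<zeta>(-s)\<close> times an entire function. Since \<open>Ghat\<close> is entire, the formula
  persists for all \<open>s\<close> by analytic continuation, and the functional equation makes it vanish at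
  every nonreal zero of \<open>\<zeta>\<close>. The Bessel series arises by integrating the double series for
  \<open>\<alpha>(exp v) \<beta>(exp (- v))\<close> term by term.

  The identity \<open>\<beta> = \<theta>2^4 / 16\<close> is Jacobi's: \<open>4 \<beta>\<close> is the logarithmic derivative of \<open>\<theta>3 / \<theta>4\<close>, and
  the Wronskian of \<open>\<theta>3\<close> and \<open>\<theta>4\<close>, a sum over \<open>(m, n)\<close>, factors after the substitution
  \<open>x = m - n\<close>, \<open>y = m + n\<close> into the square of the series for the cube of the Euler product.
\<close>

subsection \<open>Sums over products and divisors\<close>

text \<open>Three classical facts must be supplied before the argument can start:
  \<open>zeta\<close> is a definite description, so a continuation has to be constructed;
  \<open>bessel_K\<close> is given by power series, whereas term-by-term integration produces
  exponential integrals; and theta inversion rests on Poisson summation. Mellin integrals are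
  written in \<open>v\<close> with \<open>u = exp v\<close>: they run over the whole line, powers of
  \<open>u\<close> become exponentials entire in \<open>s\<close>, scalings of \<open>u\<close>
  become translations, and passing to \<open>1 / u\<close> becomes a reflection. The obstacle is
  that the integration by parts and the Dirichlet series of \<open>b\<close> are available only far
  to the left, while the formula is wanted at the zeros. It is therefore multiplied by
  \<open>rGamma (1 - s)\<close>, so that both sides are holomorphic away from \<open>0\<close> and
  \<open>-1\<close>, and carried over by the identity theorem. The zeros enter only through being
  nonreal: the reflected point is again a zero and annihilates one zeta factor. Double series are
  treated as unordered sums over pairs \<open>(d, l)\<close>, which may be regrouped by
  \<open>j = d * l\<close>.\<close>

lemma abs_summable_on_product:
  fixes f :: "'a \<Rightarrow> 'c :: {real_normed_field, banach}"
  assumes "(\<lambda>x. norm (f x)) summable_on A" "(\<lambda>x. norm (g x)) summable_on B"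
  shows "(\<lambda>z. norm (case z of (x, y) \<Rightarrow> f x * g y)) summable_on (A \<times> B)"
proof -
  have "(\<lambda>(x, y). norm (f x) * norm (g y)) summable_on (A \<times> B)"
  proof (rule summable_on_SigmaI)
    show "((\<lambda>y. case (x, y) of (x, y) \<Rightarrow> norm (f x) * norm (g y)) has_sum
            norm (f x) * infsum (\<lambda>y. norm (g y)) B) B" for x
      using assms(2) by (auto intro!: has_sum_cmult_right)
    show "(\<lambda>x. norm (f x) * infsum (\<lambda>y. norm (g y)) B) summable_on A"
      using assms(1) by (intro summable_on_cmult_left)
  qed auto
  then show ?thesis
    by (simp add: case_prod_unfold norm_mult)
qed

lemma has_sum_product:
  fixes f :: "'a \<Rightarrow> 'c :: {real_normed_field, banach}"
  assumes "(f has_sum a) A" "(g has_sum b) B"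
  assumes "(\<lambda>x. norm (f x)) summable_on A" "(\<lambda>x. norm (g x)) summable_on B"
  shows "((\<lambda>(x, y). f x * g y) has_sum (a * b)) (A \<times> B)"
proof (rule has_sum_SigmaI)
  show "((\<lambda>y. case (x, y) of (x, y) \<Rightarrow> f x * g y) has_sum f x * b) B" for x
    using assms(2) by (auto intro!: has_sum_cmult_right)
  show "((\<lambda>x. f x * b) has_sum a * b) A"
    using assms(1) by (intro has_sum_cmult_left)
  show "(\<lambda>(x, y). f x * g y) summable_on A \<times> B"
    using abs_summable_on_product[OF assms(3,4)] by (rule abs_summable_summable)
qed

lemma has_sum_diff:
  fixes f g :: "'a \<Rightarrow> 'b :: {topological_ab_group_add}"
  assumes "(f has_sum a) A" "(g has_sum b) A"
  shows "((\<lambda>x. f x - g x) has_sum (a - b)) A"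
proof -
  have "((\<lambda>x. - g x) has_sum - b) A" using assms(2) by (simp add: has_sum_uminus)
  from has_sum_add[OF assms(1) this] show ?thesis by simp
qed

lemma has_sum_divisors_iff:
  fixes f :: "nat \<Rightarrow> nat \<Rightarrow> 'a :: {topological_comm_monoid_add, t3_space}"
  shows "((\<lambda>(d, l). f d l) has_sum S) ({1..} \<times> {1..}) \<longleftrightarrow>
         ((\<lambda>(n, d). f d (n div d)) has_sum S) (SIGMA n:{1..}. {d. d dvd n})"
  by (rule has_sum_reindex_bij_witness[where i = "\<lambda>(n, d). (d, n div d)" and j = "\<lambda>(d, l). (d * l, d)"])
     (auto simp: dvd_pos_nat Suc_le_eq elim!: dvdE)

lemma has_sum_divisors:
  fixes f :: "nat \<Rightarrow> nat \<Rightarrow> 'a :: {topological_comm_monoid_add, t3_space}"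
  assumes "((\<lambda>(d, l). f d l) has_sum S) ({1..} \<times> {1..})"
  shows "((\<lambda>n. \<Sum>d | d dvd n. f d (n div d)) has_sum S) {1..}"
  using assms unfolding has_sum_divisors_iff
  by (rule has_sum_SigmaD) (auto intro!: has_sum_finite finite_divisors_nat)

lemma has_sum_nat_from_1_iff: "(f has_sum S) {1..} \<longleftrightarrow> ((\<lambda>n. f (Suc n)) has_sum S) UNIV"
  by (rule has_sum_reindex_bij_witness[where i = Suc and j = "\<lambda>n. n - 1"]) auto

section \<open>Growth of the coefficients and linear relations between them\<close>

lemma sigma1_le: "sigma1 n \<le> n ^ 2"
proof (cases "n = 0")
  case False
  have "sigma1 n \<le> (\<Sum>d \<in> {1..n}. n)"
    unfolding sigma1_def by (rule sum_le_included[where i = id])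
      (use False in \<open>auto simp: dvd_imp_le dvd_pos_nat Suc_le_eq\<close>)
  then show ?thesis by (simp add: power2_eq_square)
qed (simp add: sigma1_def)

lemma sigma1_0 [simp]: "sigma1 0 = 0"
  by (simp add: sigma1_def)

text \<open>With \<open>n = 2 ^ k * m\<close> and \<open>m\<close> odd, \<open>sigma1 n\<close> is
  \<open>(2 ^ (k + 1) - 1) * sigma1 m\<close>, and subtracting the value at \<open>n div 2\<close>
  leaves \<open>2 ^ k * sigma1 m\<close>. On generating functions this gives a difference of
  \<open>sigma_series\<close> at \<open>q\<close> and at \<open>q\<^sup>2\<close>, which is what the
  derivative of an Euler quotient produces.\<close>

lemma a_coeff_eq: "real (a_coeff n) = real (sigma1 n) - (if even n then real (sigma1 (n div 2)) else 0)"
proof (cases "n = 0")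
  case False
  define k where "k = multiplicity 2 n"
  obtain m where m: "n = 2 ^ k * m" "odd m"
    using False multiplicity_decompose'[of n 2] by (auto simp: k_def)
  have s2: "real (sigma1 (2 ^ j)) = 2 ^ (j + 1) - 1" for j
  proof -
    have "{d::nat. d dvd 2 ^ j} = (\<lambda>i. 2 ^ i) ` {..j}"
      by (auto simp: divides_primepow_nat[of 2])
    then have "sigma1 (2 ^ j) = (\<Sum>i\<le>j. 2 ^ i)"
      unfolding sigma1_def by (simp add: sum.reindex inj_on_def)
    then have "real (sigma1 (2 ^ j)) = (\<Sum>i\<le>j. 2 ^ i)"
      by simp
    then show ?thesis
      by (simp add: geometric_sum lessThan_Suc_atMost[symmetric] del: sum.lessThan_Suc)
  qed
  have s: "real (sigma1 (2 ^ j * m)) = (2 ^ (j + 1) - 1) * real (sigma1 m)" for j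
    using m(2) by (subst sigma1_mult) (auto simp: s2)
  have "real (a_coeff n) = 2 ^ k * real (sigma1 m)"
    using m by (subst m(1), subst a_coeff_mult) (auto simp: a_coeff_power_2 a_coeff_odd)
  moreover have "n div 2 = 2 ^ (k - 1) * m" "k > 0" if "even n"
    using that m by (cases k; auto)+
  moreover have "k = 0" if "odd n" using that m by (cases k) auto
  ultimately show ?thesis
    using m s[of k] s[of "k - 1"] by (cases k) (auto simp: algebra_simps)
qed (simp add: a_coeff_def)

text \<open>For even \<open>n\<close> the relation \<open>a n = 2 * a (n div 2)\<close> holds, so
  \<open>b\<close> is \<open>a n\<close> minus twice \<open>a (n div 2)\<close>, the second term
  being present for even \<open>n\<close> only. Inserting \<open>a_coeff_eq\<close> twice yields the
  weights 1, -3, 2.\<close>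

lemma b_coeff_eq:
  "real (b_coeff n) = real (sigma1 n) - 3 * (if even n then real (sigma1 (n div 2)) else 0)
     + 2 * (if 4 dvd n then real (sigma1 (n div 4)) else 0)"
proof (cases "even n")
  case True
  define a where "a = (\<lambda>n. real (a_coeff n))"
  have "a n = 2 * a (n div 2)"
  proof (cases "n = 0")
    case False
    then have "multiplicity 2 n = Suc (multiplicity 2 (n div 2))"
      using True by (auto elim!: evenE simp: multiplicity_times_same)
    then show ?thesis using False
      by (auto simp: a_def a_coeff_def div_mult2_eq)
  qed (simp add: a_def a_coeff_def)
  moreover have "even (n div 2) \<longleftrightarrow> 4 dvd n" using True by presburger
  moreover have "n div 2 div 2 = n div 4" by presburger
  ultimately show ?thesis using True unfolding a_def a_coeff_eq
    by (auto simp: b_coeff_def)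
next
  case False
  moreover from this have "\<not> 4 dvd n" by presburger
  ultimately show ?thesis by (simp add: b_coeff_def)
qed

subsection \<open>Interchanging sums and integrals\<close>

text \<open>Enumerating the index set by \<open>to_nat\<close> and padding with zeros off its image
  reduces this to the exchange theorem for \<open>suminf\<close>. Countable index types are allowed
  because the sums to come range over integers and over pairs.\<close>

lemma has_sum_integral:
  fixes f :: "'i::countable \<Rightarrow> 'a \<Rightarrow> 'b::{banach, second_countable_topology}"
  assumes int: "\<And>i. i \<in> A \<Longrightarrow> integrable M (f i)"
    and pw: "\<And>x. x \<in> space M \<Longrightarrow> (\<lambda>i. norm (f i x)) summable_on A"
    and sm: "(\<lambda>i. \<integral>x. norm (f i x) \<partial>M) summable_on A"
  shows "integrable M (\<lambda>x. \<Sum>\<^sub>\<infinity>i\<in>A. f i x)"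
    and "((\<lambda>i. \<integral>x. f i x \<partial>M) has_sum (\<integral>x. (\<Sum>\<^sub>\<infinity>i\<in>A. f i x) \<partial>M)) A"
proof -
  define B where "B = to_nat ` A"
  define g where "g = (\<lambda>n x. if n \<in> B then f (from_nat n) x else 0)"
  have reindex: "(h has_sum s) A \<longleftrightarrow> ((\<lambda>n. if n \<in> B then h (from_nat n) else 0) has_sum s) UNIV"
    for h :: "'i \<Rightarrow> 'c::{comm_monoid_add, topological_space}" and s
  proof -
    have "(h has_sum s) A \<longleftrightarrow> ((\<lambda>n. h (from_nat n)) has_sum s) B"
      by (rule has_sum_reindex_bij_witness[where i = from_nat and j = to_nat]) (auto simp: B_def)
    also have "\<dots> \<longleftrightarrow> ((\<lambda>n. if n \<in> B then h (from_nat n) else 0) has_sum s) UNIV"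
      by (rule has_sum_cong_neutral) auto
    finally show ?thesis .
  qed
  have reindex': "h summable_on A \<longleftrightarrow> (\<lambda>n. if n \<in> B then h (from_nat n) else 0) summable_on UNIV"
    for h :: "'i \<Rightarrow> 'c::{comm_monoid_add, topological_space}"
    unfolding summable_on_def reindex ..
  have ng: "norm (g n x) = (if n \<in> B then norm (f (from_nat n) x) else 0)" for n x
    by (simp add: g_def)
  have gint: "integrable M (g n)" for n
    using int by (cases "n \<in> B") (auto simp: g_def B_def)
  have gpw: "summable (\<lambda>n. norm (g n x))" if "x \<in> space M" for x
    using pw[OF that] unfolding reindex' ng by (rule summable_on_imp_summable)
  have gsm: "summable (\<lambda>n. \<integral>x. norm (g n x) \<partial>M)"
  proof -
    have "(\<lambda>n. \<integral>x. norm (g n x) \<partial>M) = (\<lambda>n. if n \<in> B then \<integral>x. norm (f (from_nat n) x) \<partial>M else 0)"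
      by (auto simp: g_def)
    then show ?thesis
      using sm unfolding reindex' by (simp add: summable_on_imp_summable)
  qed
  have gsum: "(\<Sum>n. g n x) = (\<Sum>\<^sub>\<infinity>i\<in>A. f i x)" if "x \<in> space M" for x
  proof -
    have "(\<lambda>i. f i x) summable_on A" using pw[OF that] by (rule abs_summable_summable)
    then have "((\<lambda>i. f i x) has_sum (\<Sum>\<^sub>\<infinity>i\<in>A. f i x)) A" by simp
    then show ?thesis unfolding reindex
      by (auto simp: g_def dest!: has_sum_imp_sums simp: sums_iff)
  qed
  have "integrable M (\<lambda>x. \<Sum>n. g n x)"
    by (rule integrable_suminf) (use gint gpw gsm in auto)
  then show "integrable M (\<lambda>x. \<Sum>\<^sub>\<infinity>i\<in>A. f i x)"
    by (subst Bochner_Integration.integrable_cong[OF refl, where g = "\<lambda>x. \<Sum>n. g n x"]) (auto simp: gsum)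
  have "(\<lambda>n. \<integral>x. g n x \<partial>M) sums (\<integral>x. (\<Sum>n. g n x) \<partial>M)"
    by (rule sums_integral) (use gint gpw gsm in auto)
  moreover have "(\<integral>x. (\<Sum>n. g n x) \<partial>M) = (\<integral>x. (\<Sum>\<^sub>\<infinity>i\<in>A. f i x) \<partial>M)"
    by (rule Bochner_Integration.integral_cong) (auto simp: gsum)
  moreover have "summable (\<lambda>n. norm (\<integral>x. g n x \<partial>M))"
    by (rule summable_comparison_test'[OF gsm]) (auto intro: integral_norm_bound)
  ultimately have "((\<lambda>n. \<integral>x. g n x \<partial>M) has_sum (\<integral>x. (\<Sum>\<^sub>\<infinity>i\<in>A. f i x) \<partial>M)) UNIV"
    by (simp add: norm_summable_imp_has_sum)
  moreover have "(\<lambda>n. \<integral>x. g n x \<partial>M) = (\<lambda>n. if n \<in> B then \<integral>x. f (from_nat n) x \<partial>M else 0)"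
    by (auto simp: g_def)
  ultimately show "((\<lambda>i. \<integral>x. f i x \<partial>M) has_sum (\<integral>x. (\<Sum>\<^sub>\<infinity>i\<in>A. f i x) \<partial>M)) A"
    unfolding reindex by simp
qed

text \<open>Finite sums of the integrated norms are bounded by the integral of \<open>F\<close>, and
  a nonnegative family with bounded finite sums is summable. It supplies the last hypothesis of
  \<open>has_sum_integral\<close>.\<close>

lemma summable_on_integral_dominated:
  fixes f :: "'i \<Rightarrow> 'a \<Rightarrow> 'b::{banach, second_countable_topology}"
  assumes int: "\<And>i. i \<in> A \<Longrightarrow> integrable M (f i)"
    and pw: "\<And>x. x \<in> space M \<Longrightarrow> ((\<lambda>i. norm (f i x)) has_sum F x) A"
    and F: "integrable M F"
  shows "(\<lambda>i. \<integral>x. norm (f i x) \<partial>M) summable_on A"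
proof (rule nonneg_bdd_above_summable_on)
  show "bdd_above (sum (\<lambda>i. \<integral>x. norm (f i x) \<partial>M) ` {X. X \<subseteq> A \<and> finite X})"
  proof (rule bdd_aboveI2)
    fix X assume X: "X \<in> {X. X \<subseteq> A \<and> finite X}"
    have "(\<Sum>i\<in>X. \<integral>x. norm (f i x) \<partial>M) = (\<integral>x. (\<Sum>i\<in>X. norm (f i x)) \<partial>M)"
      using X int by (subst Bochner_Integration.integral_sum) auto
    also have "\<dots> \<le> (\<integral>x. F x \<partial>M)"
      using X int F by (intro integral_mono Bochner_Integration.integrable_sum integrable_norm)
        (auto intro!: finite_sum_le_has_sum[OF pw])
    finally show "(\<Sum>i\<in>X. \<integral>x. norm (f i x) \<partial>M) \<le> (\<integral>x. F x \<partial>M)" .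
  qed
qed auto

subsection \<open>Series over the integers\<close>

lemma summable_power_times_geometric:
  fixes q :: real
  assumes "\<bar>q\<bar> < 1"
  shows "summable (\<lambda>n. real n ^ k * q ^ n)"
proof (rule root_test_convergence)
  have "(\<lambda>n. root n (real n) ^ k * \<bar>q\<bar>) \<longlonglongrightarrow> 1 ^ k * \<bar>q\<bar>"
    by (intro tendsto_intros LIMSEQ_root)
  moreover have "eventually (\<lambda>n. root n (real n) ^ k * \<bar>q\<bar> = root n (norm (real n ^ k * q ^ n))) sequentially"
    using eventually_gt_at_top[of 0]
  proof eventually_elim
    case (elim n)
    then show ?case
      by (simp add: abs_mult power_abs real_root_mult real_root_power real_root_power_cancel)
  qed
  ultimately show "(\<lambda>n. root n (norm (real n ^ k * q ^ n))) \<longlonglongrightarrow> \<bar>q\<bar>"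
    by (auto intro: Lim_transform_eventually)
qed fact

lemma summable_on_int_cases:
  fixes f :: "int \<Rightarrow> real"
  assumes "(\<lambda>n::nat. f (int n)) summable_on UNIV" "(\<lambda>n::nat. f (- int n)) summable_on UNIV"
  shows "f summable_on UNIV"
proof -
  have "f summable_on range int" "f summable_on range (\<lambda>n. - int n)"
    using assms by (subst summable_on_reindex; simp add: inj_on_def o_def)+
  then have "f summable_on (range int \<union> range (\<lambda>n. - int n))"
    using summable_on_union by blast
  moreover have "range int \<union> range (\<lambda>n. - int n) = UNIV"
  proof -
    have "x \<in> range int \<union> range (\<lambda>n. - int n)" for x
      by (cases x rule: int_cases2) auto
    then show ?thesis by blast
  qed
  ultimately show ?thesis by simp
qed

lemma summable_on_int_geometric:
  fixes q :: real
  assumes "0 < q" "q < 1"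
  shows "(\<lambda>j::int. real_of_int \<bar>j\<bar> ^ k * q ^ nat \<bar>j\<bar>) summable_on UNIV"
proof -
  have "(\<lambda>n. real n ^ k * q ^ n) summable_on UNIV"
    using summable_power_times_geometric[of q k] assms
    by (intro norm_summable_imp_summable_on) (simp add: abs_mult)
  then show ?thesis
    by (intro summable_on_int_cases) simp_all
qed

text \<open>Dominated convergence for the counting measure on the integers; it carries the finite
  triple product over to the infinite series.\<close>

lemma tannery_int:
  fixes f :: "nat \<Rightarrow> int \<Rightarrow> real"
  assumes "\<And>j. (\<lambda>n. f n j) \<longlonglongrightarrow> g j" "\<And>n j. \<bar>f n j\<bar> \<le> M j" "M summable_on UNIV"
  shows "(\<lambda>n. infsum (f n) UNIV) \<longlonglongrightarrow> infsum g UNIV" "g summable_on UNIV"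
proof -
  have M: "integrable (count_space UNIV) M"
    using assms(3) summable_on_iff_abs_summable_on_real abs_summable_equivalent
    by (metis Infinite_Set_Sum.abs_summable_on_def)
  have conv: "infsum h UNIV = integral\<^sup>L (count_space UNIV) h \<and> h summable_on UNIV"
    if "integrable (count_space UNIV) h" for h :: "int \<Rightarrow> real"
    using that infsetsum_infsum[of h UNIV] abs_summable_equivalent[of h UNIV]
    by (simp add: Infinite_Set_Sum.abs_summable_on_def infsetsum_def abs_summable_summable)
  have 1: "integrable (count_space UNIV) g"
    by (rule integrable_dominated_convergence[OF _ _ M, where s = f]) (use assms in auto)
  have 2: "integrable (count_space UNIV) (f n)" for n
    by (rule Bochner_Integration.integrable_bound[OF M])
       (use assms in \<open>auto simp: AE_count_space intro: order_trans[OF _ abs_ge_self]\<close>)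
  have "(\<lambda>n. integral\<^sup>L (count_space UNIV) (f n)) \<longlonglongrightarrow> integral\<^sup>L (count_space UNIV) g"
    by (rule integral_dominated_convergence[OF _ _ M]) (use assms in auto)
  then show "(\<lambda>n. infsum (f n) UNIV) \<longlonglongrightarrow> infsum g UNIV"
    using conv 1 2 by simp
  show "g summable_on UNIV" using conv 1 by blast
qed

subsection \<open>The Euler function\<close>

text \<open>The product of all \<open>1 - q ^ n\<close> with \<open>n \<ge> 1\<close>, encoded
  through its logarithm. In this form positivity is immediate and the logarithmic derivative is
  \<open>sigma_series\<close> up to the factor \<open>- 1 / q\<close>; \<open>qpoch_tendsto\<close>
  recovers the product.\<close>

definition euler_fun :: "real \<Rightarrow> real" where
  "euler_fun q = exp (- (\<Sum>n. real (sigma1 n) / real n * q ^ n))"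

lemma euler_fun_pos: "euler_fun q > 0"
  by (simp add: euler_fun_def)

lemma summable_sigma1:
  fixes q :: real
  assumes "\<bar>q\<bar> < 1"
  shows "summable (\<lambda>n. real (sigma1 n) * q ^ n)"
proof (rule summable_comparison_test')
  show "summable (\<lambda>n. real n ^ 2 * \<bar>q\<bar> ^ n)"
    using assms by (intro summable_power_times_geometric) auto
  show "norm (real (sigma1 n) * q ^ n) \<le> real n ^ 2 * \<bar>q\<bar> ^ n" for n
    using sigma1_le[of n] by (auto simp: abs_mult power_abs intro!: mult_right_mono
        simp flip: of_nat_power)
qed

lemma summable_sigma1_div:
  fixes q :: real
  assumes "\<bar>q\<bar> < 1"
  shows "summable (\<lambda>n. real (sigma1 n) / real n * q ^ n)"
proof (rule summable_comparison_test')
  show "summable (\<lambda>n. \<bar>real (sigma1 n) * \<bar>q\<bar> ^ n\<bar>)"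
    using summable_sigma1[of "\<bar>q\<bar>"] assms by (simp add: abs_mult)
  show "norm (real (sigma1 n) / real n * q ^ n) \<le> \<bar>real (sigma1 n) * \<bar>q\<bar> ^ n\<bar>" for n
  proof -
    have "real (sigma1 n) / real n * \<bar>q\<bar> ^ n \<le> real (sigma1 n) / 1 * \<bar>q\<bar> ^ n"
      by (cases "n = 0") (auto intro!: mult_right_mono divide_left_mono simp del: times_divide_eq_left div_by_1)
    then show ?thesis by (simp add: abs_mult power_abs)
  qed
qed

text \<open>Expand \<open>- ln (1 - q ^ k)\<close> into terms \<open>q ^ (k * m) / m\<close> and
  group by \<open>n = k * m\<close>: since \<open>1 / m = k / n\<close>, the divisors
  \<open>k\<close> of \<open>n\<close> contribute \<open>sigma1 n / n\<close>.\<close>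

lemma has_sum_ln_euler:
  fixes q :: real
  assumes "0 < q" "q < 1"
  shows "((\<lambda>k. ln (1 - q ^ k)) has_sum - (\<Sum>n. real (sigma1 n) / real n * q ^ n)) {1..}"
proof -
  define f where "f = (\<lambda>k m. q ^ (k * m) / real m)"
  define s where "s = (\<Sum>n. real (sigma1 n) / real n * q ^ n)"
  have div: "(\<Sum>d | d dvd n. f d (n div d)) = real (sigma1 n) / real n * q ^ n" if "n \<ge> 1" for n
  proof -
    have "(\<Sum>d | d dvd n. f d (n div d)) = (\<Sum>d | d dvd n. real d * (q ^ n / real n))"
      by (rule sum.cong) (use that in \<open>auto simp: f_def elim!: dvdE\<close>)
    also have "\<dots> = real (sigma1 n) * (q ^ n / real n)"
      by (simp only: sigma1_def sum_distrib_right of_nat_sum)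
    finally show ?thesis by simp
  qed
  have "(\<lambda>n. real (sigma1 n) / real n * q ^ n) sums s"
    unfolding s_def using assms by (intro summable_sums summable_sigma1_div) auto
  then have "((\<lambda>n. real (sigma1 n) / real n * q ^ n) has_sum s) UNIV"
    using assms by (intro norm_summable_imp_has_sum) (auto simp: abs_mult sums_iff)
  then have S: "((\<lambda>n. real (sigma1 n) / real n * q ^ n) has_sum s) {1..}"
    by (rule has_sum_cong_neutral[THEN iffD1, rotated -1]) (auto simp: Suc_le_eq)
  \<comment> \<open>Summability over pairs is established on the grouped side, where the inner sums
    are already known and all terms are nonnegative, and then transported to the product
    set.\<close>
  have "(\<lambda>(n, d). f d (n div d)) summable_on (SIGMA n:{1..}. {d. d dvd n})"
  proof (rule summable_on_SigmaI)
    show "((\<lambda>d. case (n, d) of (n, d) \<Rightarrow> f d (n div d)) has_sum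
            real (sigma1 n) / real n * q ^ n) {d. d dvd n}" if "n \<in> {1..}" for n
      using div[of n] that by (auto intro!: has_sum_finiteI finite_divisors_nat)
    show "(\<lambda>n. real (sigma1 n) / real n * q ^ n) summable_on {1..}"
      using S by (rule has_sum_imp_summable)
  qed (use assms in \<open>auto simp: f_def\<close>)
  then obtain S' where S': "((\<lambda>(k, m). f k m) has_sum S') ({1..} \<times> {1..})"
    unfolding summable_on_def has_sum_divisors_iff[symmetric] by blast
  from has_sum_divisors[OF this] have "((\<lambda>n. real (sigma1 n) / real n * q ^ n) has_sum S') {1..}"
    by (rule has_sum_cong[THEN iffD1, rotated]) (use div in auto)
  with S have "S' = s" using has_sum_unique by blast
  have "((\<lambda>k. - ln (1 - q ^ k)) has_sum S') {1..}"
  proof (rule has_sum_SigmaD[OF S'])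
    fix k :: nat assume k: "k \<in> {1..}"
    define x where "x = q ^ k"
    have x: "0 < x" "x < 1" using assms k by (auto simp: x_def power_Suc_less_one power_less_one_iff)
    have sums: "(\<lambda>n. x ^ n / real n) sums (- ln (1 - x))"
      using sums_minus[OF ln_series'[of "- x"]] x by simp
    then have "((\<lambda>n. x ^ n / real n) has_sum (- ln (1 - x))) UNIV"
      using x by (intro norm_summable_imp_has_sum) (auto simp: sums_iff)
    then have "((\<lambda>n. x ^ n / real n) has_sum (- ln (1 - x))) {1..}"
      by (rule has_sum_cong_neutral[THEN iffD1, rotated -1]) (auto simp: Suc_le_eq)
    then show "((\<lambda>m. case (k, m) of (k, m) \<Rightarrow> f k m) has_sum - ln (1 - q ^ k)) {1..}"
      by (simp add: f_def x_def power_mult)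
  qed
  then show ?thesis
    using \<open>S' = s\<close> by (auto simp: s_def has_sum_uminus)
qed

section \<open>Partial products of the Euler function\<close>

definition qpoch :: "real \<Rightarrow> nat \<Rightarrow> real" where
  "qpoch q n = (\<Prod>k<n. 1 - q ^ Suc k)"

lemma qpoch_0 [simp]: "qpoch q 0 = 1"
  by (simp add: qpoch_def)

lemma qpoch_pos:
  assumes "0 < q" "q < 1"
  shows "qpoch q n > 0"
  unfolding qpoch_def using assms by (intro prod_pos) (auto simp: power_Suc_less_one simp del: power_Suc)

lemma qpoch_tendsto:
  assumes "0 < q" "q < 1"
  shows "qpoch q \<longlonglongrightarrow> euler_fun q"
proof -
  have "((\<lambda>k. ln (1 - q ^ Suc k)) has_sum - (\<Sum>n. real (sigma1 n) / real n * q ^ n)) UNIV"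
    using has_sum_ln_euler[OF assms] by (simp only: has_sum_nat_from_1_iff)
  then have "(\<lambda>n. exp (\<Sum>k<n. ln (1 - q ^ Suc k))) \<longlonglongrightarrow> euler_fun q"
    unfolding euler_fun_def by (intro tendsto_intros) (simp add: has_sum_imp_sums sums_def[symmetric])
  moreover have "exp (\<Sum>k<n. ln (1 - q ^ Suc k)) = qpoch q n" for n
    unfolding exp_sum[OF finite_lessThan] qpoch_def
    by (rule prod.cong) (use assms in \<open>auto simp: power_Suc_less_one simp del: power_Suc\<close>)
  ultimately show ?thesis by simp
qed

lemma qpoch_bounds:
  assumes "0 < q" "q < 1"
  shows "qpoch q n \<le> 1" "euler_fun q \<le> qpoch q n"
proof -
  show "qpoch q n \<le> 1"
    unfolding qpoch_def by (intro prod_le_1) (use assms in \<open>auto intro!: power_le_one simp del: power_Suc\<close>)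
  have "decseq (qpoch q)"
  proof (rule decseq_SucI)
    fix n
    have "qpoch q n * (1 - q ^ Suc n) \<le> qpoch q n * 1"
      using assms qpoch_pos[OF assms, of n] by (intro mult_left_mono) auto
    then show "qpoch q (Suc n) \<le> qpoch q n" by (simp add: qpoch_def)
  qed
  then show "euler_fun q \<le> qpoch q n"
    using qpoch_tendsto[OF assms] decseq_ge by blast
qed

subsection \<open>Finite forms of the triple product\<close>

definition gauss_binomial :: "real \<Rightarrow> nat \<Rightarrow> nat \<Rightarrow> real" where
  "gauss_binomial q N k = (if k \<le> N then qpoch q N / (qpoch q k * qpoch q (N - k)) else 0)"

text \<open>One of the two q-Pascal rules, the one that fits a factor appended at the end of the
  product. After clearing denominators it is \<open>1 - A * B = (1 - B) + B * (1 - A)\<close> for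
  \<open>A = q ^ Suc k\<close> and \<open>B = q ^ (N - k)\<close>.\<close>

lemma gauss_binomial_Suc:
  assumes "0 < q" "q < 1" "k \<le> N"
  shows "gauss_binomial q (Suc N) (Suc k) =
           gauss_binomial q N (Suc k) + q ^ (N - k) * gauss_binomial q N k"
proof (cases "k = N")
  case True
  then show ?thesis
    using qpoch_pos[OF assms(1,2), of N] qpoch_pos[OF assms(1,2), of "Suc N"]
    by (simp add: gauss_binomial_def)
next
  case False
  then obtain m where m: "N = k + Suc m"
    using assms(3) by (metis add_Suc_right le_neq_implies_less less_imp_Suc_add)
  have S: "qpoch q (Suc n) = qpoch q n * (1 - q ^ Suc n)" for n
    by (simp add: qpoch_def)
  have nz: "qpoch q n \<noteq> 0" "1 - q ^ Suc n \<noteq> 0" for n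
    using qpoch_pos[OF assms(1,2), of n] power_Suc_less_one[OF assms(1,2), of n] by auto
  define A where "A = q ^ Suc k"
  define B where "B = q ^ Suc m"
  have AB: "q ^ Suc N = A * B" by (simp add: A_def B_def m power_add)
  have ne: "1 - A \<noteq> 0" "1 - B \<noteq> 0" using nz(2) by (auto simp: A_def B_def)
  have 1: "gauss_binomial q (Suc N) (Suc k) = qpoch q N * (1 - A * B) / ((qpoch q k * (1 - A)) * (qpoch q m * (1 - B)))"
    using AB unfolding gauss_binomial_def S by (simp add: m S A_def B_def)
  have 2: "gauss_binomial q N (Suc k) = qpoch q N / ((qpoch q k * (1 - A)) * qpoch q m)"
    using m by (simp add: gauss_binomial_def S A_def)
  have 3: "gauss_binomial q N k = qpoch q N / (qpoch q k * (qpoch q m * (1 - B)))"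
    using m by (simp add: gauss_binomial_def S B_def)
  have 4: "q ^ (N - k) = B" using m by (simp add: B_def)
  show ?thesis
    unfolding 1 2 3 4 using ne nz(1)[of k] nz(1)[of m] by (simp add: divide_simps) (simp add: algebra_simps)
qed

text \<open>Induction on \<open>N\<close> with new factor \<open>1 + x * q ^ N\<close>. Splitting
  \<open>q ^ N\<close> into \<open>q ^ (N - k)\<close> and \<open>q ^ k\<close>, the first part
  enters the Pascal rule and the second turns the triangular exponent of \<open>k\<close> into that
  of \<open>Suc k\<close>.\<close>

lemma gauss_binomial_theorem:
  fixes x :: "'a :: real_normed_field"
  assumes "0 < q" "q < 1"
  shows "(\<Prod>i<N. 1 + x * of_real q ^ i) =
           (\<Sum>k\<le>N. of_real (gauss_binomial q N k) * of_real q ^ (k * (k - 1) div 2) * x ^ k)"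
proof (induction N)
  case 0
  then show ?case by (simp add: gauss_binomial_def qpoch_def)
next
  case (Suc N)
  define c where "c = (\<lambda>k. of_real q ^ (k * (k - 1) div 2) * x ^ k)"
  define g where "g = (\<lambda>N k. of_real (gauss_binomial q N k) :: 'a)"
  have c: "x * of_real q ^ k * c k = c (Suc k)" for k
  proof -
    have "Suc k * k = k * (k - 1) + 2 * k" by (cases k) auto
    then have "Suc k * k div 2 = k * (k - 1) div 2 + k" by simp
    then show ?thesis by (simp add: c_def power_add)
  qed
  have g0: "g N 0 = 1" for N
    using qpoch_pos[OF assms, of N] by (simp add: g_def gauss_binomial_def)
  have gS: "g (Suc N) (Suc k) = g N (Suc k) + of_real q ^ (N - k) * g N k" if "k \<le> N" for k
    using gauss_binomial_Suc[OF assms that] by (simp add: g_def)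
  have "(\<Sum>k\<le>Suc N. g (Suc N) k * c k) = 1 * c 0 + (\<Sum>k\<le>N. g (Suc N) (Suc k) * c (Suc k))"
    by (subst sum.atMost_Suc_shift) (simp add: g0)
  also have "(\<Sum>k\<le>N. g (Suc N) (Suc k) * c (Suc k)) =
        (\<Sum>k\<le>N. g N (Suc k) * c (Suc k)) + (\<Sum>k\<le>N. of_real q ^ (N - k) * g N k * c (Suc k))"
    unfolding sum.distrib[symmetric] by (rule sum.cong) (auto simp: gS algebra_simps)
  also have "1 * c 0 + (\<dots>) = (\<Sum>k\<le>Suc N. g N k * c k) + (\<Sum>k\<le>N. of_real q ^ (N - k) * g N k * c (Suc k))"
    by (subst sum.atMost_Suc_shift) (simp add: g0)
  also have "(\<Sum>k\<le>N. of_real q ^ (N - k) * g N k * c (Suc k)) = x * of_real q ^ N * (\<Sum>k\<le>N. g N k * c k)"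
    unfolding sum_distrib_left
  proof (rule sum.cong)
    fix k assume "k \<in> {..N}"
    then have "of_real q ^ N = of_real q ^ (N - k) * (of_real q ^ k :: 'a)"
      by (simp flip: power_add)
    then show "of_real q ^ (N - k) * g N k * c (Suc k) = x * of_real q ^ N * (g N k * c k)"
      by (simp add: c[symmetric])
  qed auto
  also have "(\<Sum>k\<le>Suc N. g N k * c k) = (\<Sum>k\<le>N. g N k * c k)"
    by (simp add: g_def gauss_binomial_def)
  finally have "(\<Sum>k\<le>Suc N. g (Suc N) k * c k) = (\<Sum>k\<le>N. g N k * c k) * (1 + x * of_real q ^ N)"
    by (simp add: algebra_simps)
  then show ?case
    using Suc.IH by (simp add: g_def c_def mult.assoc)
qed

text \<open>Uniform in \<open>N\<close> and \<open>k\<close>, as the dominated passage to the limit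
  in \<open>triple_product_limit\<close> demands.\<close>

lemma gauss_binomial_bound:
  assumes "0 < q" "q < 1"
  shows "\<bar>gauss_binomial q N k\<bar> \<le> 1 / euler_fun q ^ 2"
proof (cases "k \<le> N")
  case True
  have "qpoch q N / (qpoch q k * qpoch q (N - k)) \<le> 1 / (euler_fun q * euler_fun q)"
    using qpoch_bounds[OF assms] euler_fun_pos[of q] qpoch_pos[OF assms]
    by (intro frac_le mult_mono mult_pos_pos) (auto intro: less_imp_le)
  then show ?thesis
    using True qpoch_pos[OF assms] by (simp add: gauss_binomial_def power2_eq_square less_imp_le)
qed (simp add: gauss_binomial_def)

lemma prod_lessThan_add:
  fixes f :: "nat \<Rightarrow> 'a :: comm_monoid_mult"
  shows "(\<Prod>i<n + m. f i) = (\<Prod>i<n. f i) * (\<Prod>i<m. f (n + i))"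
  by (induction m) (auto simp: mult.assoc)

text \<open>The q-binomial theorem in base \<open>q\<^sup>2\<close> with \<open>2 * n\<close>
  factors, recentred at the middle index. The upper half of the factors is
  \<open>1 + z * q ^ (2 * i + 1)\<close>; pulling the second summand out of each factor of the lower
  half turns it into \<open>1 + q ^ (2 * i + 1) / z\<close>.\<close>

lemma finite_triple_product:
  fixes q z :: real
  assumes "0 < q" "q < 1" "z \<noteq> 0"
  shows "(\<Prod>k<n. (1 + z * q ^ (2 * k + 1)) * (1 + q ^ (2 * k + 1) / z)) =
         (\<Sum>j\<in>{- int n..int n}. gauss_binomial (q\<^sup>2) (2 * n) (nat (int n + j)) * q powi (j\<^sup>2) * z powi j)"
proof -
  \<comment> \<open>With this start the exponents of \<open>q\<close> run through the odd numbers
    from \<open>1 - 2 * n\<close> to \<open>2 * n - 1\<close>, symmetric about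
    \<open>0\<close>.\<close>
  define x where "x = z * q powi (1 - 2 * int n)"
  have q2: "0 < q\<^sup>2" "q\<^sup>2 < 1" using assms by (auto simp: power_less_one_iff)
  have x: "x * (q\<^sup>2) ^ i = z * q powi (2 * int i + 1 - 2 * int n)" for i
  proof -
    have "(q\<^sup>2) ^ i = q powi (2 * int i)"
      by (metis power_int_of_nat power_mult of_nat_mult of_nat_numeral)
    then show ?thesis
      using assms by (simp add: x_def mult.assoc flip: power_int_add) (simp add: algebra_simps)
  qed
  have rev: "1 + z * q powi (- int m) = z * q powi (- int m) * (1 + q ^ m / z)" for m
    using assms by (simp add: power_int_minus field_simps)
  have "(\<Prod>i<n + n. 1 + x * (q\<^sup>2) ^ i) =
          (\<Prod>i<n. 1 + x * (q\<^sup>2) ^ (n - Suc i)) * (\<Prod>i<n. 1 + x * (q\<^sup>2) ^ (n + i))"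
    unfolding prod_lessThan_add by (subst (2) prod.nat_diff_reindex[symmetric]) simp
  also have "(\<Prod>i<n. 1 + x * (q\<^sup>2) ^ (n + i)) = (\<Prod>i<n. 1 + z * q ^ (2 * i + 1))"
  proof (rule prod.cong)
    fix i
    have "q powi (2 * int (n + i) + 1 - 2 * int n) = q powi int (2 * i + 1)"
      by (rule arg_cong[where f = "\<lambda>k. q powi k"]) simp
    then show "1 + x * (q\<^sup>2) ^ (n + i) = 1 + z * q ^ (2 * i + 1)"
      unfolding x by (simp only: power_int_of_nat)
  qed simp
  also have "(\<Prod>i<n. 1 + x * (q\<^sup>2) ^ (n - Suc i)) =
             (\<Prod>i<n. z * q powi (- int (2 * i + 1)) * (1 + q ^ (2 * i + 1) / z))"
  proof (rule prod.cong)
    fix i assume "i \<in> {..<n}"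
    then have "2 * int (n - Suc i) + 1 - 2 * int n = - int (2 * i + 1)" by auto
    then show "1 + x * (q\<^sup>2) ^ (n - Suc i) = z * q powi (- int (2 * i + 1)) * (1 + q ^ (2 * i + 1) / z)"
      unfolding x using rev[of "2 * i + 1"] by (simp only:)
  qed simp
  also have "\<dots> = z ^ n * q powi (- (int n)\<^sup>2) * (\<Prod>i<n. 1 + q ^ (2 * i + 1) / z)"
  proof -
    have "(\<Prod>i<n. q powi (- int (2 * i + 1))) = q powi (- (int n)\<^sup>2)"
    proof (induction n)
      case (Suc n)
      then show ?case using assms
        by (simp flip: power_int_add) (simp add: power2_eq_square algebra_simps)
    qed simp
    then show ?thesis by (simp add: prod.distrib)
  qed
  finally have 1: "(\<Prod>i<n + n. 1 + x * (q\<^sup>2) ^ i) = z ^ n * q powi (- (int n)\<^sup>2) *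
     (\<Prod>k<n. (1 + z * q ^ (2 * k + 1)) * (1 + q ^ (2 * k + 1) / z))"
    by (simp add: prod.distrib mult_ac)
  have "(\<Prod>i<n + n. 1 + x * (q\<^sup>2) ^ i) =
      (\<Sum>k\<le>n + n. gauss_binomial (q\<^sup>2) (n + n) k * (q\<^sup>2) ^ (k * (k - 1) div 2) * x ^ k)"
    using gauss_binomial_theorem[OF q2, of x "n + n"] by simp
  also have "\<dots> = (\<Sum>j\<in>{- int n..int n}. z ^ n * q powi (- (int n)\<^sup>2) *
     (gauss_binomial (q\<^sup>2) (2 * n) (nat (int n + j)) * q powi (j\<^sup>2) * z powi j))"
  proof (rule sum.reindex_bij_witness[where i = "\<lambda>j. nat (int n + j)" and j = "\<lambda>k. int k - int n"])
    fix k assume k: "k \<in> {..n + n}"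
    define j where "j = int k - int n"
    have "even (k * (k - 1))" by auto
    then have "(q\<^sup>2) ^ (k * (k - 1) div 2) = q ^ (k * (k - 1))"
      by (metis dvd_mult_div_cancel power_mult)
    also have "\<dots> = q powi int (k * (k - 1))" by (simp only: power_int_of_nat)
    also have "int (k * (k - 1)) = int k * (int k - 1)" by (cases k) (auto simp: algebra_simps)
    finally have "(q\<^sup>2) ^ (k * (k - 1) div 2) * x ^ k =
        q powi (int k * (int k - 1)) * q powi ((1 - 2 * int n) * int k) * z ^ k"
      using power_int_mult[of q "1 - 2 * int n" "int k"]
      by (simp add: x_def power_mult_distrib mult_ac)
    also have "\<dots> = q powi (int k * (int k - 1) + (1 - 2 * int n) * int k) * z powi (int k)"
      using assms by (simp add: power_int_add)
    \<comment> \<open>Completing the square around \<open>k = n\<close>: the exponent splits into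
      the constant \<open>- n^2\<close>, which cancels against the power pulled out of the lower
      half, and \<open>j\<^sup>2\<close>.\<close>
    also have "int k * (int k - 1) + (1 - 2 * int n) * int k = - (int n)\<^sup>2 + j\<^sup>2"
      by (simp add: j_def power2_eq_square algebra_simps)
    also have "q powi (- (int n)\<^sup>2 + j\<^sup>2) = q powi (- (int n)\<^sup>2) * q powi (j\<^sup>2)"
      by (rule power_int_add) (use assms in auto)
    also have "z powi int k = z ^ n * z powi j"
      using power_int_add[of z "int n" j] assms by (simp add: j_def)
    finally have "(q\<^sup>2) ^ (k * (k - 1) div 2) * x ^ k =
        z ^ n * q powi (- (int n)\<^sup>2) * (q powi (j\<^sup>2) * z powi j)"
      by (simp only: mult_ac)
    then show "z ^ n * q powi (- (int n)\<^sup>2) * (gauss_binomial (q\<^sup>2) (2 * n) (nat (int n + (int k - int n))) *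
         q powi ((int k - int n)\<^sup>2) * z powi (int k - int n)) =
       gauss_binomial (q\<^sup>2) (n + n) k * (q\<^sup>2) ^ (k * (k - 1) div 2) * x ^ k"
      by (simp add: j_def mult_2 mult.assoc)
  qed auto
  finally show ?thesis
    using assms unfolding 1 sum_distrib_left[symmetric] by simp
qed

lemma qpoch_mult_double: "qpoch q n * (\<Prod>k<n. 1 + q ^ Suc k) = qpoch (q\<^sup>2) n"
  unfolding qpoch_def prod.distrib[symmetric]
  by (rule prod.cong) (auto simp: power_mult_distrib power2_eq_square algebra_simps)

lemma qpoch_even_odd: "qpoch q (2 * n) = qpoch (q\<^sup>2) n * (\<Prod>k<n. 1 - q ^ (2 * k + 1))"
proof (induction n)
  case (Suc n)
  have "qpoch q (2 * Suc n) = qpoch q (2 * n) * (1 - q ^ (2 * n + 1)) * (1 - q ^ (2 * n + 2))"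
    by (simp add: qpoch_def)
  moreover have "(q\<^sup>2) ^ Suc n = q ^ (2 * n + 2)"
    by (simp add: power_mult[symmetric] del: power_Suc)
  ultimately show ?case
    using Suc.IH by (simp add: qpoch_def del: power_Suc)
qed (simp add: qpoch_def)

text \<open>For fixed \<open>j\<close> the central binomial in base \<open>q\<^sup>2\<close> tends
  to \<open>1 / euler_fun (q\<^sup>2)\<close>, so the sums tend to the full series divided by that
  value. The growth condition on \<open>w\<close> leaves room for the linear weight of the cube
  series and for the exponents \<open>j\<^sup>2 + j\<close>.\<close>

lemma triple_product_limit:
  fixes q :: real and w :: "int \<Rightarrow> real"
  assumes q: "0 < q" "q < 1"
  assumes w: "\<And>j. \<bar>w j\<bar> \<le> C * (1 + \<bar>real_of_int j\<bar>) * q powi (j\<^sup>2 - \<bar>j\<bar>)"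
  assumes p: "(\<lambda>n. \<Sum>j\<in>{- int n..int n}. gauss_binomial (q\<^sup>2) (2 * n) (nat (int n + j)) * w j) \<longlonglongrightarrow> L"
  shows "(w has_sum L * euler_fun (q\<^sup>2)) UNIV"
proof -
  define Q where "Q = q\<^sup>2"
  have Q: "0 < Q" "Q < 1" using assms by (auto simp: power_less_one_iff Q_def)
  define f where "f = (\<lambda>n j. if j \<in> {- int n..int n} then gauss_binomial Q (2 * n) (nat (int n + j)) * w j else 0)"
  define g where "g = (\<lambda>j. w j / euler_fun Q)"
  define E where "E = euler_fun Q"
  have E: "E > 0" by (simp add: E_def euler_fun_pos)
  have "(\<lambda>j. real_of_int \<bar>j\<bar> ^ 0 * q ^ nat \<bar>j\<bar>) summable_on UNIV"
       "(\<lambda>j. real_of_int \<bar>j\<bar> ^ 1 * q ^ nat \<bar>j\<bar>) summable_on UNIV"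
    using q by (blast intro: summable_on_int_geometric)+
  then have geo: "(\<lambda>j::int. \<bar>C\<bar> / q * ((1 + \<bar>real_of_int j\<bar>) * q ^ nat \<bar>j\<bar>)) summable_on UNIV"
    by (intro summable_on_cmult_right) (simp add: ring_distribs summable_on_add)
  have wb: "\<bar>w j\<bar> \<le> \<bar>C\<bar> / q * ((1 + \<bar>real_of_int j\<bar>) * q ^ nat \<bar>j\<bar>)" for j
  proof -
    \<comment> \<open>Weakens the quadratic exponent to a linear one, so that a geometric series
      dominates.\<close>
    have "j\<^sup>2 - \<bar>j\<bar> \<ge> \<bar>j\<bar> - 1"
    proof -
      have "(\<bar>j\<bar> - 1)\<^sup>2 \<ge> 0" by simp
      then show ?thesis by (simp add: power2_eq_square algebra_simps)
    qed
    then have "q powi (j\<^sup>2 - \<bar>j\<bar>) \<le> q powi (\<bar>j\<bar> - 1)"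
      using q by (intro power_int_decreasing) auto
    also have "\<dots> = q ^ nat \<bar>j\<bar> / q"
      using q by (simp add: power_int_diff) (simp add: power_int_def)
    finally have "C * (1 + \<bar>real_of_int j\<bar>) * q powi (j\<^sup>2 - \<bar>j\<bar>) \<le> \<bar>C\<bar> * (1 + \<bar>real_of_int j\<bar>) * (q ^ nat \<bar>j\<bar> / q)"
      using q by (intro mult_mono) auto
    with w[of j] show ?thesis by (simp add: field_simps)
  qed
  have lim: "(\<lambda>n. f n j) \<longlonglongrightarrow> g j" for j
  proof -
    define k where "k = nat \<bar>j\<bar>"
    have "(\<lambda>n. qpoch Q (2 * n) / (qpoch Q (nat (int n + j)) * qpoch Q (nat (int n - j))) * w j) \<longlonglongrightarrow>
          E / (E * E) * w j"
      unfolding E_def using E[unfolded E_def]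
      by (intro tendsto_intros filterlim_compose[OF qpoch_tendsto[OF Q]])
         (auto intro!: filterlim_subseq strict_monoI filterlim_at_top_mono[of "\<lambda>n. n - k", OF filterlim_minus_const_nat_at_top]
             always_eventually simp: k_def)
    moreover have "\<forall>\<^sub>F n in sequentially. qpoch Q (2 * n) / (qpoch Q (nat (int n + j)) * qpoch Q (nat (int n - j))) * w j = f n j"
      using eventually_ge_at_top[of k]
    proof eventually_elim
      case (elim n)
      then have "j \<in> {- int n..int n}" by (auto simp: k_def)
      moreover from this have "2 * n - nat (int n + j) = nat (int n - j)" "nat (int n + j) \<le> 2 * n" by auto
      ultimately show ?case by (simp add: f_def gauss_binomial_def)
    qed
    ultimately have "(\<lambda>n. f n j) \<longlonglongrightarrow> E / (E * E) * w j"
      by (rule Lim_transform_eventually)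
    then show ?thesis using E by (simp add: g_def E_def)
  qed
  have bnd: "\<bar>f n j\<bar> \<le> 1 / E\<^sup>2 * (\<bar>C\<bar> / q * ((1 + \<bar>real_of_int j\<bar>) * q ^ nat \<bar>j\<bar>))" for n j
  proof -
    have "\<bar>f n j\<bar> \<le> 1 / E\<^sup>2 * \<bar>w j\<bar>"
      using gauss_binomial_bound[OF Q] by (auto simp: f_def abs_mult E_def intro!: mult_right_mono simp del: times_divide_eq_left)
    also have "\<dots> \<le> 1 / E\<^sup>2 * (\<bar>C\<bar> / q * ((1 + \<bar>real_of_int j\<bar>) * q ^ nat \<bar>j\<bar>))"
      using wb by (intro mult_left_mono) auto
    finally show ?thesis .
  qed
  note T = tannery_int[of f g, OF lim bnd summable_on_cmult_right[OF geo]]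
  have "infsum (f n) UNIV = (\<Sum>j\<in>{- int n..int n}. gauss_binomial (q\<^sup>2) (2 * n) (nat (int n + j)) * w j)" for n
  proof -
    have "infsum (f n) UNIV = infsum (f n) {- int n..int n}"
      by (rule infsum_cong_neutral) (auto simp: f_def)
    then show ?thesis by (simp add: f_def Q_def)
  qed
  then have "infsum g UNIV = L"
    using T(1) p LIMSEQ_unique by auto
  then have "(g has_sum L) UNIV" using T(2) by auto
  then have "((\<lambda>j. g j * E) has_sum L * E) UNIV" by (rule has_sum_cmult_left)
  then show ?thesis using E by (simp add: g_def E_def Q_def)
qed

section \<open>Infinite products and the series they represent\<close>

context
  fixes q :: real
  assumes q: "0 < q" "q < 1"
begin

lemma q_powers: "0 < q\<^sup>2" "q\<^sup>2 < 1" "0 < q ^ 4" "q ^ 4 < 1"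
  using q by (auto simp: power_less_one_iff)

lemma odd_factors_tendsto:
  "(\<lambda>n. \<Prod>k<n. 1 - q ^ (2 * k + 1)) \<longlonglongrightarrow> euler_fun q / euler_fun (q\<^sup>2)"
proof -
  have "(\<lambda>n. qpoch q (2 * n) / qpoch (q\<^sup>2) n) \<longlonglongrightarrow> euler_fun q / euler_fun (q\<^sup>2)"
    using euler_fun_pos[of "q\<^sup>2"]
    by (intro tendsto_divide qpoch_tendsto q q_powers filterlim_compose[OF qpoch_tendsto[OF q]])
       (auto intro!: filterlim_subseq strict_monoI)
  moreover have "qpoch q (2 * n) / qpoch (q\<^sup>2) n = (\<Prod>k<n. 1 - q ^ (2 * k + 1))" for n
    using qpoch_pos[OF q_powers(1,2), of n] by (simp add: qpoch_even_odd del: power_Suc)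
  ultimately show ?thesis by simp
qed

lemma even_plus_factors_tendsto:
  "(\<lambda>n. \<Prod>k<n. 1 + q ^ Suc k) \<longlonglongrightarrow> euler_fun (q\<^sup>2) / euler_fun q"
proof -
  have "(\<lambda>n. qpoch (q\<^sup>2) n / qpoch q n) \<longlonglongrightarrow> euler_fun (q\<^sup>2) / euler_fun q"
    using euler_fun_pos[of q] by (intro tendsto_divide qpoch_tendsto q q_powers) auto
  moreover have "qpoch (q\<^sup>2) n / qpoch q n = (\<Prod>k<n. 1 + q ^ Suc k)" for n
    using qpoch_pos[OF q, of n] by (simp add: qpoch_mult_double[symmetric] del: power_Suc)
  ultimately show ?thesis by simp
qed

end

context
  fixes q :: real
  assumes q: "0 < q" "q < 1"
begin

text \<open>Each factor \<open>1 + y\<close> is \<open>(1 - y\<^sup>2) / (1 - y)\<close>, so the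
  limit of the odd factors is taken both at \<open>q\<close> and at \<open>q\<^sup>2\<close>. That
  second instance is the reason for starting a new context.\<close>

lemma odd_plus_factors_tendsto:
  "(\<lambda>n. \<Prod>k<n. 1 + q ^ (2 * k + 1)) \<longlonglongrightarrow> (euler_fun (q\<^sup>2))\<^sup>2 / (euler_fun q * euler_fun (q ^ 4))"
proof -
  note Q = q_powers[OF q]
  have "(\<lambda>n. (\<Prod>k<n. 1 - (q\<^sup>2) ^ (2 * k + 1)) / (\<Prod>k<n. 1 - q ^ (2 * k + 1))) \<longlonglongrightarrow>
        (euler_fun (q\<^sup>2) / euler_fun ((q\<^sup>2)\<^sup>2)) / (euler_fun q / euler_fun (q\<^sup>2))"
    using euler_fun_pos[of q] euler_fun_pos[of "q\<^sup>2"]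
    by (intro tendsto_divide odd_factors_tendsto q Q) auto
  moreover have "(\<Prod>k<n. 1 - (q\<^sup>2) ^ (2 * k + 1)) / (\<Prod>k<n. 1 - q ^ (2 * k + 1)) = (\<Prod>k<n. 1 + q ^ (2 * k + 1))" for n
    unfolding prod_dividef[symmetric]
  proof (rule prod.cong)
    fix k
    have "q ^ (2 * k + 1) \<noteq> 1" using power_Suc_less_one[OF q, of "2 * k"] by simp
    moreover have "(q\<^sup>2) ^ (2 * k + 1) = (q ^ (2 * k + 1))\<^sup>2" by (simp only: power_mult[symmetric] mult.commute)
    ultimately show "(1 - (q\<^sup>2) ^ (2 * k + 1)) / (1 - q ^ (2 * k + 1)) = 1 + q ^ (2 * k + 1)"
      by (simp add: divide_simps power2_eq_square algebra_simps del: power_Suc)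
  qed simp
  ultimately show ?thesis
    by (simp add: power2_eq_square power4_eq_xxxx mult_ac)
qed

lemma powi_bound:
  assumes "i \<ge> j\<^sup>2 - \<bar>j\<bar>"
  shows "q powi i \<le> 1 * (1 + \<bar>real_of_int j\<bar>) * q powi (j\<^sup>2 - \<bar>j\<bar>)"
proof -
  have "1 * q powi i \<le> (1 + \<bar>real_of_int j\<bar>) * q powi (j\<^sup>2 - \<bar>j\<bar>)"
    using q assms by (intro mult_mono power_int_decreasing) auto
  then show ?thesis by simp
qed

lemma theta4_has_sum:
  "((\<lambda>j::int. (- 1) powi j * q powi (j\<^sup>2)) has_sum (euler_fun q)\<^sup>2 / euler_fun (q\<^sup>2)) UNIV"
proof -
  have "(\<lambda>n. (\<Prod>k<n. 1 - q ^ (2 * k + 1)) * (\<Prod>k<n. 1 - q ^ (2 * k + 1))) \<longlonglongrightarrow>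
          (euler_fun q / euler_fun (q\<^sup>2)) * (euler_fun q / euler_fun (q\<^sup>2))"
    by (intro tendsto_mult odd_factors_tendsto q)
  then have "((\<lambda>j::int. (- 1) powi j * q powi (j\<^sup>2)) has_sum
     (euler_fun q / euler_fun (q\<^sup>2)) * (euler_fun q / euler_fun (q\<^sup>2)) * euler_fun (q\<^sup>2)) UNIV"
    using finite_triple_product[OF q, of "-1"] q powi_bound
    by (intro triple_product_limit[where C = 1] q)
       (simp_all add: prod.distrib mult_ac power_int_minus_left abs_mult power_int_abs)
  then show ?thesis using euler_fun_pos[of "q\<^sup>2"] by (simp add: power2_eq_square)
qed

lemma theta3_has_sum:
  "((\<lambda>j::int. q powi (j\<^sup>2)) has_sum euler_fun (q\<^sup>2) ^ 5 / (euler_fun q * euler_fun (q ^ 4))\<^sup>2) UNIV"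
proof -
  define L where "L = (euler_fun (q\<^sup>2))\<^sup>2 / (euler_fun q * euler_fun (q ^ 4))"
  have "(\<lambda>n. (\<Prod>k<n. 1 + q ^ (2 * k + 1)) * (\<Prod>k<n. 1 + q ^ (2 * k + 1))) \<longlonglongrightarrow> L * L"
    unfolding L_def by (intro tendsto_mult odd_plus_factors_tendsto)
  then have "((\<lambda>j::int. q powi (j\<^sup>2)) has_sum L * L * euler_fun (q\<^sup>2)) UNIV"
    using finite_triple_product[OF q, of 1] q powi_bound
    by (intro triple_product_limit[where C = 1] q) (simp_all add: prod.distrib)
  also have "L * L * euler_fun (q\<^sup>2) = euler_fun (q\<^sup>2) ^ 5 / (euler_fun q * euler_fun (q ^ 4))\<^sup>2"
    unfolding L_def power_divide[symmetric] power2_eq_square[symmetric] times_divide_eq_left[symmetric]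
    by (simp add: power_divide flip: power_Suc2 power_mult)
  finally show ?thesis .
qed

text \<open>The triple product at \<open>z = q\<close>. In classical notation the sum is
  \<open>q^(-1/4)\<close> times \<theta>2.\<close>

lemma theta2_has_sum:
  "((\<lambda>j::int. q powi (j\<^sup>2 + j)) has_sum 2 * (euler_fun (q ^ 4))\<^sup>2 / euler_fun (q\<^sup>2)) UNIV"
proof -
  note Q = q_powers[OF q]
  define L where "L = euler_fun (q ^ 4) / euler_fun (q\<^sup>2)"
  have L: "(\<lambda>n. \<Prod>k<n. 1 + (q\<^sup>2) ^ Suc k) \<longlonglongrightarrow> L"
    using even_plus_factors_tendsto[OF Q(1,2)] by (simp add: L_def flip: power_mult)
  have fin: "(\<Sum>j\<in>{- int n..int n}. gauss_binomial (q\<^sup>2) (2 * n) (nat (int n + j)) * q powi (j\<^sup>2 + j)) =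
     (\<Prod>k<n. 1 + (q\<^sup>2) ^ Suc k) * (\<Prod>k<n. 1 + (q\<^sup>2) ^ k)" for n
  proof -
    have "q * q ^ (2 * k + 1) = (q\<^sup>2) ^ Suc k" "q ^ (2 * k + 1) / q = (q\<^sup>2) ^ k" for k
      using q by (simp_all add: power_mult power2_eq_square)
    then show ?thesis
      using finite_triple_product[OF q, of q n] q
      by (simp add: prod.distrib power_int_add mult.assoc del: power_Suc)
  qed
  \<comment> \<open>The second product contains the factor for \<open>k = 0\<close>, which equals 2;
    splitting it off makes the rest a shifted copy of the first product.\<close>
  have "(\<lambda>n. (\<Prod>k<Suc n. 1 + (q\<^sup>2) ^ Suc k) * (2 * (\<Prod>k<n. 1 + (q\<^sup>2) ^ Suc k))) \<longlonglongrightarrow> L * (2 * L)"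
    by (intro tendsto_intros L LIMSEQ_Suc[OF L])
  then have "(\<lambda>n. (\<Prod>k<n. 1 + (q\<^sup>2) ^ Suc k) * (\<Prod>k<n. 1 + (q\<^sup>2) ^ k)) \<longlonglongrightarrow> L * (2 * L)"
    by (subst filterlim_sequentially_Suc[symmetric]) (simp add: prod.lessThan_Suc_shift[of "\<lambda>k. 1 + (q\<^sup>2) ^ k"] del: power_Suc prod.lessThan_Suc)
  then have "((\<lambda>j::int. q powi (j\<^sup>2 + j)) has_sum L * (2 * L) * euler_fun (q\<^sup>2)) UNIV"
    unfolding fin[symmetric]
    by (intro triple_product_limit[where C = 1] q order.trans[OF _ powi_bound]) (use q in auto)
  also have "L * (2 * L) * euler_fun (q\<^sup>2) = 2 * (euler_fun (q ^ 4))\<^sup>2 / euler_fun (q\<^sup>2)"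
    using euler_fun_pos[of "q\<^sup>2"] by (simp add: L_def power2_eq_square[of "euler_fun _"])
  finally show ?thesis .
qed

text \<open>The derivative at \<open>x = 1\<close> of the finite triple product with \<open>z = - q x\<close>, whose factor
  \<open>1 - 1/x\<close> vanishes there.\<close>

lemma finite_cube:
  "(\<Sum>j\<in>{- int (Suc m)..int (Suc m)}. gauss_binomial (q\<^sup>2) (2 * Suc m) (nat (int (Suc m) + j)) *
       ((- 1) powi j * real_of_int j * q powi (j\<^sup>2 + j))) = qpoch (q\<^sup>2) (Suc m) * qpoch (q\<^sup>2) m"
proof -
  define c where "c = (\<lambda>j. gauss_binomial (q\<^sup>2) (2 * Suc m) (nat (int (Suc m) + j)))"
  define I where "I = {- int (Suc m)..int (Suc m)}"
  define f where "f = (\<lambda>x. \<Sum>j\<in>I. c j * q powi (j\<^sup>2) * (- q * x) powi j)"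
  \<comment> \<open>The triple product with the factor \<open>1 - 1 / x\<close> taken out, hence one
    factor fewer on the right.\<close>
  define g where "g = (\<lambda>x. (\<Prod>k<Suc m. 1 - x * (q\<^sup>2) ^ Suc k) * (\<Prod>k<m. 1 - (q\<^sup>2) ^ Suc k / x))"
  have f: "f x = (1 - 1 / x) * g x" if "x \<noteq> 0" for x
  proof -
    have "f x = (\<Prod>k<Suc m. (1 + (- q * x) * q ^ (2 * k + 1)) * (1 + q ^ (2 * k + 1) / (- q * x)))"
      unfolding f_def c_def I_def using finite_triple_product[OF q, of "- q * x" "Suc m"] that q by simp
    also have "\<dots> = (\<Prod>k<Suc m. (1 - x * (q\<^sup>2) ^ Suc k) * (1 - (q\<^sup>2) ^ k / x))"
    proof (rule prod.cong)
      fix k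
      have "(q\<^sup>2) ^ k = q ^ (2 * k)" by (simp add: power_mult)
      then show "(1 + (- q * x) * q ^ (2 * k + 1)) * (1 + q ^ (2 * k + 1) / (- q * x)) =
          (1 - x * (q\<^sup>2) ^ Suc k) * (1 - (q\<^sup>2) ^ k / x)"
        using q that by (simp add: power2_eq_square)
    qed simp
    also have "\<dots> = (1 - 1 / x) * g x"
      unfolding prod.distrib g_def
      by (subst (2) prod.lessThan_Suc_shift) (simp add: mult_ac)
    finally show ?thesis .
  qed
  \<comment> \<open>Since \<open>f 1 = 0\<close>, the difference quotient at \<open>1\<close> is
    exactly \<open>g x / x\<close>, so continuity of \<open>g\<close> suffices.\<close>
  have "(f has_real_derivative g 1) (at 1)"
    unfolding has_field_derivative_iff
  proof (rule Lim_transform_eventually)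
    show "((\<lambda>x. g x / x) \<longlongrightarrow> g 1) (at 1)"
      unfolding g_def by (rule tendsto_eq_intros refl | simp)+
    have "eventually (\<lambda>x. x \<in> {0<..} - {1}) (at (1::real))"
      by (rule eventually_at_in_open) auto
    then show "\<forall>\<^sub>F x in at 1. g x / x = (f x - f 1) / (x - 1)"
      by eventually_elim (auto simp: f divide_simps algebra_simps)
  qed
  moreover have "(f has_real_derivative (\<Sum>j\<in>I. c j * ((- 1) powi j * real_of_int j * q powi (j\<^sup>2 + j)))) (at 1)"
  proof -
    have fx: "f x = (\<Sum>j\<in>I. c j * ((- 1) powi j * q powi (j\<^sup>2 + j)) * x powi j)" for x
      unfolding f_def
    proof (rule sum.cong)
      fix j
      have "(- q * x) powi j = (- 1) powi j * q powi j * x powi j"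
        by (metis mult_minus1 power_int_mult_distrib)
      then show "c j * q powi j\<^sup>2 * (- q * x) powi j = c j * ((- 1) powi j * q powi (j\<^sup>2 + j)) * x powi j"
        using q by (simp add: power_int_add)
    qed simp
    show ?thesis
      unfolding fx[abs_def] by (auto intro!: derivative_eq_intros sum.cong)
  qed
  ultimately have "(\<Sum>j\<in>I. c j * ((- 1) powi j * real_of_int j * q powi (j\<^sup>2 + j))) = g 1"
    using DERIV_unique by blast
  then show ?thesis
    by (simp add: c_def I_def g_def qpoch_def)
qed

text \<open>\<open>finite_cube\<close> contributes two factors \<open>euler_fun (q\<^sup>2)\<close>
  in the limit, and \<open>triple_product_limit\<close> multiplies by the third.\<close>

lemma cube_has_sum:
  "((\<lambda>j::int. (- 1) powi j * real_of_int j * q powi (j\<^sup>2 + j)) has_sum euler_fun (q\<^sup>2) ^ 3) UNIV"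
proof -
  note Q = q_powers[OF q]
  have "(\<lambda>n. qpoch (q\<^sup>2) (Suc n) * qpoch (q\<^sup>2) n) \<longlonglongrightarrow> euler_fun (q\<^sup>2) * euler_fun (q\<^sup>2)"
    by (intro tendsto_mult LIMSEQ_Suc qpoch_tendsto Q)
  then have "((\<lambda>j::int. (- 1) powi j * real_of_int j * q powi (j\<^sup>2 + j)) has_sum
               euler_fun (q\<^sup>2) * euler_fun (q\<^sup>2) * euler_fun (q\<^sup>2)) UNIV"
    unfolding finite_cube[symmetric]
  proof (intro triple_product_limit[where C = 1] q)
    fix j :: int
    have "\<bar>real_of_int j\<bar> * q powi (j\<^sup>2 + j) \<le> (1 + \<bar>real_of_int j\<bar>) * q powi (j\<^sup>2 - \<bar>j\<bar>)"
      using q by (intro mult_mono power_int_decreasing) auto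
    then show "\<bar>(- 1) powi j * real_of_int j * q powi (j\<^sup>2 + j)\<bar> \<le> 1 * (1 + \<bar>real_of_int j\<bar>) * q powi (j\<^sup>2 - \<bar>j\<bar>)"
      using q by (simp add: abs_mult power_int_abs)
  qed (subst (asm) filterlim_sequentially_Suc, assumption)
  then show ?thesis by (simp add: power3_eq_cube)
qed

text \<open>Averaging over the involution \<open>j \<mapsto> - 1 - j\<close>, which fixes
  \<open>j\<^sup>2 + j\<close> and flips the sign \<open>(- 1) powi j\<close>. The weight
  \<open>2 * j + 1\<close> is the odd number needed to factor the Wronskian.\<close>

lemma cube_has_sum':
  "((\<lambda>j::int. (- 1) powi j * (2 * real_of_int j + 1) * q powi (j\<^sup>2 + j)) has_sum 2 * euler_fun (q\<^sup>2) ^ 3) UNIV"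
proof -
  define w where "w = (\<lambda>j::int. (- 1) powi j * real_of_int j * q powi (j\<^sup>2 + j))"
  have "(w has_sum euler_fun (q\<^sup>2) ^ 3) UNIV" unfolding w_def by (rule cube_has_sum)
  moreover from this have "((\<lambda>j. w (- 1 - j)) has_sum euler_fun (q\<^sup>2) ^ 3) UNIV"
    by (subst has_sum_reindex_bij_witness[where S = UNIV and T = UNIV and i = "\<lambda>j. - 1 - j" and j = "\<lambda>j. - 1 - j" and h = w]) auto
  ultimately have "((\<lambda>j. w j + w (- 1 - j)) has_sum 2 * euler_fun (q\<^sup>2) ^ 3) UNIV"
    by (auto dest: has_sum_add)
  moreover have "w j + w (- 1 - j) = (- 1) powi j * (2 * real_of_int j + 1) * q powi (j\<^sup>2 + j)" for j
  proof -
    have "(- 1 - j)\<^sup>2 + (- 1 - j) = j\<^sup>2 + j" by (simp add: power2_eq_square algebra_simps)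
    moreover have "(- 1 :: real) powi (- 1 - j) = - ((- 1) powi j)"
      by (simp add: power_int_minus_left)
    ultimately show ?thesis unfolding w_def by (simp add: algebra_simps)
  qed
  ultimately show ?thesis by simp
qed

end

subsection \<open>Theta functions and their Wronskian\<close>

definition sigma_series :: "real \<Rightarrow> real" where
  "sigma_series q = (\<Sum>n. real (sigma1 n) * q ^ n)"

definition alpha_series :: "real \<Rightarrow> real" where
  "alpha_series q = (\<Sum>n. real (a_coeff n) * q ^ n)"

definition beta_series :: "real \<Rightarrow> real" where
  "beta_series q = (\<Sum>n. real (b_coeff n) * q ^ n)"

text \<open>Stated for the operator \<open>q d/dq\<close>, which multiplies the \<open>n\<close>-th
  coefficient by \<open>n\<close> without shifting the index; hence the division by
  \<open>q\<close>.\<close>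

lemma powser_deriv_euler_operator:
  fixes c :: "nat \<Rightarrow> real"
  assumes "0 < q" "q < 1" "\<And>x. \<bar>x\<bar> < 1 \<Longrightarrow> summable (\<lambda>n. c n * x ^ n)"
  shows "((\<lambda>x. \<Sum>n. c n * x ^ n) has_real_derivative (\<Sum>n. real n * c n * q ^ n) / q) (at q)"
    and "summable (\<lambda>n. real n * c n * q ^ n)"
proof -
  obtain r where r: "q < r" "r < 1" using assms dense by blast
  have D: "((\<lambda>x. \<Sum>n. c n * x ^ n) has_real_derivative (\<Sum>n. diffs c n * q ^ n)) (at q)"
    by (rule termdiffs_strong[where K = r]) (use r assms in auto)
  have "summable (\<lambda>n. diffs c n * q ^ n)"
    by (rule termdiff_converges[where K = r]) (use r assms in auto)
  from diffs_equiv[OF this] have "(\<lambda>n. q * (real n * c n * q ^ (n - Suc 0))) sums (q * (\<Sum>n. diffs c n * q ^ n))"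
    by (rule sums_mult)
  moreover have "q * (real n * c n * q ^ (n - Suc 0)) = real n * c n * q ^ n" for n
    by (cases n) auto
  ultimately have S: "(\<lambda>n. real n * c n * q ^ n) sums (q * (\<Sum>n. diffs c n * q ^ n))"
    by simp
  then show "summable (\<lambda>n. real n * c n * q ^ n)" by (rule sums_summable)
  show "((\<lambda>x. \<Sum>n. c n * x ^ n) has_real_derivative (\<Sum>n. real n * c n * q ^ n) / q) (at q)"
    using D S assms by (simp add: sums_iff)
qed

lemma DERIV_euler_fun:
  assumes "0 < q" "q < 1"
  shows "(euler_fun has_real_derivative - euler_fun q * sigma_series q / q) (at q)"
proof -
  have "(\<lambda>n. real n * (real (sigma1 n) / real n) * q ^ n) = (\<lambda>n. real (sigma1 n) * q ^ n)"
    by (rule ext) auto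
  then have "((\<lambda>x. \<Sum>n. real (sigma1 n) / real n * x ^ n) has_real_derivative sigma_series q / q) (at q)"
    using powser_deriv_euler_operator(1)[OF assms summable_sigma1_div] by (simp only: sigma_series_def)
  then show ?thesis
    unfolding euler_fun_def[abs_def]
    by (auto intro!: derivative_eq_intros)
qed

lemma DERIV_euler_fun_power:
  assumes "0 < q" "q < 1" "k > 0"
  shows "((\<lambda>x. euler_fun (x ^ k)) has_real_derivative - real k * euler_fun (q ^ k) * sigma_series (q ^ k) / q) (at q)"
proof -
  have "0 < q ^ k" "q ^ k < 1" using assms by (auto simp: power_less_one_iff)
  from DERIV_chain2[OF DERIV_euler_fun[OF this] DERIV_pow[of k q UNIV]] show ?thesis
    by (rule DERIV_cong) (use assms in \<open>cases k; auto simp: divide_simps; auto simp: algebra_simps\<close>)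
qed

lemma sums_dilate:
  fixes c :: "nat \<Rightarrow> real"
  assumes "k > 0" "(\<lambda>n. c n * (q ^ k) ^ n) sums s"
  shows "(\<lambda>n. (if k dvd n then c (n div k) else 0) * q ^ n) sums s"
proof -
  have "strict_mono (\<lambda>n. k * n)" using assms by (auto intro!: strict_monoI)
  then have "(\<lambda>n. (if k dvd k * n then c (k * n div k) else 0) * q ^ (k * n)) sums s \<longleftrightarrow>
        (\<lambda>n. (if k dvd n then c (n div k) else 0) * q ^ n) sums s"
    by (rule sums_mono_reindex) auto
  with assms show ?thesis by (simp add: power_mult)
qed

context
  fixes q :: real
  assumes q: "0 < q" "q < 1"
begin

lemma sigma_series_dilate_sums:
  assumes "k > 0"
  shows "(\<lambda>n. (if k dvd n then real (sigma1 (n div k)) else 0) * q ^ n) sums sigma_series (q ^ k)"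
  by (rule sums_dilate[OF assms], unfold sigma_series_def, rule summable_sums, rule summable_sigma1)
     (use q assms in \<open>auto simp: power_less_one_iff power_abs\<close>)

lemma sigma_series_sums: "(\<lambda>n. real (sigma1 n) * q ^ n) sums sigma_series q"
  using sigma_series_dilate_sums[of 1] by simp

lemma alpha_series_sums: "(\<lambda>n. real (a_coeff n) * q ^ n) sums (sigma_series q - sigma_series (q\<^sup>2))"
  using sums_diff[OF sigma_series_sums sigma_series_dilate_sums[of 2]]
  by (simp add: a_coeff_eq algebra_simps)

lemma beta_series_sums:
  "(\<lambda>n. real (b_coeff n) * q ^ n) sums
     (sigma_series q - 3 * sigma_series (q\<^sup>2) + 2 * sigma_series (q ^ 4))"
  using sums_add[OF sums_diff[OF sigma_series_sums sums_mult[OF sigma_series_dilate_sums[of 2], of 3]]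
      sums_mult[OF sigma_series_dilate_sums[of 4], of 2]]
  by (simp add: b_coeff_eq algebra_simps)

lemma alpha_series_eq: "alpha_series q = sigma_series q - sigma_series (q\<^sup>2)"
  and beta_series_eq: "beta_series q = sigma_series q - 3 * sigma_series (q\<^sup>2) + 2 * sigma_series (q ^ 4)"
  using alpha_series_sums beta_series_sums by (simp_all add: alpha_series_def beta_series_def sums_iff)

end

section \<open>Theta series, their derivatives and the formula for the beta series\<close>

definition theta3 :: "real \<Rightarrow> real" where
  "theta3 q = (\<Sum>\<^sub>\<infinity>j::int. q powi (j\<^sup>2))"

definition theta4 :: "real \<Rightarrow> real" where
  "theta4 q = (\<Sum>\<^sub>\<infinity>j::int. (- 1) powi j * q powi (j\<^sup>2))"

lemma theta4_eq: "0 < q \<Longrightarrow> q < 1 \<Longrightarrow> theta4 q = (euler_fun q)\<^sup>2 / euler_fun (q\<^sup>2)"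
  unfolding theta4_def by (rule infsumI[OF theta4_has_sum])

lemma theta3_eq:
  "0 < q \<Longrightarrow> q < 1 \<Longrightarrow> theta3 q = euler_fun (q\<^sup>2) ^ 5 / (euler_fun q * euler_fun (q ^ 4))\<^sup>2"
  unfolding theta3_def by (rule infsumI[OF theta3_has_sum])

lemma has_sum_int_even:
  fixes f :: "int \<Rightarrow> real"
  assumes "\<And>j. f (- j) = f j" "((\<lambda>n. f (int n)) has_sum s) UNIV"
  shows "(f has_sum (2 * s - f 0)) UNIV"
proof -
  have 1: "(f has_sum s) {0..}"
    using assms(2) by (subst has_sum_reindex_bij_witness[where i = int and j = nat and T = UNIV and h = "\<lambda>n. f (int n)"]) auto
  have 2: "(f has_sum s) {..0}"
    by (subst has_sum_reindex_bij_witness[where i = "\<lambda>j. - j" and j = "\<lambda>j. - j" and T = "{0..}" and h = f])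
       (use 1 assms(1) in auto)
  have 3: "(f has_sum f 0) {0}" by (simp add: has_sum_finite_iff)
  have "(f has_sum (s - f 0)) ({..0} - {0})"
    by (rule has_sum_Diff[OF 2 3]) auto
  then have "(f has_sum (s + (s - f 0))) ({0..} \<union> ({..0} - {0}))"
    by (rule has_sum_Un_disjoint[OF 1]) auto
  moreover have "{0::int..} \<union> ({..0} - {0}) = UNIV" by auto
  ultimately show ?thesis by (simp add: algebra_simps)
qed

text \<open>A series in \<open>x ^ n\<^sup>2\<close> is an ordinary power series whose coefficients
  \<open>c\<close> are supported on the squares. Reindexing along the strictly increasing map
  \<open>g\<close> transfers differentiation, and multiplying by the exponent becomes multiplying by
  \<open>n^2\<close>.\<close>

lemma square_series_deriv:
  fixes w :: "nat \<Rightarrow> real"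
  assumes q: "0 < q" "q < 1" and w: "\<And>n. \<bar>w n\<bar> \<le> 1"
  shows "((\<lambda>x. \<Sum>n. w n * x ^ n\<^sup>2) has_real_derivative (\<Sum>n. real n ^ 2 * w n * q ^ n\<^sup>2) / q) (at q)"
    and "summable (\<lambda>n. real n ^ 2 * w n * q ^ n\<^sup>2)" and "summable (\<lambda>n. w n * q ^ n\<^sup>2)"
proof -
  define g :: "nat \<Rightarrow> nat" where "g = (\<lambda>n. n\<^sup>2)"
  have g: "strict_mono g" by (auto simp: g_def intro!: strict_monoI power_strict_mono)
  then have inj: "inj g" by (rule strict_mono_imp_inj_on)
  define c where "c = (\<lambda>k. if k \<in> range g then w (inv g k) else 0)"
  have cg: "c (g n) = w n" for n using inj by (simp add: c_def)
  have cb: "\<bar>c n\<bar> \<le> 1" for n using w by (simp add: c_def)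
  have sc: "summable (\<lambda>n. c n * x ^ n)" if "\<bar>x\<bar> < 1" for x
    by (rule summable_comparison_test'[where g = "\<lambda>n. \<bar>x\<bar> ^ n"])
       (use that cb in \<open>auto simp: abs_mult power_abs intro!: mult_left_le_one_le\<close>)
  have 1: "(\<lambda>n. w n * x ^ n\<^sup>2) sums s \<longleftrightarrow> (\<lambda>n. c n * x ^ n) sums s" for x s
  proof -
    have "(\<lambda>n. c (g n) * x ^ g n) sums s \<longleftrightarrow> (\<lambda>n. c n * x ^ n) sums s"
      by (rule sums_mono_reindex[OF g]) (auto simp: c_def)
    then show ?thesis unfolding cg by (simp add: g_def)
  qed
  have 2: "(\<lambda>n. real n ^ 2 * w n * q ^ n\<^sup>2) sums s \<longleftrightarrow> (\<lambda>n. real n * c n * q ^ n) sums s" for s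
  proof -
    have "(\<lambda>n. real (g n) * c (g n) * q ^ g n) sums s \<longleftrightarrow> (\<lambda>n. real n * c n * q ^ n) sums s"
      by (rule sums_mono_reindex[OF g]) (auto simp: c_def)
    then show ?thesis unfolding cg by (simp add: g_def)
  qed
  note D = powser_deriv_euler_operator[OF q, of c, OF sc]
  have e1: "(\<lambda>x. \<Sum>n. w n * x ^ n\<^sup>2) = (\<lambda>x. \<Sum>n. c n * x ^ n)"
    unfolding suminf_def 1 ..
  have e2: "(\<Sum>n. real n ^ 2 * w n * q ^ n\<^sup>2) = (\<Sum>n. real n * c n * q ^ n)"
    unfolding suminf_def 2 ..
  show "((\<lambda>x. \<Sum>n. w n * x ^ n\<^sup>2) has_real_derivative (\<Sum>n. real n ^ 2 * w n * q ^ n\<^sup>2) / q) (at q)"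
    unfolding e1 e2 by (rule D)
  show "summable (\<lambda>n. real n ^ 2 * w n * q ^ n\<^sup>2)"
    using D(2) 2 by (auto simp: summable_def)
  show "summable (\<lambda>n. w n * q ^ n\<^sup>2)"
    using sc[of q] 1 q by (auto simp: summable_def)
qed

lemma square_series_int:
  fixes w :: "int \<Rightarrow> real"
  assumes w: "\<And>j. \<bar>w j\<bar> \<le> 1" "\<And>j. w (- j) = w j" and q: "0 < q" "q < 1"
  defines "f \<equiv> \<lambda>x. \<Sum>\<^sub>\<infinity>j::int. w j * x powi (j\<^sup>2)"
  obtains d where "((\<lambda>j. real_of_int j ^ 2 * w j * q powi (j\<^sup>2)) has_sum d) UNIV"
    "(f has_real_derivative d / q) (at q)" "((\<lambda>j. w j * q powi (j\<^sup>2)) has_sum f q) UNIV"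
proof -
  have pw: "x powi ((int n)\<^sup>2) = x ^ n\<^sup>2" for x :: real and n
    by (metis of_nat_power power_int_of_nat)
  have hs: "((\<lambda>n. w (int n) * x powi ((int n)\<^sup>2)) has_sum (\<Sum>n. w (int n) * x ^ n\<^sup>2)) UNIV" if "0 < x" "x < 1" for x
    unfolding pw using square_series_deriv(3)[of x "\<lambda>n. \<bar>w (int n)\<bar>"] square_series_deriv(3)[of x "\<lambda>n. w (int n)"] that w(1)
    by (intro norm_summable_imp_has_sum) (auto simp: abs_mult sums_iff)
  have hs': "((\<lambda>n. real_of_int (int n) ^ 2 * w (int n) * q powi ((int n)\<^sup>2)) has_sum (\<Sum>n. real n ^ 2 * w (int n) * q ^ n\<^sup>2)) UNIV"
    unfolding pw using square_series_deriv(2)[of q "\<lambda>n. \<bar>w (int n)\<bar>"] square_series_deriv(2)[of q "\<lambda>n. w (int n)"] q w(1)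
    by (intro norm_summable_imp_has_sum) (auto simp: abs_mult sums_iff)
  have F: "((\<lambda>j. w j * x powi (j\<^sup>2)) has_sum (2 * (\<Sum>n. w (int n) * x ^ n\<^sup>2) - w 0)) UNIV" if "0 < x" "x < 1" for x
    using has_sum_int_even[OF _ hs[OF that]] w(2) by simp
  then have fx: "f x = 2 * (\<Sum>n. w (int n) * x ^ n\<^sup>2) - w 0" if "0 < x" "x < 1" for x
    unfolding f_def using that by (intro infsumI)
  define d where "d = 2 * (\<Sum>n. real n ^ 2 * w (int n) * q ^ n\<^sup>2)"
  show ?thesis
  proof (rule that)
    show "((\<lambda>j. real_of_int j ^ 2 * w j * q powi (j\<^sup>2)) has_sum d) UNIV"
      using has_sum_int_even[OF _ hs'] w(2) by (simp add: d_def)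
    have "((\<lambda>x. 2 * (\<Sum>n. w (int n) * x ^ n\<^sup>2) - w 0) has_real_derivative d / q) (at q)"
      unfolding d_def by (auto intro!: derivative_eq_intros square_series_deriv(1) q w(1))
    then show "(f has_real_derivative d / q) (at q)"
      by (rule has_field_derivative_transform_within_open[where S = "{0<..<1}"]) (use q fx in auto)
    show "((\<lambda>j. w j * q powi (j\<^sup>2)) has_sum f q) UNIV"
      using F[OF q] fx[OF q] by simp
  qed
qed

context
  fixes q :: real
  assumes q: "0 < q" "q < 1"
begin

lemma DERIV_theta4: "(theta4 has_real_derivative - 2 * alpha_series q * theta4 q / q) (at q)"
proof -
  have nz: "euler_fun x \<noteq> 0" for x using euler_fun_pos[of x] by simp
  have "((\<lambda>x. (euler_fun x)\<^sup>2 / euler_fun (x\<^sup>2)) has_real_derivative - 2 * alpha_series q * theta4 q / q) (at q)"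
    using q nz
    by (auto intro!: derivative_eq_intros DERIV_euler_fun DERIV_euler_fun_power
        simp: alpha_series_eq theta4_eq power2_eq_square[of "euler_fun _"] field_simps)
  then show ?thesis
    by (rule has_field_derivative_transform_within_open[where S = "{0<..<1}"])
       (use q in \<open>auto simp: theta4_eq\<close>)
qed

lemma DERIV_theta3:
  "(theta3 has_real_derivative
     (2 * sigma_series q - 10 * sigma_series (q\<^sup>2) + 8 * sigma_series (q ^ 4)) * theta3 q / q) (at q)"
proof -
  have nz: "euler_fun x \<noteq> 0" for x using euler_fun_pos[of x] by simp
  have "((\<lambda>x. euler_fun (x\<^sup>2) ^ 5 / (euler_fun x * euler_fun (x ^ 4))\<^sup>2) has_real_derivative
     (2 * sigma_series q - 10 * sigma_series (q\<^sup>2) + 8 * sigma_series (q ^ 4)) * theta3 q / q) (at q)"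
  proof (rule DERIV_cong)
    \<comment> \<open>Naming the values turns the comparison of derivatives into rational algebra.
      The weights come from exponent times dilation: 2 * 1, -5 * 2 and 2 * 4.\<close>
    define e1 e2 e4 where "e1 = euler_fun q" and "e2 = euler_fun (q\<^sup>2)" and "e4 = euler_fun (q ^ 4)"
    define s1 s2 s4 where "s1 = sigma_series q" and "s2 = sigma_series (q\<^sup>2)" and "s4 = sigma_series (q ^ 4)"
    define d1 d2 d4 where "d1 = - e1 * s1 / q" and "d2 = - 2 * e2 * s2 / q" and "d4 = - 4 * e4 * s4 / q"
    have "((\<lambda>x. euler_fun x) has_real_derivative d1) (at q)"
         "((\<lambda>x. euler_fun (x\<^sup>2)) has_real_derivative d2) (at q)"
         "((\<lambda>x. euler_fun (x ^ 4)) has_real_derivative d4) (at q)"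
      using DERIV_euler_fun[OF q] DERIV_euler_fun_power[OF q, of 2] DERIV_euler_fun_power[OF q, of 4]
      by (simp_all add: d1_def d2_def d4_def e1_def e2_def e4_def s1_def s2_def s4_def)
    then show "((\<lambda>x. euler_fun (x\<^sup>2) ^ 5 / (euler_fun x * euler_fun (x ^ 4))\<^sup>2) has_real_derivative
        (5 * e2 ^ 4 * d2 * (e1 * e4)\<^sup>2 - e2 ^ 5 * (2 * (e1 * e4) * (d1 * e4 + e1 * d4))) / ((e1 * e4)\<^sup>2)\<^sup>2) (at q)"
      using nz by (auto intro!: derivative_eq_intros simp: e1_def e2_def e4_def power2_eq_square[of "_ * _"] power2_eq_square[of "euler_fun _"] algebra_simps)
    have nz': "e1 \<noteq> 0" "e2 \<noteq> 0" "e4 \<noteq> 0" using nz by (simp_all add: e1_def e2_def e4_def)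
    have "(5 * e2 ^ 4 * d2 * (e1 * e4)\<^sup>2 - e2 ^ 5 * (2 * (e1 * e4) * (d1 * e4 + e1 * d4))) / ((e1 * e4)\<^sup>2)\<^sup>2
        = (2 * s1 - 10 * s2 + 8 * s4) * (e2 ^ 5 / (e1 * e4)\<^sup>2) / q"
      using nz' q unfolding d1_def d2_def d4_def by (simp add: divide_simps) (simp add: power_numeral_reduce algebra_simps)
    then show "(5 * e2 ^ 4 * d2 * (e1 * e4)\<^sup>2 - e2 ^ 5 * (2 * (e1 * e4) * (d1 * e4 + e1 * d4))) / ((e1 * e4)\<^sup>2)\<^sup>2
        = (2 * sigma_series q - 10 * sigma_series (q\<^sup>2) + 8 * sigma_series (q ^ 4)) * theta3 q / q"
      by (simp add: theta3_eq[OF q] e1_def e2_def e4_def s1_def s2_def s4_def)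
  qed
  then show ?thesis
    by (rule has_field_derivative_transform_within_open[where S = "{0<..<1}"])
       (use q in \<open>auto simp: theta3_eq\<close>)
qed

text \<open>\<open>d3\<close> and \<open>d4\<close> stand for \<open>q\<close> times the derivatives
  of \<open>theta3\<close> and \<open>theta4\<close>. In the result, the single \<open>q\<close>
  comes from the constant in \<open>m\<^sup>2 + n\<^sup>2 = 1 + 2 * (a\<^sup>2 + a) + 2 * (b\<^sup>2
  + b)\<close>, and 4 is the square of the 2 in \<open>cube_has_sum'\<close> at
  \<open>q\<^sup>2\<close>.\<close>

lemma theta_wronskian_sum:
  assumes "((\<lambda>j. real_of_int j ^ 2 * q powi (j\<^sup>2)) has_sum d3) UNIV"
          "((\<lambda>j. real_of_int j ^ 2 * (- 1) powi j * q powi (j\<^sup>2)) has_sum d4) UNIV"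
  shows "d3 * theta4 q - theta3 q * d4 = 4 * q * euler_fun (q ^ 4) ^ 6"
proof -
  have q2: "0 < q\<^sup>2" "q\<^sup>2 < 1" using q by (auto simp: power_less_one_iff)
  define t where "t = (\<lambda>(m::int, n::int). (- 1) powi n * (real_of_int m ^ 2 - real_of_int n ^ 2) * q powi (m\<^sup>2 + n\<^sup>2))"
  have t3: "((\<lambda>j::int. q powi (j\<^sup>2)) has_sum theta3 q) UNIV"
    using theta3_has_sum[OF q] theta3_eq[OF q] by simp
  have t4: "((\<lambda>j::int. (- 1) powi j * q powi (j\<^sup>2)) has_sum theta4 q) UNIV"
    using theta4_has_sum[OF q] theta4_eq[OF q] by simp
  have abs: "(\<lambda>x. norm (f x)) summable_on UNIV" if "(f has_sum s) UNIV" for f :: "int \<Rightarrow> real" and s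
    using summable_on_iff_abs_summable_on_real[of f UNIV] has_sum_imp_summable[OF that] by simp
  have "(t has_sum (d3 * theta4 q - theta3 q * d4)) (UNIV \<times> UNIV)"
    using has_sum_diff[OF has_sum_product[OF assms(1) t4 abs[OF assms(1)] abs[OF t4]]
        has_sum_product[OF t3 assms(2) abs[OF t3] abs[OF assms(2)]]]
    by (rule has_sum_cong[THEN iffD1, rotated]) (use q in \<open>auto simp: t_def power_int_add algebra_simps\<close>)
  then have tot: "(t has_sum (d3 * theta4 q - theta3 q * d4)) UNIV" by simp
  \<comment> \<open>On \<open>A\<close> the swap \<open>(m, n) \<mapsto> (n, m)\<close> flips the sign of \<open>t\<close>; \<open>B\<close> is parametrised by \<open>m - n = 2a + 1\<close>, \<open>m + n = 2b + 1\<close>.\<close>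
  define A where "A = {(m::int, n::int). even (m + n)}"
  define B where "B = {(m::int, n::int). odd (m + n)}"
  have AB: "A \<union> B = UNIV" "A \<inter> B = {}" by (auto simp: A_def B_def)
  obtain sA where sA: "(t has_sum sA) A"
    using summable_on_subset_banach[of t UNIV A] tot by (auto simp: summable_on_def)
  have "((\<lambda>z. - t z) has_sum sA) A"
    by (subst has_sum_reindex_bij_witness[where i = prod.swap and j = prod.swap and T = A and h = t])
       (use sA in \<open>auto simp: A_def t_def power_int_minus_left algebra_simps\<close>)
  then have "sA = - sA"
    using sA has_sum_uminus has_sum_unique by (metis minus_minus)
  then have sA0: "sA = 0" by simp
  define u where "u = (\<lambda>j::int. (- 1) powi j * (2 * real_of_int j + 1) * (q\<^sup>2) powi (j\<^sup>2 + j))"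
  define U where "U = 2 * euler_fun (q ^ 4) ^ 3"
  have u: "(u has_sum U) UNIV"
    using cube_has_sum'[OF q2] by (simp add: u_def U_def flip: power_mult)
  have "((\<lambda>z. q * (case z of (a, b) \<Rightarrow> u a * u b)) has_sum q * (U * U)) (UNIV \<times> UNIV)"
    by (intro has_sum_cmult_right has_sum_product u abs[OF u])
  moreover have "((\<lambda>z. q * (case z of (a, b) \<Rightarrow> u a * u b)) has_sum q * (U * U)) (UNIV \<times> UNIV) \<longleftrightarrow>
                 (t has_sum q * (U * U)) B"
  proof (rule has_sum_reindex_bij_witness[where j = "\<lambda>(a, b). (a + b + 1, b - a)" and i = "\<lambda>(m, n). ((m - n) div 2, (m + n) div 2)"])
    fix z :: "int \<times> int"
    obtain a b where z: "z = (a, b)" by (cases z)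
    have "(a + b + 1)\<^sup>2 + (b - a)\<^sup>2 = 1 + (2 * (a\<^sup>2 + a) + 2 * (b\<^sup>2 + b))"
      by (simp add: power2_eq_square algebra_simps)
    then have "q powi ((a + b + 1)\<^sup>2 + (b - a)\<^sup>2) = q * ((q\<^sup>2) powi (a\<^sup>2 + a) * (q\<^sup>2) powi (b\<^sup>2 + b))"
      using q by (simp add: power_int_add power_int_mult)
    moreover have "(- 1 :: real) powi (b - a) = (- 1) powi a * (- 1) powi b"
      by (cases "even a"; cases "even b"; simp add: power_int_minus_left)
    moreover have "(real_of_int (a + b + 1))\<^sup>2 - (real_of_int (b - a))\<^sup>2 = (2 * real_of_int a + 1) * (2 * real_of_int b + 1)"
      by (simp add: power2_eq_square algebra_simps)
    ultimately show "t (case z of (a, b) \<Rightarrow> (a + b + 1, b - a)) = q * (case z of (a, b) \<Rightarrow> u a * u b)"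
      unfolding z t_def u_def prod.case by (simp only: mult_ac)
    show "(case (case z of (a, b) \<Rightarrow> (a + b + 1, b - a)) of (m, n) \<Rightarrow> ((m - n) div 2, (m + n) div 2)) = z"
      by (simp add: z)
    show "(case z of (a, b) \<Rightarrow> (a + b + 1, b - a)) \<in> B"
      by (auto simp: z B_def)
  next
    fix z assume "z \<in> B"
    then obtain m n where z: "z = (m, n)" "odd (m + n)" by (auto simp: B_def)
    then have "(m - n) div 2 + (m + n) div 2 + 1 = m" "(m + n) div 2 - (m - n) div 2 = n"
      by presburger+
    then show "(case (case z of (m, n) \<Rightarrow> ((m - n) div 2, (m + n) div 2)) of (a, b) \<Rightarrow> (a + b + 1, b - a)) = z"
      by (simp add: z)
  qed auto
  ultimately have sB: "(t has_sum q * (U * U)) B" by simp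
  have "(t has_sum (sA + q * (U * U))) UNIV"
    using has_sum_Un_disjoint[OF sA sB AB(2)] AB(1) by simp
  then have "d3 * theta4 q - theta3 q * d4 = sA + q * (U * U)"
    using tot has_sum_unique by blast
  then show ?thesis
    by (simp add: sA0 U_def flip: power_add)
qed

text \<open>The logarithmic derivatives (in \<open>q d/dq\<close>) of \<open>theta3\<close> and
  \<open>theta4\<close> differ by 4, -12, 8 times \<open>sigma_series\<close> at \<open>q\<close>,
  \<open>q\<^sup>2\<close>, \<open>q ^ 4\<close>, which is 4 times
  \<open>beta_series q\<close>.\<close>

lemma theta_wronskian: "theta3 q * theta4 q * beta_series q = q * euler_fun (q ^ 4) ^ 6"
proof -
  obtain d3 where d3: "((\<lambda>j. real_of_int j ^ 2 * q powi (j\<^sup>2)) has_sum d3) UNIV"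
    "(theta3 has_real_derivative d3 / q) (at q)"
    using square_series_int[of "\<lambda>_. 1" q] q unfolding theta3_def[abs_def] by auto
  obtain d4 where d4: "((\<lambda>j. real_of_int j ^ 2 * (- 1) powi j * q powi (j\<^sup>2)) has_sum d4) UNIV"
    "(theta4 has_real_derivative d4 / q) (at q)"
  proof -
    have w: "\<bar>(- 1 :: real) powi j\<bar> \<le> 1" "(- 1 :: real) powi (- j) = (- 1) powi j" for j
      by (simp_all add: power_int_abs power_int_minus_left)
    show ?thesis
      using square_series_int[where w = "\<lambda>j. (- 1) powi j", OF w q] that unfolding theta4_def[abs_def] by blast
  qed
  have e3: "d3 = (2 * sigma_series q - 10 * sigma_series (q\<^sup>2) + 8 * sigma_series (q ^ 4)) * theta3 q"
    using DERIV_unique[OF d3(2) DERIV_theta3] q by simp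
  have e4: "d4 = - 2 * alpha_series q * theta4 q"
    using DERIV_unique[OF d4(2) DERIV_theta4] q by (simp add: field_simps)
  show ?thesis
    using theta_wronskian_sum[OF d3(1) d4(1)]
    unfolding e3 e4 alpha_series_eq[OF q] beta_series_eq[OF q] by (simp add: algebra_simps)
qed

text \<open>The product \<open>theta3 q * theta4 q\<close> collapses to
  \<open>e2 ^ 4 / e4\<^sup>2\<close>, so \<open>beta_series q = q * e4 ^ 8 / e2 ^ 4\<close>; on the
  other side \<open>s ^ 4 = 16 * e4 ^ 8 / e2 ^ 4\<close>. The factor \<open>q\<close> completes
  \<open>s ^ 4\<close> to the fourth power of \<theta>2.\<close>

lemma beta_series_theta2:
  assumes "((\<lambda>j::int. q powi (j\<^sup>2 + j)) has_sum s) UNIV"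
  shows "beta_series q = q * s ^ 4 / 16"
proof -
  define e1 e2 e4 where "e1 = euler_fun q" and "e2 = euler_fun (q\<^sup>2)" and "e4 = euler_fun (q ^ 4)"
  have nz: "e1 > 0" "e2 > 0" "e4 > 0" by (simp_all add: e1_def e2_def e4_def euler_fun_pos)
  have s: "s = 2 * e4\<^sup>2 / e2"
    using has_sum_unique[OF assms theta2_has_sum[OF q]] by (simp add: e4_def e2_def)
  have "e2 ^ 5 / (e1 * e4)\<^sup>2 * (e1\<^sup>2 / e2) * beta_series q = q * e4 ^ 6"
    using theta_wronskian by (simp add: theta3_eq[OF q] theta4_eq[OF q] e1_def e2_def e4_def)
  then have "beta_series q * e2 ^ 4 = q * e4 ^ 8"
    using nz by (simp add: field_simps power_numeral_reduce)
  then have "beta_series q = q * e4 ^ 8 / e2 ^ 4"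
    using nz by (simp add: field_simps)
  then show ?thesis
    unfolding s by (simp add: power_divide power_mult_distrib flip: power_mult)
qed

end

subsection \<open>Poisson summation for the Gaussian\<close>

text \<open>A rescaling of the characteristic function of the standard normal law; \<open>c\<close>
  is chosen so that \<open>(c * x)\<^sup>2 / 2 = pi * u * x\<^sup>2\<close>.\<close>

lemma gaussian_fourier:
  fixes u t :: real
  assumes "u > 0"
  shows "integrable lborel (\<lambda>x. exp (- pi * u * x\<^sup>2) * cos (2 * pi * t * x))"
    and "(\<integral>x. exp (- pi * u * x\<^sup>2) * cos (2 * pi * t * x) \<partial>lborel) = exp (- pi * t\<^sup>2 / u) / sqrt u"
proof -
  define c where "c = sqrt (2 * pi * u)"
  have c: "c > 0" "c\<^sup>2 = 2 * pi * u" using assms by (auto simp: c_def)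
  define T where "T = 2 * pi * t / c"
  have dens: "integrable lborel std_normal_density"
    by simp
  have bd: "integrable lborel (\<lambda>x. std_normal_density x * cos (T * x))"
    by (rule Bochner_Integration.integrable_bound[OF dens])
       (auto simp: abs_mult intro!: mult_left_le)
  have "char std_normal_distribution T = (\<integral>x. std_normal_density x *\<^sub>R iexp (T * x) \<partial>lborel)"
    unfolding char_def by (subst integral_density) auto
  from this[symmetric] have "Re (\<integral>x. std_normal_density x *\<^sub>R iexp (T * x) \<partial>lborel) = exp (- T\<^sup>2 / 2)"
    by (simp add: char_std_normal_distribution)
  moreover have "integrable lborel (\<lambda>x. std_normal_density x *\<^sub>R iexp (T * x))"
    by (rule Bochner_Integration.integrable_bound[OF dens]) auto
  ultimately have "(\<integral>x. Re (std_normal_density x *\<^sub>R iexp (T * x)) \<partial>lborel) = exp (- T\<^sup>2 / 2)"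
    by (simp only: integral_Re)
  then have val: "(\<integral>x. std_normal_density x * cos (T * x) \<partial>lborel) = exp (- T\<^sup>2 / 2)"
    by (simp add: Re_exp)
  have aff: "exp (- pi * u * x\<^sup>2) * cos (2 * pi * t * x) =
             sqrt (2 * pi) * (std_normal_density (0 + c * x) * cos (T * (0 + c * x)))" for x
    using c by (simp add: normal_density_def T_def power_mult_distrib field_simps)
  show "integrable lborel (\<lambda>x. exp (- pi * u * x\<^sup>2) * cos (2 * pi * t * x))"
    unfolding aff using c
    by (intro integrable_mult_right lborel_integrable_real_affine[OF bd]) auto
  have "exp (- T\<^sup>2 / 2) = c * (\<integral>x. std_normal_density (0 + c * x) * cos (T * (0 + c * x)) \<partial>lborel)"
    using c lborel_integral_real_affine[of c "\<lambda>x. std_normal_density x * cos (T * x)" 0] val by simp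
  moreover have "T\<^sup>2 / 2 = pi * t\<^sup>2 / u"
    using c assms by (simp add: T_def power_divide power_mult_distrib field_simps power2_eq_square)
  moreover have "c = sqrt (2 * pi) * sqrt u" by (simp add: c_def real_sqrt_mult)
  ultimately show "(\<integral>x. exp (- pi * u * x\<^sup>2) * cos (2 * pi * t * x) \<partial>lborel) = exp (- pi * t\<^sup>2 / u) / sqrt u"
    unfolding aff using assms by (simp add: field_simps)
qed

text \<open>By symmetry it suffices to approximate \<open>h\<close> on \<open>[0, 1/2]\<close>, where \<open>cos (2 pi x)\<close> separates points,
  so that Stone--Weierstrass applies to polynomials in it.\<close>

lemma continuous_even_fourier_zero:
  fixes h :: "real \<Rightarrow> real"
  assumes cont: "continuous_on {0..1} h" and sym: "\<And>x. x \<in> {0..1} \<Longrightarrow> h (1 - x) = h x"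
    and zero: "\<And>m::int. integral {0..1} (\<lambda>x. h x * cos (2 * pi * of_int m * x)) = 0"
    and x: "x \<in> {0..1}"
  shows "h x = 0"
proof -
  have int: "f integrable_on {0..1}" if "continuous_on {0..1} f" for f :: "real \<Rightarrow> real"
    using that by (rule integrable_continuous_real)
  \<comment> \<open>The product formula \<open>2 * cos a * cos b = cos (a + b) + cos (a - b)\<close>
    raises the power of the first cosine by one while shifting \<open>m\<close>. So \<open>h\<close>
    is orthogonal to every polynomial in \<open>cos (2 * pi * x)\<close>.\<close>
  have pow: "integral {0..1} (\<lambda>x. h x * cos (2 * pi * x) ^ i * cos (2 * pi * of_int m * x)) = 0" for i and m :: int
  proof (induction i arbitrary: m)
    case (Suc i)
    have "(\<lambda>x. h x * cos (2 * pi * x) ^ Suc i * cos (2 * pi * of_int m * x)) =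
          (\<lambda>x. (h x * cos (2 * pi * x) ^ i * cos (2 * pi * of_int (m + 1) * x)) / 2 +
               (h x * cos (2 * pi * x) ^ i * cos (2 * pi * of_int (m - 1) * x)) / 2)"
      by (rule ext) (simp add: algebra_simps cos_add cos_diff add_divide_distrib diff_divide_distrib)
    then have "integral {0..1} (\<lambda>x. h x * cos (2 * pi * x) ^ Suc i * cos (2 * pi * of_int m * x)) =
          integral {0..1} (\<lambda>x. h x * cos (2 * pi * x) ^ i * cos (2 * pi * of_int (m + 1) * x)) / 2 +
          integral {0..1} (\<lambda>x. h x * cos (2 * pi * x) ^ i * cos (2 * pi * of_int (m - 1) * x)) / 2"
      by (simp only:) (subst integral_add; (intro int continuous_intros cont)?; simp)
    also have "\<dots> = 0" unfolding Suc.IH by simp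
    finally show ?case .
  qed (use zero in auto)
  have pol: "integral {0..1} (\<lambda>x. h x * poly p (cos (2 * pi * x))) = 0" for p
  proof -
    have "integral {0..1} (\<lambda>x. \<Sum>i\<le>degree p. coeff p i * (h x * cos (2 * pi * x) ^ i * cos (2 * pi * of_int 0 * x))) =
      (\<Sum>i\<le>degree p. integral {0..1} (\<lambda>x. coeff p i * (h x * cos (2 * pi * x) ^ i * cos (2 * pi * of_int 0 * x))))"
      by (intro integral_sum int continuous_intros cont) auto
    also have "\<dots> = 0" using pow[of _ 0] by simp
    finally show ?thesis
      by (simp add: poly_altdef sum_distrib_left algebra_simps)
  qed
  \<comment> \<open>Subtracting from one factor \<open>h\<close> an approximating polynomial, to
    which \<open>h\<close> is orthogonal, leaves a factor below \<open>e\<close>. As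
    \<open>e\<close> is arbitrary, the integral of \<open>h^2\<close> vanishes.\<close>
  have "integral {0..1} (\<lambda>x. h x * h x) \<le> e * integral {0..1} (\<lambda>x. \<bar>h x\<bar>)" if e: "e > 0" for e
  proof -
    define P where "P = (\<lambda>f::real \<Rightarrow> real. \<exists>p. f = (\<lambda>x. poly p (cos (2 * pi * x))))"
    have "\<exists>g. P g \<and> (\<forall>x\<in>{0..1/2}. \<bar>h x - g x\<bar> < e)"
    proof (rule Stone_Weierstrass_HOL[where P = P])
      show "P (\<lambda>x. c)" for c unfolding P_def by (intro exI[of _ "[:c:]"]) auto
      show "continuous_on {0..1/2} f" if "P f" for f
        using that by (auto simp: P_def intro!: continuous_intros)
      show "P (\<lambda>x. f x + g x)" if "P f \<and> P g" for f g
      proof -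
        from that obtain p r where "f = (\<lambda>x. poly p (cos (2 * pi * x)))" "g = (\<lambda>x. poly r (cos (2 * pi * x)))"
          unfolding P_def by blast
        then show ?thesis unfolding P_def by (intro exI[of _ "p + r"]) simp
      qed
      show "P (\<lambda>x. f x * g x)" if "P f \<and> P g" for f g
      proof -
        from that obtain p r where "f = (\<lambda>x. poly p (cos (2 * pi * x)))" "g = (\<lambda>x. poly r (cos (2 * pi * x)))"
          unfolding P_def by blast
        then show ?thesis unfolding P_def by (intro exI[of _ "p * r"]) simp
      qed
      show "\<exists>f. P f \<and> f x \<noteq> f y" if "x \<in> {0..1/2} \<and> y \<in> {0..1/2} \<and> x \<noteq> y" for x y
      proof (intro exI conjI)
        show "P (\<lambda>x. cos (2 * pi * x))" unfolding P_def by (intro exI[of _ "[:0, 1:]"]) auto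
        show "cos (2 * pi * x) \<noteq> cos (2 * pi * y)"
        proof
          assume "cos (2 * pi * x) = cos (2 * pi * y)"
          moreover have "0 \<le> 2 * pi * t" "2 * pi * t \<le> pi" if "t \<in> {0..1/2}" for t
            using that mult_left_mono[of "2 * t" 1 pi] by (simp_all add: mult_ac)
          ultimately have "2 * pi * x = 2 * pi * y"
            using that cos_inj_pi[of "2 * pi * x" "2 * pi * y"] by blast
          then show False using that by simp
        qed
      qed
      show "continuous_on {0..1/2} h" by (rule continuous_on_subset[OF cont]) auto
    qed (use e in auto)
    then obtain p where p: "\<And>x. x \<in> {0..1/2} \<Longrightarrow> \<bar>h x - poly p (cos (2 * pi * x))\<bar> < e"
      unfolding P_def by blast
    \<comment> \<open>The approximation was obtained on the left half only; both \<open>h\<close>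
      and the polynomial in the cosine are invariant under \<open>x \<mapsto> 1 - x\<close>.\<close>
    have p': "\<bar>h x - poly p (cos (2 * pi * x))\<bar> < e" if "x \<in> {0..1}" for x
    proof (cases "x \<le> 1/2")
      case False
      have "cos (2 * pi * (1 - x)) = cos (2 * pi * x)"
        by (simp add: algebra_simps cos_diff)
      with p[of "1 - x"] sym[OF that] False that show ?thesis by simp
    qed (use p that in auto)
    have i1: "(\<lambda>x. h x * h x) integrable_on {0..1}"
      and i2: "(\<lambda>x. h x * poly p (cos (2 * pi * x))) integrable_on {0..1}"
      and i3: "(\<lambda>x. e * \<bar>h x\<bar>) integrable_on {0..1}"
      by (intro int continuous_intros cont)+
    have "integral {0..1} (\<lambda>x. h x * h x) = integral {0..1} (\<lambda>x. h x * h x - h x * poly p (cos (2 * pi * x)))"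
      unfolding integral_diff[OF i1 i2] pol by simp
    also have "\<dots> \<le> integral {0..1} (\<lambda>x. e * \<bar>h x\<bar>)"
    proof (rule integral_le)
      fix x :: real assume x: "x \<in> {0..1}"
      have "h x * (h x - poly p (cos (2 * pi * x))) \<le> \<bar>h x\<bar> * \<bar>h x - poly p (cos (2 * pi * x))\<bar>"
        unfolding abs_mult[symmetric] by (rule abs_ge_self)
      also have "\<dots> \<le> \<bar>h x\<bar> * e" using p'[OF x] by (intro mult_left_mono) auto
      finally show "h x * h x - h x * poly p (cos (2 * pi * x)) \<le> e * \<bar>h x\<bar>"
        by (simp add: algebra_simps)
    qed (rule integrable_diff[OF i1 i2], rule i3)
    finally show ?thesis by simp
  qed
  then have "integral {0..1} (\<lambda>x. h x * h x) \<le> 0"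
  proof -
    assume *: "\<And>e. e > 0 \<Longrightarrow> integral {0..1} (\<lambda>x. h x * h x) \<le> e * integral {0..1} (\<lambda>x. \<bar>h x\<bar>)"
    have "((\<lambda>e. e * integral {0..1} (\<lambda>x. \<bar>h x\<bar>)) \<longlongrightarrow> 0 * integral {0..1} (\<lambda>x. \<bar>h x\<bar>)) (at_right 0)"
      by (intro tendsto_intros)
    then have "integral {0..1} (\<lambda>x. h x * h x) \<le> 0 * integral {0..1} (\<lambda>x. \<bar>h x\<bar>)"
      by (rule tendsto_lowerbound) (use * in \<open>auto simp: eventually_at_filter\<close>)
    then show ?thesis by simp
  qed
  moreover have "integral {0..1} (\<lambda>x. h x * h x) \<ge> 0"
    by (rule integral_nonneg[OF int[OF continuous_on_mult[OF cont cont]]]) simp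
  ultimately have "integral {0..1} (\<lambda>x. h x * h x) = 0" by simp
  then have "\<forall>x\<in>{0..1}. h x * h x = 0"
    using integral_eq_0_iff[of 0 1 "\<lambda>x. h x * h x"] continuous_on_mult[OF cont cont] by simp
  with x show ?thesis by auto
qed

text \<open>For \<open>k = m = 0\<close> both conditions hold, which gives the correct value 1 for
  the constant function.\<close>

lemma integral_cos_cos:
  fixes k m :: int
  shows "integral {0..1} (\<lambda>x. cos (2 * pi * of_int k * x) * cos (2 * pi * of_int m * x)) =
           ((if k = m then 1 else 0) + (if k = - m then 1 else 0)) / 2"
proof -
  have I: "((\<lambda>x. cos (2 * pi * of_int j * x)) has_integral (if j = 0 then 1 else 0)) {0..1}" for j :: int
  proof (cases "j = 0")
    case True
    then show ?thesis using has_integral_const_real[of "1::real" 0 1] by simp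
  next
    case False
    have "((\<lambda>x. cos (2 * pi * of_int j * x)) has_integral
        (sin (2 * pi * of_int j * 1) / (2 * pi * of_int j) - sin (2 * pi * of_int j * 0) / (2 * pi * of_int j))) {0..1}"
      by (rule fundamental_theorem_of_calculus)
         (use False in \<open>auto intro!: derivative_eq_intros simp: has_real_derivative_iff_has_vector_derivative[symmetric]\<close>)
    moreover have "sin (2 * pi * of_int j) = 0"
      using sin_zero_iff_int2[of "2 * pi * of_int j"] by (metis mult.assoc mult.commute of_int_mult of_int_numeral)
    ultimately show ?thesis using False by simp
  qed
  have "((\<lambda>x. (cos (2 * pi * of_int (k - m) * x) + cos (2 * pi * of_int (k + m) * x)) / 2) has_integral
          ((if k - m = 0 then 1 else 0) + (if k + m = 0 then 1 else 0)) / 2) {0..1}"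
    by (intro has_integral_divide has_integral_add I)
  moreover have "(cos (2 * pi * of_int (k - m) * x) + cos (2 * pi * of_int (k + m) * x)) / 2 =
      cos (2 * pi * of_int k * x) * cos (2 * pi * of_int m * x)" for x
    by (simp add: algebra_simps cos_add cos_diff)
  ultimately have "((\<lambda>x. cos (2 * pi * of_int k * x) * cos (2 * pi * of_int m * x)) has_integral
          ((if k - m = 0 then 1 else 0) + (if k + m = 0 then 1 else 0)) / 2) {0..1}"
    by (simp only:)
  from integral_unique[OF this] show ?thesis
    by (simp add: eq_neg_iff_add_eq_0)
qed

lemma cos_shift_int: "cos (2 * pi * of_int m * (x + of_int n)) = cos (2 * pi * of_int m * x)" for m n :: int
proof -
  have "cos (2 * pi * of_int m * x + 2 * pi * of_int (m * n)) = cos (2 * pi * of_int m * x)"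
  proof -
    have "sin (2 * pi * of_int (m * n)) = 0" "cos (2 * pi * of_int (m * n)) = 1"
      using sin_int_2pin[of "m * n"] cos_int_2pin[of "m * n"] by (simp_all only: mult_ac)
    then show ?thesis by (simp only: cos_add)
  qed
  then show ?thesis by (simp add: algebra_simps)
qed

lemma infsum_continuous_on:
  fixes f :: "'i \<Rightarrow> 'a::metric_space \<Rightarrow> 'b::banach"
  assumes "\<And>i. continuous_on S (f i)" "\<And>i x. x \<in> S \<Longrightarrow> norm (f i x) \<le> M i" "M summable_on UNIV"
  shows "continuous_on S (\<lambda>x. \<Sum>\<^sub>\<infinity>i. f i x)"
proof (rule uniform_limit_theorem)
  show "uniform_limit S (\<lambda>X x. \<Sum>i\<in>X. f i x) (\<lambda>x. \<Sum>\<^sub>\<infinity>i. f i x) (finite_subsets_at_top UNIV)"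
    by (rule Weierstrass_m_test_general) (use assms in auto)
qed (auto intro!: always_eventually continuous_intros assms)

text \<open>From \<open>t\<^sup>2 \<ge> \<bar>t\<bar> - 1 / 4\<close> at \<open>t = x + n\<close>,
  and \<open>\<bar>x + n\<bar> \<ge> \<bar>n\<bar> - 1\<close>. The factor with exponent
  \<open>0\<close> is 1 and only gives the bound the shape of
  \<open>summable_on_int_geometric\<close>.\<close>

lemma gaussian_term_bound:
  fixes u x :: real and n :: int
  assumes "u > 0" "x \<in> {0..1}"
  shows "exp (- pi * u * (x + of_int n)\<^sup>2) \<le> exp (2 * pi * u) * (real_of_int \<bar>n\<bar> ^ 0 * exp (- pi * u) ^ nat \<bar>n\<bar>)"
proof -
  have "(\<bar>x + of_int n\<bar> - 1 / 2)\<^sup>2 \<ge> 0" by simp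
  then have "(x + of_int n)\<^sup>2 \<ge> \<bar>x + of_int n\<bar> - 1 / 4"
    by (simp add: power2_eq_square algebra_simps)
  moreover have "\<bar>x + of_int n\<bar> \<ge> \<bar>of_int n\<bar> - 1" using assms by auto
  ultimately have "(x + of_int n)\<^sup>2 \<ge> real_of_int \<bar>n\<bar> - 2" by simp
  then have "pi * u * (x + of_int n)\<^sup>2 \<ge> pi * u * (real_of_int \<bar>n\<bar> - 2)"
    using assms by (intro mult_left_mono) auto
  then have "exp (- pi * u * (x + of_int n)\<^sup>2) \<le> exp (2 * pi * u - pi * u * real (nat \<bar>n\<bar>))"
    by (simp add: algebra_simps)
  also have "\<dots> = exp (2 * pi * u) * exp (- pi * u) ^ nat \<bar>n\<bar>"
    by (simp add: exp_of_nat_mult[symmetric] mult_exp_exp algebra_simps)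
  finally show ?thesis by simp
qed

lemma gaussian_summable:
  fixes u x :: real
  assumes "u > 0" "x \<in> {0..1}"
  shows "(\<lambda>n::int. exp (- pi * u * (x + of_int n)\<^sup>2)) summable_on UNIV"
proof (rule summable_on_comparison_test)
  show "(\<lambda>n. exp (2 * pi * u) * (real_of_int \<bar>n\<bar> ^ 0 * exp (- pi * u) ^ nat \<bar>n\<bar>)) summable_on UNIV"
    using assms by (intro summable_on_cmult_right summable_on_int_geometric) auto
qed (use gaussian_term_bound[OF assms] in auto)

text \<open>\<open>F\<close> is the periodised Gaussian and \<open>K\<close> the cosine series built
  from its Fourier transform. Both are continuous, symmetric about 1/2 and have the same cosine
  coefficients, so they agree by \<open>continuous_even_fourier_zero\<close>; the identity is their
  equality at \<open>0\<close>.\<close>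

lemma poisson_gaussian:
  fixes u :: real
  assumes u: "u > 0"
  shows "(\<Sum>\<^sub>\<infinity>n::int. exp (- pi * u * (of_int n)\<^sup>2)) = (\<Sum>\<^sub>\<infinity>k::int. exp (- pi * (of_int k)\<^sup>2 / u)) / sqrt u"
proof -
  define e where "e = (\<lambda>(n::int) x::real. exp (- pi * u * (x + of_int n)\<^sup>2))"
  define F where "F = (\<lambda>x. \<Sum>\<^sub>\<infinity>n. e n x)"
  define c where "c = (\<lambda>k::int. exp (- pi * (of_int k)\<^sup>2 / u) / sqrt u)"
  define K where "K = (\<lambda>x. \<Sum>\<^sub>\<infinity>k. c k * cos (2 * pi * of_int k * x))"
  define M where "M = (\<lambda>n::int. exp (2 * pi * u) * (real_of_int \<bar>n\<bar> ^ 0 * exp (- pi * u) ^ nat \<bar>n\<bar>))"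
  have eM: "norm (e n x) \<le> M n" if "x \<in> {0..1}" for n x
    using gaussian_term_bound[OF u that] by (simp add: e_def M_def)
  have M: "M summable_on UNIV"
    unfolding M_def using u by (intro summable_on_cmult_right summable_on_int_geometric) auto
  have csum: "c summable_on UNIV"
  proof -
    have "(\<lambda>n::int. exp (- pi * (1 / u) * (0 + of_int n)\<^sup>2)) summable_on UNIV"
      using u by (intro gaussian_summable) auto
    then have "(\<lambda>n::int. exp (- pi * (1 / u) * (0 + of_int n)\<^sup>2) * (1 / sqrt u)) summable_on UNIV"
      by (rule summable_on_cmult_left)
    then show ?thesis by (simp add: c_def)
  qed
  have contF: "continuous_on {0..1} F" unfolding F_def
    by (rule infsum_continuous_on[OF _ eM M]) (auto simp: e_def intro!: continuous_intros)
  have cK: "norm (c k * cos (2 * pi * of_int k * x)) \<le> c k" for k x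
    using u by (auto simp: c_def abs_mult intro!: mult_left_le divide_right_mono)
  have contK: "continuous_on {0..1} K" unfolding K_def
    by (rule infsum_continuous_on[OF _ cK csum]) (auto intro!: continuous_intros)
  have symF: "F (1 - x) = F x" for x unfolding F_def
    by (rule infsum_reindex_bij_witness[where i = "\<lambda>n. - 1 - n" and j = "\<lambda>n. - 1 - n"])
       (auto simp: e_def power2_eq_square algebra_simps)
  have symK: "K (1 - x) = K x" for x
  proof -
    have "cos (2 * pi * of_int k * (1 - x)) = cos (2 * pi * of_int k * x)" for k :: int
      using cos_shift_int[of k "- x" 1] by (simp add: algebra_simps)
    then show ?thesis by (simp add: K_def)
  qed
  have coeffF: "integral {0..1} (\<lambda>x. F x * cos (2 * pi * of_int m * x)) = c m" for m :: int
  proof -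
    define \<phi> where "\<phi> = (\<lambda>y. exp (- pi * u * y\<^sup>2) * cos (2 * pi * of_int m * y))"
    have \<phi>: "integrable lborel \<phi>" "integral\<^sup>L lborel \<phi> = c m"
      using gaussian_fourier[OF u, of "of_int m"] by (simp_all add: \<phi>_def c_def)
    \<comment> \<open>\<open>g n\<close> is \<open>\<phi>\<close> cut to the interval from
      \<open>n\<close> to \<open>n + 1\<close>, and \<open>f n\<close> is that piece translated to
      the unit interval. Summing the integrals of the \<open>g n\<close> gives the integral over the
      line; summing those of the \<open>f n\<close> gives the coefficient of
      \<open>F\<close>.\<close>
    define f where "f = (\<lambda>n x. indicator {0..<1} x * \<phi> (of_int n + 1 * x))"
    define g where "g = (\<lambda>(n::int) y. indicator {of_int n..<of_int n + 1} y * \<phi> y)"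
    have fg: "f n x = g n (of_int n + 1 * x)" for n x
      by (auto simp: f_def g_def indicator_def)
    have gint: "integrable lborel (g n)" for n
      unfolding g_def using integrable_mult_indicator[OF _ \<phi>(1)] by simp
    have fint: "integrable lborel (f n)" for n
      unfolding fg by (rule lborel_integrable_real_affine[OF gint]) simp
    \<comment> \<open>At each point \<open>y\<close> only the piece with index
      \<open>\<lfloor>y\<rfloor>\<close> is nonzero. The general \<open>h\<close> covers both the
      norm and the identity.\<close>
    have gs: "((\<lambda>n. h (g n y)) has_sum h (\<phi> y)) UNIV" if "h 0 = 0" for y and h :: "real \<Rightarrow> real"
    proof -
      have "h (g n y) = 0" if "n \<noteq> \<lfloor>y\<rfloor>" for n
        using that \<open>h 0 = 0\<close> by (auto simp: g_def indicator_def floor_unique)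
      moreover have "((\<lambda>n. h (g n y)) has_sum h (g \<lfloor>y\<rfloor> y)) {\<lfloor>y\<rfloor>}"
        by (simp add: has_sum_finite_iff)
      ultimately have "((\<lambda>n. h (g n y)) has_sum h (g \<lfloor>y\<rfloor> y)) UNIV"
        by (subst has_sum_cong_neutral[where T = "{\<lfloor>y\<rfloor>}" and g = "\<lambda>n. h (g n y)"]) auto
      moreover have "g \<lfloor>y\<rfloor> y = \<phi> y" by (auto simp: g_def indicator_def)
      ultimately show ?thesis by simp
    qed
    have gsum: "(\<lambda>n. \<integral>y. norm (g n y) \<partial>lborel) summable_on UNIV"
      by (rule summable_on_integral_dominated[OF gint _ integrable_norm[OF \<phi>(1)]])
         (use gs[of norm] in auto)
    have shift: "(\<integral>x. h (f n x) \<partial>lborel) = (\<integral>y. h (g n y) \<partial>lborel)" for n and h :: "real \<Rightarrow> real"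
      unfolding fg using lborel_integral_real_affine[of 1 "\<lambda>y. h (g n y)" "of_int n"] by simp
    have "((\<lambda>n. \<integral>y. g n y \<partial>lborel) has_sum (\<integral>y. (\<Sum>\<^sub>\<infinity>n. g n y) \<partial>lborel)) UNIV"
      by (rule has_sum_integral(2)[OF gint _ gsum]) (use gs[of norm] in \<open>auto simp: summable_on_def\<close>)
    moreover have "(\<Sum>\<^sub>\<infinity>n. g n y) = \<phi> y" for y
      using gs[of "\<lambda>x. x"] by (intro infsumI) simp
    ultimately have 1: "((\<lambda>n. \<integral>y. g n y \<partial>lborel) has_sum c m) UNIV" using \<phi> by simp
    have fM: "norm (f n x) \<le> M n" for n x
    proof (cases "x \<in> {0..<1}")
      case True
      then have "norm (f n x) \<le> e n x"
        by (auto simp: f_def \<phi>_def e_def abs_mult add.commute intro!: mult_left_le)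
      also have "\<dots> \<le> M n" using eM[of x n] True by (auto simp: e_def)
      finally show ?thesis .
    qed (auto simp: f_def M_def)
    have fs: "(\<lambda>n. norm (f n x)) summable_on UNIV" for x
      by (rule summable_on_comparison_test[OF M]) (use fM in auto)
    have "((\<lambda>n. \<integral>x. f n x \<partial>lborel) has_sum (\<integral>x. (\<Sum>\<^sub>\<infinity>n. f n x) \<partial>lborel)) UNIV"
      by (rule has_sum_integral(2)[OF fint fs]) (use gsum shift[where h = norm] in simp)
    then have 2: "(\<integral>x. (\<Sum>\<^sub>\<infinity>n. f n x) \<partial>lborel) = c m"
      using 1 shift[of "\<lambda>x. x"] has_sum_unique by simp
    have "(\<Sum>\<^sub>\<infinity>n. f n x) = indicator {0..<1} x *\<^sub>R (F x * cos (2 * pi * of_int m * x))" for x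
    proof (cases "x \<in> {0..<1}")
      case True
      have "f n x = e n x * cos (2 * pi * of_int m * x)" for n
        using True cos_shift_int[of m x n] by (simp add: f_def e_def \<phi>_def add.commute)
      moreover have "((\<lambda>n. e n x) has_sum F x) UNIV"
        unfolding F_def using gaussian_summable[OF u, of x] True by (simp add: e_def)
      ultimately show ?thesis
        using True by (auto intro!: infsumI has_sum_cmult_left)
    qed (simp add: f_def)
    with 2 have "(LINT x:{0..<1}|lborel. F x * cos (2 * pi * of_int m * x)) = c m"
      by (simp add: set_lebesgue_integral_def)
    moreover have contFc: "continuous_on {0..1} (\<lambda>x. F x * cos (2 * pi * of_int m * x))"
      by (intro continuous_intros contF)
    have "set_integrable lborel {0..1} (\<lambda>x. F x * cos (2 * pi * of_int m * x))"
      by (rule borel_integrable_atLeastAtMost'[OF contFc])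
    then have "set_integrable lborel {0..<1} (\<lambda>x. F x * cos (2 * pi * of_int m * x))"
      by (rule set_integrable_subset) auto
    ultimately have "integral {0..<1} (\<lambda>x. F x * cos (2 * pi * of_int m * x)) = c m"
      by (simp add: set_borel_integral_eq_integral(2))
    moreover have "integral {0..<1} (\<lambda>x. F x * cos (2 * pi * of_int m * x)) = integral {0..1} (\<lambda>x. F x * cos (2 * pi * of_int m * x))"
      by (rule integral_subset_negligible) (auto intro: negligible_subset[of "{1}"])
    ultimately show ?thesis by simp
  qed
  have coeffK: "integral {0..1} (\<lambda>x. K x * cos (2 * pi * of_int m * x)) = c m" for m :: int
  proof -
    define f where "f = (\<lambda>k x. indicator {0..1} x *\<^sub>R (c k * cos (2 * pi * of_int k * x) * cos (2 * pi * of_int m * x)))"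
    have cont: "continuous_on {0..1} (\<lambda>x. c k * cos (2 * pi * of_int k * x) * cos (2 * pi * of_int m * x))" for k
      by (intro continuous_intros)
    have sint: "set_integrable lborel {0..1} (\<lambda>x. c k * cos (2 * pi * of_int k * x) * cos (2 * pi * of_int m * x))" for k
      by (rule borel_integrable_atLeastAtMost'[OF cont])
    then have fint: "integrable lborel (f k)" for k
      by (simp add: f_def set_integrable_def)
    have fb: "norm (f k x) \<le> indicator {0..1} x * c k" for k x
    proof -
      have "\<bar>c k * cos (2 * pi * of_int k * x)\<bar> * \<bar>cos (2 * pi * of_int m * x)\<bar> \<le> c k * 1"
        using cK[of k x] by (intro mult_mono) auto
      then show ?thesis by (auto simp: f_def indicator_def abs_mult)
    qed
    have fs: "(\<lambda>k. norm (f k x)) summable_on UNIV" for x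
    proof (rule summable_on_comparison_test[OF csum])
      fix k
      have "indicator {0..1} x * c k \<le> c k" using u by (auto simp: indicator_def c_def)
      with fb[of k x] show "norm (f k x) \<le> c k" by linarith
    qed simp
    have cint: "integrable lborel (\<lambda>x. indicator {0..1::real} x * c k)" for k
      by (intro integrable_mult_left) auto
    have fsum: "(\<lambda>k. \<integral>x. norm (f k x) \<partial>lborel) summable_on UNIV"
    proof (rule summable_on_comparison_test[OF csum])
      fix k
      have "(\<integral>x. norm (f k x) \<partial>lborel) \<le> (\<integral>x. indicator {0..1::real} x * c k \<partial>lborel)"
        by (intro integral_mono fint integrable_norm cint fb)
      then show "(\<integral>x. norm (f k x) \<partial>lborel) \<le> c k" by simp
    qed simp
    have hs: "((\<lambda>k. \<integral>x. f k x \<partial>lborel) has_sum (\<integral>x. (\<Sum>\<^sub>\<infinity>k. f k x) \<partial>lborel)) UNIV"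
      by (rule has_sum_integral(2)[OF fint fs fsum])
    have fk: "(\<integral>x. f k x \<partial>lborel) = c k * (((if k = m then 1 else 0) + (if k = - m then 1 else 0)) / 2)" for k
    proof -
      have "(\<integral>x. f k x \<partial>lborel) = integral {0..1} (\<lambda>x. c k * (cos (2 * pi * of_int k * x) * cos (2 * pi * of_int m * x)))"
        using set_borel_integral_eq_integral(2)[OF sint[of k]]
        by (simp only: f_def set_lebesgue_integral_def mult.assoc)
      then show ?thesis by (simp only: integral_mult_right integral_cos_cos)
    qed
    \<comment> \<open>By orthogonality only \<open>k = m\<close> and \<open>k = - m\<close> survive.
      They contribute half of \<open>c m\<close> each, since \<open>c\<close> is even, and coincide
      for \<open>m = 0\<close>.\<close>
    have "((\<lambda>k. \<integral>x. f k x \<partial>lborel) has_sum (\<Sum>k\<in>{m, - m}. \<integral>x. f k x \<partial>lborel)) {m, - m}"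
      by (rule has_sum_finite) auto
    then have "((\<lambda>k. \<integral>x. f k x \<partial>lborel) has_sum (\<Sum>k\<in>{m, - m}. \<integral>x. f k x \<partial>lborel)) UNIV"
      by (subst has_sum_cong_neutral[where T = "{m, - m}" and g = "\<lambda>k. \<integral>x. f k x \<partial>lborel"]) (auto simp: fk)
    then have "((\<lambda>k. \<integral>x. f k x \<partial>lborel) has_sum c m) UNIV"
    proof (rule back_subst[where P = "\<lambda>s. (_ has_sum s) UNIV"])
      show "(\<Sum>k\<in>{m, - m}. \<integral>x. f k x \<partial>lborel) = c m"
        by (cases "m = 0") (auto simp: fk c_def)
    qed
    then have "(\<integral>x. (\<Sum>\<^sub>\<infinity>k. f k x) \<partial>lborel) = c m"
      using hs has_sum_unique by blast
    moreover have "(\<Sum>\<^sub>\<infinity>k. f k x) = indicator {0..1} x *\<^sub>R (K x * cos (2 * pi * of_int m * x))" for x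
    proof -
      have "(\<lambda>k. c k * cos (2 * pi * of_int k * x)) summable_on UNIV"
        by (rule abs_summable_summable, rule summable_on_comparison_test[OF csum]) (use cK in auto)
      then have "((\<lambda>k. c k * cos (2 * pi * of_int k * x)) has_sum K x) UNIV"
        by (simp add: K_def)
      from has_sum_cmult_right[OF has_sum_cmult_left[OF this, of "cos (2 * pi * of_int m * x)"], of "indicator {0..1} x"]
      show ?thesis by (intro infsumI) (simp add: f_def)
    qed
    moreover have "set_integrable lborel {0..1} (\<lambda>x. K x * cos (2 * pi * of_int m * x))"
      by (rule borel_integrable_atLeastAtMost') (intro continuous_intros contK)
    ultimately show ?thesis
      using set_borel_integral_eq_integral(2)[of "{0..1}" "\<lambda>x. K x * cos (2 * pi * of_int m * x)"]
      by (simp only: set_lebesgue_integral_def)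
  qed
  have "F 0 - K 0 = 0"
  proof (rule continuous_even_fourier_zero[where h = "\<lambda>x. F x - K x" and x = 0])
    show "continuous_on {0..1} (\<lambda>x. F x - K x)" by (intro continuous_intros contF contK)
    show "integral {0..1} (\<lambda>x. (F x - K x) * cos (2 * pi * of_int m * x)) = 0" for m :: int
    proof -
      have "integral {0..1} (\<lambda>x. F x * cos (2 * pi * of_int m * x) - K x * cos (2 * pi * of_int m * x)) = c m - c m"
        by (subst integral_diff)
           (auto intro!: integrable_continuous_real continuous_intros contF contK simp: coeffF coeffK)
      then show ?thesis by (simp add: algebra_simps)
    qed
  qed (auto simp: symF symK)
  moreover have "K 0 = (\<Sum>\<^sub>\<infinity>k::int. exp (- pi * (of_int k)\<^sup>2 / u)) / sqrt u"
    unfolding K_def c_def divide_inverse[of _ "sqrt u"] by (simp add: infsum_cmult_left')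
  ultimately show ?thesis by (simp add: F_def e_def)
qed

subsection \<open>Exponential integrals over the real line\<close>

text \<open>Euler's integral under the substitution \<open>t = exp v\<close>, whose Jacobian turns
  the exponent \<open>s - 1\<close> into \<open>s\<close>.\<close>

lemma Gamma_integral_line:
  fixes s :: complex
  assumes "Re s > 0"
  shows "integrable lborel (\<lambda>v. exp (s * of_real v - of_real (exp v)))"
    and "(\<integral>v. exp (s * of_real v - of_real (exp v)) \<partial>lborel) = Gamma s"
proof -
  define f where "f = (\<lambda>t. complex_of_real t powr (s - 1) / of_real (exp t))"
  have img: "range (exp :: real \<Rightarrow> real) = {0<..}"
  proof safe
    fix x :: real assume "x > 0"
    then have "x = exp (ln x)" by simp
    then show "x \<in> range exp" by blast
  qed simp
  have "f absolutely_integrable_on range (exp :: real \<Rightarrow> real) \<and> integral (range exp) f = Gamma s"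
    unfolding img f_def
    using absolutely_integrable_Gamma_integral'[OF assms] integral_unique[OF Gamma_integral_complex'[OF assms]]
    by blast
  then have "(\<lambda>v. \<bar>exp v\<bar> *\<^sub>R f (exp v)) absolutely_integrable_on UNIV \<and>
             integral UNIV (\<lambda>v. \<bar>exp v\<bar> *\<^sub>R f (exp v)) = Gamma s"
    by (subst has_absolute_integral_change_of_variables_real) (auto intro!: derivative_eq_intros inj_onI)
  moreover have eq: "\<bar>exp v\<bar> *\<^sub>R f (exp v) = exp (s * of_real v - of_real (exp v))" for v :: real
  proof -
    have "complex_of_real (exp v) powr (s - 1) = exp ((s - 1) * of_real v)"
      by (simp add: powr_def Ln_of_real)
    moreover have "complex_of_real (exp v) * exp ((s - 1) * of_real v) = exp (s * of_real v)"
      unfolding exp_of_real[symmetric] mult_exp_exp by (simp add: algebra_simps)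
    ultimately show ?thesis
      by (simp add: f_def scaleR_conv_of_real exp_diff exp_of_real)
  qed
  ultimately have *: "(\<lambda>v. exp (s * of_real v - of_real (exp v))) absolutely_integrable_on UNIV"
     "integral UNIV (\<lambda>v. exp (s * of_real v - of_real (exp v))) = Gamma s"
    by simp_all
  \<comment> \<open>The change of variables lives in Lebesgue measure; Borel measurability allows
    the return to \<open>lborel\<close>.\<close>
  have meas: "(\<lambda>v. exp (s * of_real v - of_real (exp v))) \<in> borel_measurable lborel"
  proof -
    have "(\<lambda>v. exp (s * of_real v - of_real (exp v))) \<in> borel_measurable borel"
      by (intro borel_measurable_continuous_onI continuous_intros)
    then show ?thesis by simp
  qed
  have L: "integrable lebesgue (\<lambda>v. exp (s * of_real v - of_real (exp v)))"
    using *(1) by (simp add: set_integrable_def)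
  then show "integrable lborel (\<lambda>v. exp (s * of_real v - of_real (exp v)))"
    using integrable_completion[OF meas] by simp
  have "(LINT v:UNIV|lebesgue. exp (s * of_real v - of_real (exp v))) = Gamma s"
    using *(2) set_lebesgue_integral_eq_integral(2)[OF *(1)] by simp
  then show "(\<integral>v. exp (s * of_real v - of_real (exp v)) \<partial>lborel) = Gamma s"
    using integral_completion[OF meas] by (simp add: set_lebesgue_integral_def)
qed

lemma Gamma_integral_line_scaled:
  fixes s :: complex and c :: real
  assumes "Re s > 0" "c > 0"
  shows "integrable lborel (\<lambda>v. exp (s * of_real v - of_real (c * exp v)))"
    and "(\<integral>v. exp (s * of_real v - of_real (c * exp v)) \<partial>lborel) = of_real c powr (- s) * Gamma s"
proof -
  define f where "f = (\<lambda>v::real. exp (s * of_real v - of_real (exp v)))"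
  have f: "integrable lborel f" "integral\<^sup>L lborel f = Gamma s"
    using Gamma_integral_line[OF assms(1)] by (simp_all add: f_def)
  have eq: "exp (s * of_real v - of_real (c * exp v)) = of_real c powr (- s) * f (ln c + 1 * v)" for v :: real
  proof -
    have "exp (ln c + v) = c * exp v" using assms(2) by (simp add: exp_add)
    then show ?thesis
      using assms(2) by (simp add: f_def powr_def Ln_of_real ring_distribs flip: exp_add)
  qed
  show "integrable lborel (\<lambda>v. exp (s * of_real v - of_real (c * exp v)))"
    unfolding eq by (intro integrable_mult_right lborel_integrable_real_affine[OF f(1)]) auto
  show "(\<integral>v. exp (s * of_real v - of_real (c * exp v)) \<partial>lborel) = of_real c powr (- s) * Gamma s"
    unfolding eq using lborel_integral_real_affine[of 1 f "ln c"] f by simp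
qed

lemma Gamma_integral_line_real:
  fixes r c :: real
  assumes "r > 0" "c > 0"
  shows "integrable lborel (\<lambda>v. exp (r * v - c * exp v))"
    and "(\<integral>v. exp (r * v - c * exp v) \<partial>lborel) = c powr (- r) * Gamma r"
proof -
  have eq: "complex_of_real (exp (r * v - c * exp v)) = exp (of_real r * of_real v - of_real (c * exp v))" for v
    by (simp flip: exp_of_real)
  have "integrable lborel (\<lambda>v. complex_of_real (exp (r * v - c * exp v)))"
    unfolding eq using assms by (intro Gamma_integral_line_scaled) auto
  then show "integrable lborel (\<lambda>v. exp (r * v - c * exp v))"
    by (simp add: complex_of_real_integrable_eq)
  have "(\<integral>v. complex_of_real (exp (r * v - c * exp v)) \<partial>lborel) = of_real (c powr (- r) * Gamma r)"
    unfolding eq using assms Gamma_integral_line_scaled(2)[of "of_real r" c]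
    by (simp add: powr_of_real[symmetric] Gamma_complex_of_real)
  then show "(\<integral>v. exp (r * v - c * exp v) \<partial>lborel) = c powr (- r) * Gamma r"
    unfolding integral_complex_of_real of_real_eq_iff .
qed

lemma lborel_integrable_reflect:
  fixes f :: "real \<Rightarrow> 'a :: {banach, second_countable_topology}"
  shows "integrable lborel f \<Longrightarrow> integrable lborel (\<lambda>v. f (- v))"
  using lborel_integrable_real_affine[of f "-1" 0] by simp

lemma lborel_integral_reflect:
  fixes f :: "real \<Rightarrow> 'a :: {banach, second_countable_topology}"
  shows "(\<integral>v. f (- v) \<partial>lborel) = (\<integral>v. f v \<partial>lborel)"
  using lborel_integral_real_affine[of "-1" f 0] by simp

text \<open>Drop the \<open>B\<close> term for \<open>v \<ge> 0\<close> and the \<open>A\<close>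
  term for \<open>v \<le> 0\<close>. Replacing \<open>c\<close> by
  \<open>r = \<bar>c\<bar> + 1\<close> enlarges the exponent on either side and makes both remaining
  Gamma integrals converge.\<close>

lemma integrable_two_sided_kernel_real:
  fixes c A B :: real
  assumes "A > 0" "B > 0"
  shows "integrable lborel (\<lambda>v. exp (c * v - A * exp v - B * exp (- v)))"
proof (rule Bochner_Integration.integrable_bound)
  define r where "r = \<bar>c\<bar> + 1"
  show "integrable lborel (\<lambda>v. exp (r * v - A * exp v) + exp (r * (- v) - B * exp (- v)))"
    by (intro Bochner_Integration.integrable_add Gamma_integral_line_real(1)
          lborel_integrable_reflect[where f = "\<lambda>v. exp (r * v - B * exp v)"]) (use assms in \<open>auto simp: r_def\<close>)
  show "AE v in lborel. norm (exp (c * v - A * exp v - B * exp (- v))) \<le>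
          norm (exp (r * v - A * exp v) + exp (r * (- v) - B * exp (- v)))"
  proof (intro AE_I2)
    fix v :: real
    have aux: "norm z \<le> norm (x + y)" if "z \<le> x \<or> z \<le> y" "0 \<le> x" "0 \<le> y" "0 \<le> z" for x y z :: real
      using that by auto
    have "c * v - A * exp v - B * exp (- v) \<le> r * v - A * exp v" if "v \<ge> 0"
    proof -
      have "c * v \<le> r * v" using that by (intro mult_right_mono) (auto simp: r_def)
      moreover have "B * exp (- v) \<ge> 0" using assms by simp
      ultimately show ?thesis by linarith
    qed
    moreover have "c * v - A * exp v - B * exp (- v) \<le> r * (- v) - B * exp (- v)" if "v \<le> 0"
    proof -
      have "- c * (- v) \<le> r * (- v)" using that by (intro mult_right_mono) (auto simp: r_def)
      moreover have "A * exp v \<ge> 0" using assms by simp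
      ultimately show ?thesis by linarith
    qed
    ultimately have "exp (c * v - A * exp v - B * exp (- v)) \<le> exp (r * v - A * exp v) \<or>
          exp (c * v - A * exp v - B * exp (- v)) \<le> exp (r * (- v) - B * exp (- v))"
      by (cases "v \<ge> 0") auto
    then show "norm (exp (c * v - A * exp v - B * exp (- v))) \<le>
          norm (exp (r * v - A * exp v) + exp (r * (- v) - B * exp (- v)))"
      by (rule aux) auto
  qed
qed auto

lemma integrable_two_sided_kernel:
  fixes \<nu> :: complex and A B :: real
  assumes "A > 0" "B > 0"
  shows "integrable lborel (\<lambda>v. exp (\<nu> * of_real v - of_real (A * exp v) - of_real (B * exp (- v))))"
proof (rule Bochner_Integration.integrable_bound[OF integrable_two_sided_kernel_real[OF assms, of "Re \<nu>"]])
  show "(\<lambda>v. exp (\<nu> * of_real v - of_real (A * exp v) - of_real (B * exp (- v)))) \<in> borel_measurable lborel"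
  proof -
    have "(\<lambda>v. exp (\<nu> * of_real v - of_real (A * exp v) - of_real (B * exp (- v)))) \<in> borel_measurable borel"
      by (intro borel_measurable_continuous_onI continuous_intros)
    then show ?thesis by simp
  qed
qed (auto simp: norm_exp_eq_Re)

lemma exp_sums_divide: "(\<lambda>n. x ^ n / fact n) sums exp x" for x :: "'x :: {real_normed_field, banach}"
  using exp_converges[of x] by (simp add: scaleR_conv_of_real field_simps)

text \<open>Expanding \<open>exp (s * v)\<close> and integrating term by term, dominated by
  \<open>exp (norm s * \<bar>v\<bar>) * norm (g v)\<close>, exhibits the integral as an everywhere
  convergent power series in \<open>s\<close>.\<close>

lemma integral_exp_entire:
  fixes g :: "real \<Rightarrow> complex"
  assumes meas: "g \<in> borel_measurable borel"
    and int: "\<And>c. integrable lborel (\<lambda>v. exp (c * \<bar>v\<bar>) * norm (g v))"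
  shows "integrable lborel (\<lambda>v. exp (s * of_real v) * g v)"
    and "(\<lambda>s. \<integral>v. exp (s * of_real v) * g v \<partial>lborel) holomorphic_on UNIV"
proof -
  show *: "integrable lborel (\<lambda>v. exp (s * of_real v) * g v)" for s
  proof (rule Bochner_Integration.integrable_bound[OF int[of "norm s"]])
    show "(\<lambda>v. exp (s * of_real v) * g v) \<in> borel_measurable lborel"
      using meas by measurable
    have "Re s * v \<le> cmod s * \<bar>v\<bar>" for v
    proof -
      have "Re s * v \<le> \<bar>Re s\<bar> * \<bar>v\<bar>" by (metis abs_ge_self abs_mult)
      also have "\<dots> \<le> cmod s * \<bar>v\<bar>" by (intro mult_right_mono abs_Re_le_cmod) auto
      finally show ?thesis .
    qed
    then show "AE v in lborel. norm (exp (s * of_real v) * g v) \<le> norm (exp (cmod s * \<bar>v\<bar>) * norm (g v))"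
      by (auto simp: norm_mult norm_exp_eq_Re intro!: mult_right_mono)
  qed
  define a where "a = (\<lambda>n. \<integral>v. of_real v ^ n / fact n * g v \<partial>lborel)"
  have ser: "(\<lambda>n. a n * s ^ n) sums (\<integral>v. exp (s * of_real v) * g v \<partial>lborel)" for s
  proof -
    define f where "f = (\<lambda>n v. (s * of_real v) ^ n / fact n * g v)"
    have nf: "norm (f n v) = (norm s * \<bar>v\<bar>) ^ n / fact n * norm (g v)" for n v
      by (simp add: f_def norm_mult norm_divide norm_power power_mult_distrib)
    have nsum: "(\<lambda>n. norm (f n v)) sums (exp (norm s * \<bar>v\<bar>) * norm (g v))" for v
      unfolding nf by (intro sums_mult2 exp_sums_divide)
    have meas_f: "f n \<in> borel_measurable lborel" for n
      unfolding f_def using meas by measurable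
    have fint: "integrable lborel (f n)" for n
    proof (rule Bochner_Integration.integrable_bound[OF int[of "norm s"] meas_f])
      have "norm (f n v) \<le> exp (norm s * \<bar>v\<bar>) * norm (g v)" for v
        using sum_le_suminf[of "\<lambda>n. norm (f n v)" "{n}"] nsum[of v] by (simp add: sums_iff)
      then show "AE v in lborel. norm (f n v) \<le> norm (exp (norm s * \<bar>v\<bar>) * norm (g v))"
        by (auto simp: abs_mult)
    qed
    have hs: "((\<lambda>n. norm (f n v)) has_sum (exp (norm s * \<bar>v\<bar>) * norm (g v))) UNIV" for v
      using nsum[of v] by (intro norm_summable_imp_has_sum) (auto simp: sums_iff)
    have "((\<lambda>n. \<integral>v. f n v \<partial>lborel) has_sum (\<integral>v. (\<Sum>\<^sub>\<infinity>n. f n v) \<partial>lborel)) UNIV"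
    proof (rule has_sum_integral(2)[OF fint])
      show "(\<lambda>n. norm (f n v)) summable_on UNIV" for v using hs by (rule has_sum_imp_summable)
      show "(\<lambda>n. \<integral>v. norm (f n v) \<partial>lborel) summable_on UNIV"
        by (rule summable_on_integral_dominated[OF fint hs int])
    qed
    moreover have "(\<Sum>\<^sub>\<infinity>n. f n v) = exp (s * of_real v) * g v" for v
    proof (rule infsumI, rule norm_summable_imp_has_sum)
      show "summable (\<lambda>n. norm (f n v))" using nsum by (rule sums_summable)
      show "(\<lambda>n. f n v) sums (exp (s * of_real v) * g v)"
        unfolding f_def by (intro sums_mult2 exp_sums_divide)
    qed
    moreover have "(\<integral>v. f n v \<partial>lborel) = a n * s ^ n" for n
    proof -
      have "f n = (\<lambda>v. (of_real v ^ n / fact n * g v) * s ^ n)"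
        by (rule ext) (simp add: f_def power_mult_distrib)
      then show ?thesis by (simp add: a_def)
    qed
    ultimately show ?thesis by (auto dest: has_sum_imp_sums)
  qed
  show "(\<lambda>s. \<integral>v. exp (s * of_real v) * g v \<partial>lborel) holomorphic_on UNIV"
  proof -
    have "(\<lambda>s. \<integral>v. exp (s * of_real v) * g v \<partial>lborel) holomorphic_on ball 0 r" for r
      by (rule power_series_holomorphic[where a = a]) (use ser in auto)
    then have "(\<lambda>s. \<integral>v. exp (s * of_real v) * g v \<partial>lborel) field_differentiable at z" for z
      by (rule holomorphic_on_imp_differentiable_at[where s = "ball 0 (norm z + 1)"]) auto
    then show ?thesis by (simp add: holomorphic_on_def)
  qed
qed

subsection \<open>Modified Bessel functions\<close>

lemma integral_FTC_line:
  fixes f F :: "real \<Rightarrow> 'a::euclidean_space"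
  assumes "\<And>x. (F has_vector_derivative f x) (at x)" "\<And>x. isCont f x" "integrable lborel f"
    and "(F \<longlongrightarrow> A) at_bot" "(F \<longlongrightarrow> B) at_top"
  shows "(\<integral>x. f x \<partial>lborel) = B - A"
proof -
  have "(LBINT x=-\<infinity>..\<infinity>. f x) = B - A"
    by (rule interval_integral_FTC_integrable)
       (use assms in \<open>auto simp: set_integrable_def o_def at_right_MInf at_left_PInf filterlim_filtermap\<close>)
  then show ?thesis
    by (simp add: interval_lebesgue_integral_def set_lebesgue_integral_def)
qed

definition bessel_kernel :: "complex \<Rightarrow> real \<Rightarrow> real \<Rightarrow> complex" where
  "bessel_kernel \<nu> y v = exp (\<nu> * of_real v - of_real (exp v) - of_real (y * exp (- v)))"

text \<open>For \<open>y > 0\<close> and non-integer order this is 2 y^(\<nu>/2) K_\<nu>(2 sqrt y),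
  see \<open>bessel_K_integral\<close>. The normalisation keeps the recurrence free of fractional
  powers.\<close>

definition bessel_integral :: "complex \<Rightarrow> real \<Rightarrow> complex" where
  "bessel_integral \<nu> y = (\<integral>v. bessel_kernel \<nu> y v \<partial>lborel)"

text \<open>This is y^(-\<nu>/2) I_\<nu>(2 sqrt y), which is entire in \<open>y\<close> because the
  branch factor has been removed.\<close>

definition bessel_series :: "complex \<Rightarrow> complex \<Rightarrow> complex" where
  "bessel_series \<nu> y = (\<Sum>k. rGamma (\<nu> + of_nat k + 1) / fact k * y ^ k)"

lemma integrable_bessel_kernel: "y > 0 \<Longrightarrow> integrable lborel (bessel_kernel \<nu> y)"
  using integrable_two_sided_kernel[of 1 y \<nu>] by (simp add: bessel_kernel_def[abs_def])

lemma norm_bessel_kernel: "norm (bessel_kernel \<nu> y v) = exp (Re \<nu> * v - exp v - y * exp (- v))"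
  by (simp add: bessel_kernel_def norm_exp_eq_Re)

text \<open>The derivative of the kernel integrates to zero, and multiplying the kernel by
  \<open>exp v\<close> or \<open>exp (- v)\<close> shifts the order by one.\<close>

lemma bessel_integral_rec:
  assumes "y > 0"
  shows "bessel_integral (\<nu> + 1) y = \<nu> * bessel_integral \<nu> y + of_real y * bessel_integral (\<nu> - 1) y"
proof -
  have k1: "of_real (exp v) * bessel_kernel \<nu> y v = bessel_kernel (\<nu> + 1) y v" for v
    by (simp add: bessel_kernel_def algebra_simps flip: exp_of_real exp_add)
  have k2: "of_real (exp (- v)) * bessel_kernel \<nu> y v = bessel_kernel (\<nu> - 1) y v" for v
    by (simp add: bessel_kernel_def algebra_simps flip: exp_of_real exp_add)
  define f where "f = (\<lambda>v. \<nu> * bessel_kernel \<nu> y v - bessel_kernel (\<nu> + 1) y v + of_real y * bessel_kernel (\<nu> - 1) y v)"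
  have "(\<integral>v. f v \<partial>lborel) = 0 - 0"
  proof (rule integral_FTC_line[where F = "bessel_kernel \<nu> y"])
    fix v
    have "f v = bessel_kernel \<nu> y v * (\<nu> - of_real (exp v) + of_real (y * exp (- v)))"
      unfolding f_def k1[symmetric] k2[symmetric] by (simp add: algebra_simps)
    moreover have "((\<lambda>v. bessel_kernel \<nu> y v) has_vector_derivative
        bessel_kernel \<nu> y v * (\<nu> - of_real (exp v) + of_real (y * exp (- v)))) (at v)"
    proof -
      have "((\<lambda>z. exp (\<nu> * z - exp z - of_real y * exp (- z))) has_field_derivative
          exp (\<nu> * of_real v - exp (of_real v) - of_real y * exp (- of_real v)) *
            (\<nu> - exp (of_real v) + of_real y * exp (- of_real v))) (at (of_real v))"
        by (auto intro!: derivative_eq_intros simp: algebra_simps)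
      from has_vector_derivative_real_field[OF this, of UNIV] show ?thesis
        by (simp add: bessel_kernel_def flip: exp_of_real)
    qed
    ultimately show "(bessel_kernel \<nu> y has_vector_derivative f v) (at v)" by simp
    show "isCont f v" unfolding f_def bessel_kernel_def by (intro continuous_intros)
  next
    show "integrable lborel f" unfolding f_def
      by (intro Bochner_Integration.integrable_add Bochner_Integration.integrable_diff integrable_mult_right integrable_bessel_kernel assms)
    have "((\<lambda>v. exp (Re \<nu> * v - exp v - y * exp (- v))) \<longlongrightarrow> 0) at_top"
      using assms by real_asymp
    then show "(bessel_kernel \<nu> y \<longlongrightarrow> 0) at_top"
      by (rule Lim_null_comparison[rotated]) (simp add: norm_bessel_kernel)
    have "((\<lambda>v. exp (Re \<nu> * v - exp v - y * exp (- v))) \<longlongrightarrow> 0) at_bot"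
      using assms by real_asymp
    then show "(bessel_kernel \<nu> y \<longlongrightarrow> 0) at_bot"
      by (rule Lim_null_comparison[rotated]) (simp add: norm_bessel_kernel)
  qed
  moreover have "(\<integral>v. f v \<partial>lborel) = \<nu> * bessel_integral \<nu> y - bessel_integral (\<nu> + 1) y + of_real y * bessel_integral (\<nu> - 1) y"
    unfolding f_def bessel_integral_def using integrable_bessel_kernel[OF assms] by simp
  ultimately show ?thesis by (simp add: algebra_simps)
qed

text \<open>The substitution \<open>v \<mapsto> ln y - v\<close> exchanges \<open>exp v\<close> with
  \<open>y * exp (- v)\<close>.\<close>

lemma bessel_integral_minus:
  assumes "y > 0"
  shows "bessel_integral (- \<nu>) y = of_real y powr (- \<nu>) * bessel_integral \<nu> y"
proof -
  have eq: "bessel_kernel (- \<nu>) y (ln y + (- 1) * v) = of_real y powr (- \<nu>) * bessel_kernel \<nu> y v" for v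
  proof -
    have "exp (ln y - v) = y * exp (- v)" "y * exp (- (ln y - v)) = exp v"
      using assms by (simp_all add: exp_diff exp_minus field_simps)
    moreover have "of_real y powr (- \<nu>) = exp (- \<nu> * of_real (ln y))"
      using assms by (simp add: powr_def Ln_of_real)
    ultimately show ?thesis
      by (simp add: bessel_kernel_def algebra_simps flip: exp_add)
  qed
  have "bessel_integral (- \<nu>) y = (\<integral>v. bessel_kernel (- \<nu>) y (ln y + (- 1) * v) \<partial>lborel)"
    unfolding bessel_integral_def using lborel_integral_real_affine[of "-1" "bessel_kernel (- \<nu>) y" "ln y"] by simp
  then show ?thesis unfolding eq by (simp add: bessel_integral_def)
qed

section \<open>The power series solution and its Wronskian\<close>

lemma summable_bessel_series:
  fixes \<nu> y :: complex
  shows "summable (\<lambda>k. rGamma (\<nu> + of_nat k + 1) / fact k * y ^ k)"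
proof -
  \<comment> \<open>Beyond \<open>N\<close> the ratio bound holds:
    \<open>norm y / (k + 1) \<le> 1 / 2\<close> and
    \<open>norm (\<nu> + of_nat k + 1) \<ge> 1\<close>. Writing the earlier coefficient through the
    later one avoids dividing by a possibly vanishing \<open>rGamma\<close>.\<close>
  define N where "N = nat \<lceil>norm \<nu> + 2 * norm y + 1\<rceil>"
  show ?thesis
  proof (rule summable_ratio_test[where c = "1/2" and N = N])
    fix k assume k: "N \<le> k"
    then have kk: "real k \<ge> norm \<nu> + 2 * norm y + 1" unfolding N_def by linarith
    have "norm (\<nu> + of_nat k + 1) \<ge> real k + 1 - norm \<nu>"
      using norm_triangle_ineq4[of "\<nu> + of_nat k + 1" \<nu>]
      by (simp add: algebra_simps) (metis norm_of_nat of_nat_Suc)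
    then have n1: "norm (\<nu> + of_nat k + 1) \<ge> 1" using kk norm_ge_zero[of y] by linarith
    define r where "r = rGamma (\<nu> + of_nat (Suc k) + 1)"
    have r: "rGamma (\<nu> + of_nat k + 1) = (\<nu> + of_nat k + 1) * r"
      using rGamma_plus1[of "\<nu> + of_nat k + 1"] by (simp add: r_def add_ac)
    have "norm (r / fact (Suc k) * y ^ Suc k) = norm r / fact k * norm y ^ k * (norm y / (real k + 1))"
      unfolding norm_mult norm_divide norm_power norm_fact by (simp add: field_simps)
    also have "\<dots> \<le> norm r / fact k * norm y ^ k * (1 / 2)"
    proof (intro mult_left_mono)
      have "2 * norm y \<le> real k + 1" using kk norm_ge_zero[of \<nu>] by linarith
      then show "norm y / (real k + 1) \<le> 1 / 2" by (simp add: field_simps)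
    qed auto
    also have "\<dots> \<le> norm r / fact k * norm y ^ k * (1 / 2) * norm (\<nu> + of_nat k + 1)"
      using mult_left_mono[OF n1, of "norm r / fact k * norm y ^ k * (1 / 2)"] by simp
    also have "\<dots> = 1 / 2 * norm (rGamma (\<nu> + of_nat k + 1) / fact k * y ^ k)"
      unfolding r by (simp add: norm_mult norm_divide norm_power mult_ac)
    finally show "norm (rGamma (\<nu> + of_nat (Suc k) + 1) / fact (Suc k) * y ^ Suc k) \<le>
        1 / 2 * norm (rGamma (\<nu> + of_nat k + 1) / fact k * y ^ k)" unfolding r_def .
  qed simp
qed

lemma bessel_series_diffs:
  "diffs (\<lambda>k. rGamma (\<nu> + of_nat k + 1) / fact k) = (\<lambda>k. rGamma (\<nu> + 1 + of_nat k + 1) / fact k)"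
  for \<nu> :: complex
proof
  fix k
  have e: "\<nu> + of_nat (Suc k) + 1 = \<nu> + 1 + of_nat k + 1" by simp
  show "diffs (\<lambda>k. rGamma (\<nu> + of_nat k + 1) / fact k) k = rGamma (\<nu> + 1 + of_nat k + 1) / fact k"
    unfolding diffs_def e by (simp del: of_nat_Suc)
qed

lemma DERIV_bessel_series: "(bessel_series \<nu> has_field_derivative bessel_series (\<nu> + 1) y) (at y)"
  using termdiffs_strong_converges_everywhere[OF summable_bessel_series, of \<nu> y]
  unfolding bessel_series_diffs bessel_series_def[abs_def] .

text \<open>Coefficientwise this is \<open>rGamma_plus1\<close> at \<open>\<nu> + of_nat k\<close>:
  the part \<open>of_nat k\<close> comes from \<open>y\<close> times the derivative, which raises
  the order by one.\<close>

lemma bessel_series_rec: "bessel_series (\<nu> - 1) y = \<nu> * bessel_series \<nu> y + y * bessel_series (\<nu> + 1) y"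
proof -
  define c where "c = (\<lambda>k. rGamma (\<nu> + of_nat k + 1) / fact k :: complex)"
  have "(\<lambda>k. c k * y ^ k) sums bessel_series \<nu> y"
    unfolding c_def bessel_series_def by (rule summable_sums[OF summable_bessel_series])
  then have 1: "(\<lambda>k. \<nu> * (c k * y ^ k)) sums (\<nu> * bessel_series \<nu> y)" by (rule sums_mult)
  have "summable (\<lambda>k. diffs c k * y ^ k)"
    unfolding c_def bessel_series_diffs by (rule summable_bessel_series)
  from sums_mult[OF diffs_equiv[OF this], of y]
  have "(\<lambda>k. y * (of_nat k * c k * y ^ (k - Suc 0))) sums (y * bessel_series (\<nu> + 1) y)"
    by (simp only: c_def bessel_series_diffs bessel_series_def)
  moreover have "y * (of_nat k * c k * y ^ (k - Suc 0)) = of_nat k * c k * y ^ k" for k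
    by (cases k) auto
  ultimately have 2: "(\<lambda>k. of_nat k * c k * y ^ k) sums (y * bessel_series (\<nu> + 1) y)" by simp
  have "\<nu> * (c k * y ^ k) + of_nat k * c k * y ^ k = rGamma (\<nu> - 1 + of_nat k + 1) / fact k * y ^ k" for k
  proof -
    have "\<nu> * (c k * y ^ k) + of_nat k * c k * y ^ k = (\<nu> + of_nat k) * rGamma (\<nu> + of_nat k + 1) / fact k * y ^ k"
      by (simp add: c_def algebra_simps add_divide_distrib)
    then show ?thesis unfolding rGamma_plus1 by simp
  qed
  with sums_add[OF 1 2] show ?thesis
    by (simp add: bessel_series_def sums_iff)
qed

lemma bessel_series_0: "bessel_series \<nu> 0 = rGamma (\<nu> + 1)"
  unfolding bessel_series_def powser_zero by simp

text \<open>The derivative of the left-hand side in \<open>y\<close> vanishes, so it equals its value at \<open>0\<close>.\<close>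

lemma bessel_series_wronskian:
  "bessel_series (\<nu> - 1) y * bessel_series (- \<nu>) y - y * bessel_series \<nu> y * bessel_series (1 - \<nu>) y =
     sin (of_real pi * \<nu>) / of_real pi"
proof -
  define D where "D = (\<lambda>y. bessel_series (\<nu> - 1) y * bessel_series (- \<nu>) y - y * bessel_series \<nu> y * bessel_series (1 - \<nu>) y)"
  have "(D has_field_derivative 0) (at y)" for y
  proof -
    have 1: "(bessel_series (\<nu> - 1) has_field_derivative bessel_series \<nu> y) (at y)"
      using DERIV_bessel_series[of "\<nu> - 1" y] by simp
    have 2: "(bessel_series (- \<nu>) has_field_derivative bessel_series (1 - \<nu>) y) (at y)"
      using DERIV_bessel_series[of "- \<nu>" y] by simp
    have 3: "(bessel_series (1 - \<nu>) has_field_derivative bessel_series (2 - \<nu>) y) (at y)"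
      using DERIV_bessel_series[of "1 - \<nu>" y] by simp
    have r1: "bessel_series (\<nu> - 1) y = \<nu> * bessel_series \<nu> y + y * bessel_series (\<nu> + 1) y"
      by (rule bessel_series_rec)
    have r2: "bessel_series (- \<nu>) y = (1 - \<nu>) * bessel_series (1 - \<nu>) y + y * bessel_series (2 - \<nu>) y"
      using bessel_series_rec[of "1 - \<nu>" y] by simp
    show ?thesis unfolding D_def
      by (rule derivative_eq_intros 1 2 3 DERIV_bessel_series refl)+ (simp add: r1 r2 algebra_simps)
  qed
  then obtain c where c: "\<And>y. D y = c"
    using has_field_derivative_zero_constant[of UNIV D] by auto
  then have "D y = D 0" by simp
  also have "D 0 = rGamma \<nu> * rGamma (1 - \<nu>)"
    by (simp add: D_def bessel_series_0)
  finally show ?thesis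
    by (simp add: D_def rGamma_reflection_complex)
qed

section \<open>Relation between the integral and the series\<close>

lemma bessel_product_step:
  assumes "y > 0"
  shows "bessel_integral (\<nu> + 1) y * bessel_series \<nu> y + y * bessel_integral \<nu> y * bessel_series (\<nu> + 1) y =
         bessel_integral \<nu> y * bessel_series (\<nu> - 1) y + y * bessel_integral (\<nu> - 1) y * bessel_series \<nu> y"
  unfolding bessel_integral_rec[OF assms] bessel_series_rec[of \<nu>] by (simp add: algebra_simps)

text \<open>Uses \<open>1 - exp (- t) \<le> t\<close> at \<open>t = y * exp (- v)\<close>; the extra
  \<open>exp (- v)\<close> lowers the order by one, hence \<open>Re \<nu> > 1\<close>.\<close>

lemma bessel_integral_Gamma_bound:
  assumes "y > 0" "Re \<nu> > 1"
  shows "norm (bessel_integral \<nu> y - Gamma \<nu>) \<le> y * Gamma (Re \<nu> - 1)"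
proof -
  note G = Gamma_integral_line[of \<nu>]
  have "bessel_integral \<nu> y - Gamma \<nu> = (\<integral>v. bessel_kernel \<nu> y v - exp (\<nu> * of_real v - of_real (exp v)) \<partial>lborel)"
    unfolding bessel_integral_def using G integrable_bessel_kernel[OF assms(1)] assms(2) by simp
  also have "norm \<dots> \<le> (\<integral>v. y * exp ((Re \<nu> - 1) * v - 1 * exp v) \<partial>lborel)"
  proof (rule Bochner_Integration.integral_norm_bound_integral)
    show "integrable lborel (\<lambda>v. bessel_kernel \<nu> y v - exp (\<nu> * of_real v - of_real (exp v)))"
      using G(1) integrable_bessel_kernel[OF assms(1)] assms(2) by auto
    show "integrable lborel (\<lambda>v. y * exp ((Re \<nu> - 1) * v - 1 * exp v))"
      using assms by (intro integrable_mult_right Gamma_integral_line_real) auto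
    fix v :: real
    have "bessel_kernel \<nu> y v - exp (\<nu> * of_real v - of_real (exp v)) =
          exp (\<nu> * of_real v - of_real (exp v)) * of_real (exp (- (y * exp (- v))) - 1)"
    proof -
      have "bessel_kernel \<nu> y v = exp (\<nu> * of_real v - of_real (exp v)) * of_real (exp (- (y * exp (- v))))"
        by (simp add: bessel_kernel_def flip: exp_of_real exp_add)
      then show ?thesis by (simp only: of_real_diff of_real_1 right_diff_distrib mult_1_right)
    qed
    also have "norm \<dots> = exp (Re \<nu> * v - exp v) * (1 - exp (- (y * exp (- v))))"
      unfolding norm_mult norm_of_real norm_exp_eq_Re using assms by simp
    also have "\<dots> \<le> exp (Re \<nu> * v - exp v) * (y * exp (- v))"
      using exp_ge_add_one_self[of "- (y * exp (- v))"] by (intro mult_left_mono) auto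
    also have "\<dots> = y * exp ((Re \<nu> - 1) * v - 1 * exp v)"
      by (simp add: algebra_simps flip: exp_add)
    finally show "norm (bessel_kernel \<nu> y v - exp (\<nu> * of_real v - of_real (exp v))) \<le> y * exp ((Re \<nu> - 1) * v - 1 * exp v)" .
  qed
  also have "\<dots> = y * Gamma (Re \<nu> - 1)"
    using Gamma_integral_line_real(2)[of "Re \<nu> - 1" 1] assms by simp
  finally show ?thesis .
qed

lemma norm_pochhammer_ge:
  fixes \<nu> :: complex
  assumes "Re \<nu> > 0"
  shows "norm (pochhammer \<nu> n) \<ge> pochhammer (Re \<nu>) n"
proof (induction n)
  case (Suc n)
  have "Re \<nu> + real n \<le> norm (\<nu> + of_nat n)"
    using complex_Re_le_cmod[of "\<nu> + of_nat n"] by simp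
  then have "pochhammer (Re \<nu>) n * (Re \<nu> + real n) \<le> norm (pochhammer \<nu> n) * norm (\<nu> + of_nat n)"
    using Suc.IH assms by (intro mult_mono) auto
  then show ?case by (simp add: pochhammer_Suc norm_mult)
qed simp

text \<open>The relative error is at most \<open>y / (Re \<mu> - 1)\<close> times
  \<open>Gamma (Re \<mu>) * norm (rGamma \<mu>)\<close>. That last product never exceeds its value
  \<open>C\<close> at \<open>n = 0\<close>, because \<open>pochhammer (Re \<nu>) n\<close> is at
  most \<open>norm (pochhammer \<nu> n)\<close>.\<close>

lemma bessel_integral_rGamma_tendsto:
  assumes "y > 0" "Re \<nu> > 0"
  shows "(\<lambda>n. bessel_integral (\<nu> + of_nat n) y * rGamma (\<nu> + of_nat n)) \<longlonglongrightarrow> 1"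
proof (rule LIM_zero_cancel, rule Lim_null_comparison)
  define C where "C = Gamma (Re \<nu>) * norm (rGamma \<nu>)"
  have nz: "\<nu> + of_nat n \<notin> \<int>\<^sub>\<le>\<^sub>0" for n
    using assms(2) by (auto elim!: nonpos_Ints_cases simp: complex_eq_iff)
  show "\<forall>\<^sub>F n in sequentially. norm (bessel_integral (\<nu> + of_nat n) y * rGamma (\<nu> + of_nat n) - 1) \<le> y * C / (Re \<nu> + real n - 1)"
    using eventually_ge_at_top[of 2]
  proof eventually_elim
    case (elim n)
    define \<mu> where "\<mu> = \<nu> + of_nat n"
    have \<mu>: "Re \<mu> > 1" using elim assms by (simp add: \<mu>_def)
    have "rGamma \<mu> * Gamma \<mu> = 1"
      using nz[of n] by (simp add: \<mu>_def Gamma_def rGamma_eq_zero_iff)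
    then have "bessel_integral \<mu> y * rGamma \<mu> - 1 = (bessel_integral \<mu> y - Gamma \<mu>) * rGamma \<mu>"
      by (simp add: algebra_simps)
    also have "norm \<dots> \<le> (y * Gamma (Re \<mu> - 1)) * norm (rGamma \<mu>)"
      unfolding norm_mult by (intro mult_right_mono bessel_integral_Gamma_bound assms \<mu>) auto
    also have "\<dots> = y / (Re \<mu> - 1) * (Gamma (Re \<mu>) * norm (rGamma \<mu>))"
    proof -
      have "Gamma (Re \<mu>) = (Re \<mu> - 1) * Gamma (Re \<mu> - 1)"
      proof -
        have "Re \<mu> - 1 \<notin> \<int>\<^sub>\<le>\<^sub>0"
        proof
          assume "Re \<mu> - 1 \<in> \<int>\<^sub>\<le>\<^sub>0"
          then have "Re \<mu> - 1 \<le> 0" by (auto elim!: nonpos_Ints_cases)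
          with \<mu> show False by simp
        qed
        from Gamma_plus1[OF this] show ?thesis by simp
      qed
      then show ?thesis using \<mu> by simp
    qed
    also have "\<dots> \<le> y / (Re \<mu> - 1) * C"
    proof (intro mult_left_mono)
      have "Gamma (Re \<mu>) = Gamma (Re \<nu>) * pochhammer (Re \<nu>) n"
      proof -
        have "Re \<nu> \<notin> \<int>\<^sub>\<le>\<^sub>0" using assms(2) by (auto elim!: nonpos_Ints_cases)
        from pochhammer_Gamma[OF this, of n] show ?thesis
          using Gamma_real_pos[OF assms(2)] by (simp add: \<mu>_def field_simps)
      qed
      moreover have "rGamma \<nu> = pochhammer \<nu> n * rGamma \<mu>"
        by (simp add: \<mu>_def pochhammer_rGamma)
      moreover have "pochhammer (Re \<nu>) n * norm (rGamma \<mu>) \<le> norm (pochhammer \<nu> n) * norm (rGamma \<mu>)"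
        by (intro mult_right_mono norm_pochhammer_ge assms) auto
      ultimately show "Gamma (Re \<mu>) * norm (rGamma \<mu>) \<le> C"
        using Gamma_real_pos[OF assms(2)] by (simp add: C_def norm_mult mult.assoc)
    qed (use \<mu> assms in auto)
    finally show ?case by (simp add: \<mu>_def)
  qed
  show "(\<lambda>n. y * C / (Re \<nu> + real n - 1)) \<longlonglongrightarrow> 0"
    by real_asymp
qed

text \<open>Multiplication by Gamma normalises the leading term to 1. In every later term the
  Pochhammer symbol has modulus at least \<open>n\<close>, so the tail is at most
  \<open>exp (norm y) / n\<close>.\<close>

lemma bessel_series_Gamma_tendsto:
  assumes "Re \<nu> > 0"
  shows "(\<lambda>n. bessel_series (\<nu> + of_nat n - 1) y * Gamma (\<nu> + of_nat n)) \<longlonglongrightarrow> 1"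
proof (rule LIM_zero_cancel, rule Lim_null_comparison)
  have nz: "\<nu> + of_nat n \<notin> \<int>\<^sub>\<le>\<^sub>0" for n
    using assms by (auto elim!: nonpos_Ints_cases simp: complex_eq_iff)
  show "\<forall>\<^sub>F n in sequentially. norm (bessel_series (\<nu> + of_nat n - 1) y * Gamma (\<nu> + of_nat n) - 1) \<le> exp (norm y) / real n"
    using eventually_ge_at_top[of 1]
  proof eventually_elim
    case (elim n)
    define \<mu> where "\<mu> = \<nu> + of_nat n"
    have \<mu>: "Re \<mu> > real n" using assms by (simp add: \<mu>_def)
    define t where "t = (\<lambda>k. y ^ k / fact k / pochhammer \<mu> k)"
    have tk: "rGamma (\<mu> - 1 + of_nat k + 1) / fact k * y ^ k * Gamma \<mu> = t k" for k
    proof -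
      have "rGamma \<mu> = pochhammer \<mu> k * rGamma (\<mu> + of_nat k)" by (rule pochhammer_rGamma)
      moreover have "rGamma \<mu> \<noteq> 0" using nz[of n] by (simp add: \<mu>_def rGamma_eq_zero_iff)
      ultimately have "rGamma (\<mu> + of_nat k) * Gamma \<mu> = 1 / pochhammer \<mu> k"
        by (auto simp: Gamma_def field_simps)
      then have "y ^ k / fact k * (rGamma (\<mu> + of_nat k) * Gamma \<mu>) = t k"
        by (simp add: t_def)
      then show ?thesis by (simp add: mult_ac)
    qed
    have "(\<lambda>k. rGamma (\<mu> - 1 + of_nat k + 1) / fact k * y ^ k * Gamma \<mu>) sums (bessel_series (\<mu> - 1) y * Gamma \<mu>)"
      unfolding bessel_series_def by (intro sums_mult2 summable_sums summable_bessel_series)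
    then have "t sums (bessel_series (\<mu> - 1) y * Gamma \<mu>)" unfolding tk .
    then have ts: "(\<lambda>k. t (Suc k)) sums (bessel_series (\<mu> - 1) y * Gamma \<mu> - 1)"
      by (subst sums_Suc_iff) (simp add: t_def)
    have tb: "norm (t (Suc k)) \<le> norm y ^ Suc k / fact (Suc k) / real n" for k
    proof -
      have "norm (pochhammer \<mu> (Suc k)) \<ge> pochhammer (Re \<mu>) (Suc k)"
        using norm_pochhammer_ge[of \<mu> "Suc k"] \<mu> by simp
      moreover have "pochhammer (Re \<mu>) (Suc k) \<ge> real n * 1"
      proof -
        have "(1::real) \<le> pochhammer (Re \<mu> + 1) k"
          unfolding pochhammer_prod using \<mu> elim by (intro prod_ge_1) auto
        then show ?thesis
          unfolding pochhammer_rec using \<mu> elim by (intro mult_mono) auto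
      qed
      ultimately have "norm (pochhammer \<mu> (Suc k)) \<ge> real n" by simp
      then have "norm y ^ Suc k / fact (Suc k) / norm (pochhammer \<mu> (Suc k)) \<le> norm y ^ Suc k / fact (Suc k) / real n"
        using elim by (intro divide_left_mono mult_pos_pos) auto
      then show ?thesis by (simp only: t_def norm_divide norm_power norm_fact)
    qed
    have es: "(\<lambda>k. norm y ^ Suc k / fact (Suc k)) sums (exp (norm y) - 1)"
      using exp_sums_divide[of "norm y"] by (subst sums_Suc_iff) simp
    have "norm (bessel_series (\<mu> - 1) y * Gamma \<mu> - 1) \<le> (exp (norm y) - 1) / real n"
      by (rule norm_sums_le[OF ts sums_divide[OF es] tb])
    also have "\<dots> \<le> exp (norm y) / real n" by (intro divide_right_mono) auto
    finally show ?case by (simp add: \<mu>_def)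
  qed
  show "(\<lambda>n. exp (norm y) / real n) \<longlonglongrightarrow> 0"
    by real_asymp
qed

text \<open>The left-hand side is 1-periodic in \<open>\<nu>\<close> and tends to \<open>1\<close> along \<open>\<nu> + n\<close>.\<close>

lemma bessel_product:
  assumes "y > 0"
  shows "bessel_integral \<nu> y * bessel_series (\<nu> - 1) y + y * bessel_integral (\<nu> - 1) y * bessel_series \<nu> y = 1"
proof -
  define A where "A = (\<lambda>\<nu>. bessel_integral \<nu> y * bessel_series (\<nu> - 1) y + y * bessel_integral (\<nu> - 1) y * bessel_series \<nu> y)"
  have step: "A (\<nu> + 1) = A \<nu>" for \<nu>
    using bessel_product_step[OF assms, of \<nu>] by (simp add: A_def)
  have steps: "A (\<nu> + of_nat n) = A \<nu>" for \<nu> n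
  proof (induction n)
    case (Suc n)
    then show ?case using step[of "\<nu> + of_nat n"] by (simp add: add_ac)
  qed simp
  have main: "A \<nu> = 1" if \<nu>: "Re \<nu> > 0" for \<nu>
  proof -
    define X where "X = (\<lambda>n. bessel_integral (\<nu> + of_nat n) y * rGamma (\<nu> + of_nat n))"
    define Y where "Y = (\<lambda>n. bessel_series (\<nu> + of_nat n - 1) y * Gamma (\<nu> + of_nat n))"
    have X: "X \<longlonglongrightarrow> 1" and Y: "Y \<longlonglongrightarrow> 1"
      unfolding X_def Y_def using bessel_integral_rGamma_tendsto[OF assms \<nu>] bessel_series_Gamma_tendsto[OF \<nu>] by blast+
    have nz: "\<nu> + of_nat n \<notin> \<int>\<^sub>\<le>\<^sub>0" for n
      using \<nu> by (auto elim!: nonpos_Ints_cases simp: complex_eq_iff)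
    then have G: "Gamma (\<nu> + of_nat n) = inverse (rGamma (\<nu> + of_nat n))" "rGamma (\<nu> + of_nat n) \<noteq> 0" for n
      by (simp_all add: Gamma_def rGamma_eq_zero_iff)
    have nz': "\<nu> + of_nat n \<noteq> 0" for n using nz[of n] by auto
    \<comment> \<open>In the second product the orders sit two Gamma steps apart, which leaves a
      quadratic denominator; this summand tends to zero.\<close>
    have "A (\<nu> + of_nat (Suc n)) = X (Suc n) * Y (Suc n) + y * (X n * Y (n + 2)) / ((\<nu> + of_nat n) * (\<nu> + of_nat (Suc n)))" for n
    proof -
      have e1: "rGamma (\<nu> + of_nat n) = (\<nu> + of_nat n) * ((\<nu> + of_nat (Suc n)) * rGamma (\<nu> + of_nat (n + 2)))"
        using rGamma_plus1[of "\<nu> + of_nat n"] rGamma_plus1[of "\<nu> + of_nat (Suc n)"] by (simp add: add_ac)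
      have "bessel_integral (\<nu> + of_nat n) y * bessel_series (\<nu> + of_nat (Suc n)) y =
            X n * Y (n + 2) / ((\<nu> + of_nat n) * (\<nu> + of_nat (Suc n)))"
      proof -
        have alg: "i * s = i * (a * (b * r)) * (s * inverse r) / (a * b)" if "a \<noteq> 0" "b \<noteq> 0" "r \<noteq> 0" for i s a b r :: complex
          using that by (simp add: field_simps)
        have e2: "\<nu> + of_nat (n + 2) - 1 = \<nu> + of_nat (Suc n)" by simp
        show ?thesis
          unfolding X_def Y_def e1 G(1) e2 by (rule alg[OF nz' nz' G(2)])
      qed
      moreover have "bessel_integral (\<nu> + of_nat (Suc n)) y * bessel_series (\<nu> + of_nat (Suc n) - 1) y = X (Suc n) * Y (Suc n)"
        unfolding X_def Y_def G(1) using G(2)[of "Suc n"] by (simp add: field_simps del: of_nat_Suc)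
      ultimately show ?thesis
        by (simp add: A_def add_ac mult.assoc)
    qed
    then have "A \<nu> = X (Suc n) * Y (Suc n) + y * (X n * Y (n + 2)) / ((\<nu> + of_nat n) * (\<nu> + of_nat (Suc n)))" for n
      using steps[of \<nu> "Suc n"] by simp
    moreover have "(\<lambda>n. X (Suc n) * Y (Suc n) + y * (X n * Y (n + 2)) / ((\<nu> + of_nat n) * (\<nu> + of_nat (Suc n)))) \<longlonglongrightarrow> 1 * 1 + 0"
    proof (intro tendsto_intros LIMSEQ_Suc X Y)
      have inf: "filterlim (\<lambda>n. \<nu> + of_nat n) at_infinity sequentially"
        by (intro tendsto_add_filterlim_at_infinity[OF tendsto_const] tendsto_of_nat)
      show "(\<lambda>n. y * (X n * Y (n + 2)) / ((\<nu> + of_nat n) * (\<nu> + of_nat (Suc n)))) \<longlonglongrightarrow> 0"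
        by (rule tendsto_divide_0[OF tendsto_mult[OF tendsto_const tendsto_mult[OF X LIMSEQ_ignore_initial_segment[OF Y]]]])
           (rule filterlim_at_infinity_times[OF inf filterlim_sequentially_Suc[THEN iffD2, OF inf]])
    qed
    ultimately have "(\<lambda>n::nat. A \<nu>) \<longlonglongrightarrow> 1 * 1 + 0" by simp
    then show "A \<nu> = 1" by (simp add: LIMSEQ_const_iff)
  qed
  \<comment> \<open>Periodicity moves any \<open>\<nu>\<close> into the right half plane.\<close>
  have "A \<nu> = A (\<nu> + of_nat (nat \<lceil>1 - Re \<nu>\<rceil>))" by (simp add: steps)
  also have "\<dots> = 1" by (rule main) (simp, linarith)
  finally show ?thesis by (simp add: A_def)
qed

text \<open>\<open>bessel_product\<close> at \<open>\<nu>\<close> and, after reflection of the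
  orders, at \<open>1 - \<nu>\<close> gives two linear equations for the integrals of order
  \<open>\<nu>\<close> and \<open>\<nu> - 1\<close>. Eliminating the latter leaves the determinant
  \<open>bessel_series_wronskian\<close>, nonzero for non-integer \<open>\<nu>\<close>.\<close>

lemma bessel_integral_eq_series:
  assumes "y > 0" "\<nu> \<notin> \<int>"
  shows "bessel_integral \<nu> y =
    of_real pi / sin (of_real pi * \<nu>) * (bessel_series (- \<nu>) y - of_real y powr \<nu> * bessel_series \<nu> y)"
proof -
  define z where "z = complex_of_real y"
  have z: "z \<noteq> 0" using assms by (simp add: z_def)
  define F0 F1 where "F0 = bessel_integral \<nu> y" and "F1 = bessel_integral (\<nu> - 1) y"
  have 1: "F0 * bessel_series (\<nu> - 1) z + z * F1 * bessel_series \<nu> z = 1"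
    using bessel_product[OF assms(1), of \<nu>] by (simp add: F0_def F1_def z_def)
  have "z powr (1 - \<nu>) * F1 * bessel_series (- \<nu>) z + z * (z powr (- \<nu>) * F0) * bessel_series (1 - \<nu>) z = 1"
    using bessel_product[OF assms(1), of "1 - \<nu>"] bessel_integral_minus[OF assms(1), of "\<nu> - 1"]
      bessel_integral_minus[OF assms(1), of \<nu>] by (simp add: F0_def F1_def z_def)
  moreover have "z * z powr (- \<nu>) = z powr (1 - \<nu>)"
    using z by (simp add: powr_diff powr_minus divide_inverse)
  ultimately have "z powr (1 - \<nu>) * (F1 * bessel_series (- \<nu>) z + F0 * bessel_series (1 - \<nu>) z) = 1"
    by (simp add: algebra_simps)
  moreover have "z powr \<nu> * z powr (1 - \<nu>) = z"
    using z by (simp flip: powr_add)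
  ultimately have "z powr \<nu> * (z powr (1 - \<nu>) * (F1 * bessel_series (- \<nu>) z + F0 * bessel_series (1 - \<nu>) z)) = z powr \<nu>"
    and "z powr \<nu> * z powr (1 - \<nu>) = z"
    by (simp_all only: mult_1_right)
  then have 2: "z * (F1 * bessel_series (- \<nu>) z + F0 * bessel_series (1 - \<nu>) z) = z powr \<nu>"
    by (simp only: mult.assoc[symmetric])
  have "F0 * (sin (of_real pi * \<nu>) / of_real pi) =
      (F0 * bessel_series (\<nu> - 1) z + z * F1 * bessel_series \<nu> z) * bessel_series (- \<nu>) z -
      z * (F1 * bessel_series (- \<nu>) z + F0 * bessel_series (1 - \<nu>) z) * bessel_series \<nu> z"
    unfolding bessel_series_wronskian[of \<nu> z, symmetric] by (simp add: algebra_simps)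
  then have "F0 * (sin (of_real pi * \<nu>) / of_real pi) = bessel_series (- \<nu>) z - z powr \<nu> * bessel_series \<nu> z"
    unfolding 1 2 by simp
  moreover have "sin (of_real pi * \<nu>) \<noteq> 0"
    using assms(2) by (auto simp: sin_eq_0 elim!: Ints_cases)
  ultimately show ?thesis
    by (simp add: F0_def z_def field_simps)
qed

lemma bessel_I_eq_series:
  assumes "y > 0"
  shows "bessel_I \<nu> (of_real (2 * sqrt y)) = of_real (sqrt y) powr \<nu> * bessel_series \<nu> y"
proof -
  have e: "(complex_of_real (2 * sqrt y) / 2) powr (\<nu> + 2 * of_nat k) * rGamma (\<nu> + of_nat k + 1) / fact k =
     of_real (sqrt y) powr \<nu> * (rGamma (\<nu> + of_nat k + 1) / fact k * of_real y ^ k)" for k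
  proof -
    have "complex_of_real (sqrt y) powr (of_nat (2 * k)) = of_real (sqrt y) ^ (2 * k)"
      using assms by (intro powr_nat') auto
    also have "\<dots> = of_real y ^ k"
      using assms by (simp add: power_mult flip: of_real_power)
    finally show ?thesis by (simp add: powr_add)
  qed
  show ?thesis
    unfolding bessel_I_def e bessel_series_def by (rule suminf_mult[OF summable_bessel_series])
qed

lemma bessel_K_integral:
  assumes "y > 0" "\<nu> \<notin> \<int>"
  shows "bessel_integral \<nu> y = 2 * of_real (sqrt y) powr \<nu> * bessel_K \<nu> (of_real (2 * sqrt y))"
proof -
  define w where "w = complex_of_real (sqrt y) powr \<nu>"
  have w: "w \<noteq> 0" using assms by (simp add: w_def)
  have "w * w = (complex_of_real (sqrt y) * of_real (sqrt y)) powr \<nu>"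
    using assms by (simp add: w_def powr_times_real)
  also have "\<dots> = of_real y powr \<nu>"
    using assms by (simp flip: of_real_mult)
  finally have w2: "w * w = of_real y powr \<nu>" .
  have wm: "complex_of_real (sqrt y) powr (- \<nu>) = 1 / w" by (simp add: w_def powr_minus field_simps)
  define Rp Rm where "Rp = bessel_series \<nu> y" and "Rm = bessel_series (- \<nu>) y"
  define S where "S = sin (complex_of_real pi * \<nu>)"
  have "bessel_K \<nu> (of_real (2 * sqrt y)) = of_real pi / 2 * (1 / w * Rm - w * Rp) / S"
    unfolding bessel_K_def Let_def bessel_I_eq_series[OF assms(1)] wm w_def[symmetric] Rp_def Rm_def S_def
    by (simp only: assms(2) if_False)
  moreover have "bessel_integral \<nu> y = of_real pi / S * (Rm - w * w * Rp)"
    unfolding bessel_integral_eq_series[OF assms] w2 Rp_def Rm_def S_def ..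
  moreover have "of_real pi / S * (Rm - w * w * Rp) = 2 * w * (of_real pi / 2 * (1 / w * Rm - w * Rp) / S)"
    using w by (simp add: right_diff_distrib diff_divide_distrib mult_ac)
  ultimately show ?thesis by (simp add: w_def)
qed

text \<open>Translation by \<open>ln A\<close> reduces to the kernel with \<open>y = A * B\<close>.
  All bases are positive reals, so the powers combine through real logarithms without branch
  questions.\<close>

lemma bessel_K_integral_scaled:
  fixes A B :: real
  assumes "A > 0" "B > 0" "\<nu> \<notin> \<int>"
  shows "(\<integral>v. exp (\<nu> * of_real v - of_real (A * exp v) - of_real (B * exp (- v))) \<partial>lborel) =
         of_real (B / A) powr (\<nu> / 2) * (2 * bessel_K \<nu> (of_real (2 * sqrt (A * B))))"
proof -
  have AB: "A * B > 0" using assms by simp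
  have eq: "exp (\<nu> * of_real v - of_real (A * exp v) - of_real (B * exp (- v))) =
            of_real A powr (- \<nu>) * bessel_kernel \<nu> (A * B) (ln A + 1 * v)" for v
  proof -
    have "exp (ln A + v) = A * exp v" "A * B * exp (- (ln A + v)) = B * exp (- v)"
      using assms by (simp_all add: exp_add exp_minus exp_diff field_simps)
    then have "bessel_kernel \<nu> (A * B) (ln A + 1 * v) = exp (\<nu> * of_real (ln A + v) - of_real (A * exp v) - of_real (B * exp (- v)))"
      unfolding bessel_kernel_def by (simp only: mult_1)
    moreover have "of_real A powr (- \<nu>) = exp (- \<nu> * of_real (ln A))"
      using assms by (simp add: powr_def Ln_of_real)
    ultimately show ?thesis by (simp only: mult_exp_exp) (simp add: algebra_simps)
  qed
  have "(\<integral>v. exp (\<nu> * of_real v - of_real (A * exp v) - of_real (B * exp (- v))) \<partial>lborel) =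
        of_real A powr (- \<nu>) * bessel_integral \<nu> (A * B)"
    unfolding eq bessel_integral_def
    using lborel_integral_real_affine[of 1 "bessel_kernel \<nu> (A * B)" "ln A"] by simp
  also have "\<dots> = (of_real A powr (- \<nu>) * of_real (sqrt (A * B)) powr \<nu>) * (2 * bessel_K \<nu> (of_real (2 * sqrt (A * B))))"
    unfolding bessel_K_integral[OF AB assms(3)] by simp
  also have "of_real A powr (- \<nu>) * of_real (sqrt (A * B)) powr \<nu> = of_real (B / A) powr (\<nu> / 2)"
  proof -
    have p: "complex_of_real r powr z = exp (z * of_real (ln r))" if "r > 0" for r z
      using that by (simp add: powr_def Ln_of_real)
    have "of_real A powr (- \<nu>) * of_real (sqrt (A * B)) powr \<nu> = exp (- \<nu> * of_real (ln A) + \<nu> * of_real (ln (sqrt (A * B))))"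
      using assms AB by (simp only: p real_sqrt_gt_zero exp_add)
    also have "- \<nu> * of_real (ln A) + \<nu> * of_real (ln (sqrt (A * B))) = \<nu> / 2 * of_real (ln (B / A))"
      using assms by (simp add: ln_sqrt ln_mult ln_div field_simps)
    also have "exp (\<nu> / 2 * of_real (ln (B / A))) = of_real (B / A) powr (\<nu> / 2)"
      by (rule p[symmetric]) (use assms in simp)
    finally show ?thesis .
  qed
  finally show ?thesis .
qed

subsection \<open>Decay of exponential series\<close>

text \<open>The fourth power of \<open>x / 4 \<le> exp (x / 4)\<close>, whence 256 = 4^4.\<close>

lemma exp_bound_power4:
  fixes x :: real
  assumes "x > 0"
  shows "exp (- x) \<le> 256 / x ^ 4"
proof -
  have "(x / 4) ^ 4 \<le> exp (x / 4) ^ 4"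
    using assms exp_ge_add_one_self[of "x / 4"] by (intro power_mono) linarith+
  also have "exp (x / 4) ^ 4 = exp x" by (simp flip: exp_of_nat_mult)
  finally have "x ^ 4 \<le> 256 * exp x" by (simp add: power_divide)
  then show ?thesis using assms by (simp add: exp_minus field_simps)
qed

text \<open>For \<open>n \<ge> 1\<close>, \<open>pi * n * u \<ge> 2 * n * u \<ge> u + n * u\<close>.
  The first part gives decay uniform in \<open>n\<close>; the second, through
  \<open>exp_bound_power4\<close>, pays for the weight \<open>n^2\<close> and still leaves a
  summable \<open>1 / n^2\<close>.\<close>

lemma square_exp_bound:
  fixes u :: real
  assumes "u > 0"
  shows "real n ^ 2 * exp (- pi * u) ^ n \<le> 256 * exp (- u) / u ^ 4 * inverse (real n ^ 2)"
proof (cases "n = 0")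
  case False
  have "exp (- pi * u) ^ n = exp (- (pi * (real n * u)))"
    by (simp add: algebra_simps flip: exp_of_nat_mult)
  also have "\<dots> \<le> exp (- u - real n * u)"
  proof -
    have "pi * (real n * u) \<ge> 2 * (real n * u)"
      using pi_ge_two assms by (intro mult_right_mono) auto
    moreover have "real n * u \<ge> 1 * u" using False assms by (intro mult_right_mono) auto
    ultimately show ?thesis by simp
  qed
  also have "\<dots> = exp (- u) * exp (- (real n * u))" by (simp flip: exp_add)
  also have "\<dots> \<le> exp (- u) * (256 / (real n * u) ^ 4)"
    using False assms by (intro mult_left_mono exp_bound_power4) auto
  finally have "real n ^ 2 * exp (- pi * u) ^ n \<le> real n ^ 2 * (exp (- u) * (256 / (real n * u) ^ 4))"
    by (intro mult_left_mono) auto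
  also have "\<dots> = 256 * exp (- u) / u ^ 4 * inverse (real n ^ 2)"
    using False assms by (simp add: field_simps power_numeral_reduce)
  finally show ?thesis .
qed simp

text \<open>Dominates every series below, each of whose terms is at most \<open>n^2 exp (- pi u)^n\<close>.\<close>

definition decay_const :: real where
  "decay_const = 256 * (\<Sum>n. inverse (real n ^ 2))"

lemma exp_series_bound:
  fixes w :: "nat \<Rightarrow> real" and u :: real
  assumes u: "u > 0" and w: "\<And>n. 0 \<le> w n" "\<And>n. w n \<le> real n ^ 2 * exp (- pi * u) ^ n"
  shows "summable w" "0 \<le> suminf w" "suminf w \<le> decay_const * (exp (- u) / u ^ 4)"
proof -
  have bd: "w n \<le> 256 * exp (- u) / u ^ 4 * inverse (real n ^ 2)" for n
    using w(2)[of n] square_exp_bound[OF u, of n] by linarith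
  have sm: "summable (\<lambda>n. 256 * exp (- u) / u ^ 4 * inverse (real n ^ 2))"
    by (intro summable_mult inverse_power_summable) simp
  show s: "summable w"
    by (rule summable_comparison_test'[OF sm]) (use w bd in auto)
  show "0 \<le> suminf w" by (rule suminf_nonneg[OF s w(1)])
  have "suminf w \<le> (\<Sum>n. 256 * exp (- u) / u ^ 4 * inverse (real n ^ 2))"
    by (rule suminf_le[OF bd s sm])
  also have "\<dots> = decay_const * (exp (- u) / u ^ 4)"
    unfolding decay_const_def by (subst suminf_mult) (auto intro: inverse_power_summable)
  finally show "suminf w \<le> decay_const * (exp (- u) / u ^ 4)" .
qed

lemma decay_const_nonneg: "decay_const \<ge> 0"
  unfolding decay_const_def by (intro mult_nonneg_nonneg suminf_nonneg inverse_power_summable) auto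

subsection \<open>The Riemann zeta function\<close>

definition omega :: "real \<Rightarrow> real" where
  "omega u = (\<Sum>n. if n = 0 then 0 else exp (- pi * u * real n ^ 2))"

lemma omega_bound:
  assumes "u > 0"
  shows "0 \<le> omega u" "omega u \<le> decay_const * (exp (- u) / u ^ 4)"
    and "summable (\<lambda>n. if n = 0 then 0 else exp (- pi * u * real n ^ 2))"
proof -
  have b: "(if n = 0 then 0 else exp (- pi * u * real n ^ 2)) \<le> real n ^ 2 * exp (- pi * u) ^ n" for n
  proof (cases "n = 0")
    case False
    have "exp (- pi * u * real n ^ 2) \<le> exp (- pi * u * real n)"
    proof -
      have "real n * 1 \<le> real n * real n" using False by (intro mult_left_mono) auto
      then show ?thesis using assms by (simp add: power2_eq_square)
    qed
    also have "\<dots> = 1 * exp (- pi * u) ^ n" by (simp add: algebra_simps flip: exp_of_nat_mult)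
    also have "\<dots> \<le> real n ^ 2 * exp (- pi * u) ^ n" using False by (intro mult_right_mono) auto
    finally show ?thesis using False by simp
  qed simp
  note B = exp_series_bound[OF assms _ b]
  show "0 \<le> omega u" "omega u \<le> decay_const * (exp (- u) / u ^ 4)"
    "summable (\<lambda>n. if n = 0 then 0 else exp (- pi * u * real n ^ 2))"
    unfolding omega_def by (rule B; simp)+
qed

lemma omega_has_sum:
  assumes "u > 0"
  shows "((\<lambda>n. exp (- pi * u * real n ^ 2)) has_sum omega u) {1..}"
proof -
  have "((\<lambda>n. if n = 0 then 0 else exp (- pi * u * real n ^ 2)) has_sum omega u) UNIV"
    using omega_bound(3)[OF assms] unfolding omega_def
    by (intro norm_summable_imp_has_sum) (auto simp: if_distrib[of abs] cong: if_cong)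
  then show ?thesis
    by (rule has_sum_cong_neutral[THEN iffD1, rotated -1]) auto
qed

definition theta_line :: "real \<Rightarrow> real" where
  "theta_line u = (\<Sum>\<^sub>\<infinity>n::int. exp (- pi * u * (of_int n)\<^sup>2))"

lemma theta_line_has_sum:
  assumes "u > 0"
  shows "((\<lambda>n::int. exp (- pi * u * (of_int n)\<^sup>2)) has_sum theta_line u) UNIV"
  unfolding theta_line_def using gaussian_summable[OF assms, of 0] by simp

lemma theta_line_inversion:
  assumes "u > 0"
  shows "theta_line (1 / u) = sqrt u * theta_line u"
  using poisson_gaussian[OF assms] assms by (simp add: theta_line_def field_simps)

lemma theta_line_omega:
  assumes "u > 0"
  shows "theta_line u = 1 + 2 * omega u"
proof -
  define f where "f = (\<lambda>n::int. exp (- pi * u * (of_int n)\<^sup>2))"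
  have "((\<lambda>n. exp (- pi * u * real n ^ 2)) has_sum (1 + omega u)) ({0} \<union> {1..})"
    by (rule has_sum_Un_disjoint[OF _ omega_has_sum[OF assms]]) (auto simp: has_sum_finite_iff)
  moreover have "{0} \<union> {1..} = (UNIV :: nat set)" by auto
  ultimately have "((\<lambda>n. f (int n)) has_sum (1 + omega u)) UNIV" by (simp add: f_def)
  from has_sum_int_even[OF _ this] have "(f has_sum 2 * (1 + omega u) - f 0) UNIV"
    by (simp add: f_def)
  then show ?thesis
    using has_sum_unique[OF theta_line_has_sum[OF assms]] by (simp add: f_def)
qed

lemma omega_inversion:
  "omega (exp (- v)) = exp (v / 2) * omega (exp v) + (exp (v / 2) - 1) / 2"
proof -
  have "1 + 2 * omega (exp (- v)) = sqrt (exp v) * (1 + 2 * omega (exp v))"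
    using theta_line_inversion[of "exp v"] by (simp add: theta_line_omega exp_minus field_simps)
  moreover have "sqrt (exp v) = exp (v / 2)" by (rule real_sqrt_unique) (simp_all add: power2_eq_square flip: exp_add)
  ultimately show ?thesis by (simp add: field_simps)
qed

lemma omega_measurable [measurable]: "(\<lambda>v. omega (exp v)) \<in> borel_measurable borel"
  unfolding omega_def by measurable

section \<open>Completed zeta function, continuation and reflection\<close>

lemma zeta_terms_summable:
  fixes s :: complex
  assumes "Re s > 1"
  shows "(\<lambda>n. norm (of_nat n powr (- s))) summable_on {1..}"
proof -
  have "summable (\<lambda>n. norm (real n powr (- Re s)))"
    using assms by (simp add: summable_real_powr_iff)
  then have "(\<lambda>n. real n powr (- Re s)) summable_on UNIV" by (rule norm_summable_imp_summable_on)
  then have "(\<lambda>n. real n powr (- Re s)) summable_on {1..}" by (rule summable_on_subset_banach) simp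
  then show ?thesis
    by (rule summable_on_cong[THEN iffD1, rotated]) (auto simp: norm_powr_real_powr)
qed

lemma of_real_powr_exp: "r > 0 \<Longrightarrow> complex_of_real r powr z = exp (z * of_real (ln r))"
  by (simp add: powr_def Ln_of_real)

lemma completed_zeta_integral:
  fixes s :: complex
  assumes s: "Re s > 1"
  shows "integrable lborel (\<lambda>v. exp (s / 2 * of_real v) * of_real (omega (exp v)))"
    and "(\<integral>v. exp (s / 2 * of_real v) * of_real (omega (exp v)) \<partial>lborel) =
           of_real pi powr (- s / 2) * Gamma (s / 2) * (\<Sum>\<^sub>\<infinity>n\<in>{1..}. of_nat n powr (- s))"
proof -
  define f where "f = (\<lambda>n v. exp (s / 2 * of_real v - of_real (pi * real n ^ 2 * exp v)))"
  have pos: "pi * real n ^ 2 > 0" if "n \<in> {1..}" for n using that by simp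
  have fint: "integrable lborel (f n)" if "n \<in> {1..}" for n
    unfolding f_def by (rule Gamma_integral_line_scaled(1)[OF _ pos[OF that]]) (use s in simp)
  have nf: "norm (f n v) = exp (Re s / 2 * v) * exp (- pi * exp v * real n ^ 2)" for n v
    by (simp add: f_def norm_exp_eq_Re algebra_simps flip: exp_add)
  have pw: "((\<lambda>n. norm (f n v)) has_sum (exp (Re s / 2 * v) * omega (exp v))) {1..}" for v
    unfolding nf by (intro has_sum_cmult_right omega_has_sum) simp
  have p: "of_real (pi * real n ^ 2) powr (- z / 2) = of_real pi powr (- z / 2) * of_nat n powr (- z)"
    if "n \<in> {1..}" for n :: nat and z :: complex
  proof -
    have "ln (pi * real n ^ 2) = ln pi + 2 * ln (real n)"
      using that by (subst ln_mult) (auto simp: ln_realpow)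
    then have "of_real (pi * real n ^ 2) powr (- z / 2) = exp (- z / 2 * of_real (ln pi + 2 * ln (real n)))"
      using of_real_powr_exp[OF pos[OF that]] by (simp only:)
    also have "\<dots> = exp (- z / 2 * of_real (ln pi)) * exp (- z * of_real (ln (real n)))"
      unfolding mult_exp_exp by (rule arg_cong[where f = exp]) (simp add: field_simps)
    also have "\<dots> = of_real pi powr (- z / 2) * of_nat n powr (- z)"
      using of_real_powr_exp[of pi] of_real_powr_exp[of "real n" "- z"] that by simp
    finally show ?thesis .
  qed
  have val: "(\<integral>v. f n v \<partial>lborel) = of_real pi powr (- s / 2) * Gamma (s / 2) * of_nat n powr (- s)"
    if "n \<in> {1..}" for n
    unfolding f_def using Gamma_integral_line_scaled(2)[OF _ pos[OF that], of "s / 2"] s p[OF that, of s] by simp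
  \<comment> \<open>The norms integrate to the same closed form with \<open>s\<close> replaced by
    \<open>Re s\<close>, so absolute summability is that of the Dirichlet series at
    \<open>Re s\<close>.\<close>
  have nval: "(\<integral>v. norm (f n v) \<partial>lborel) = norm (of_real pi powr (- of_real (Re s) / 2) * Gamma (of_real (Re s) / 2) * of_nat n powr (- of_real (Re s)) :: complex)"
    if "n \<in> {1..}" for n
  proof -
    have "(\<integral>v. norm (f n v) \<partial>lborel) = (\<integral>v. exp (Re s / 2 * v - pi * real n ^ 2 * exp v) \<partial>lborel)"
      unfolding nf by (simp add: algebra_simps flip: exp_add)
    also have "\<dots> = (pi * real n ^ 2) powr (- (Re s / 2)) * Gamma (Re s / 2)"
      using s by (intro Gamma_integral_line_real pos that) auto
    also have "\<dots> = norm (complex_of_real ((pi * real n ^ 2) powr (- (Re s / 2)) * Gamma (Re s / 2)))"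
      using s by (subst norm_of_real, subst abs_of_nonneg)
        (auto intro!: mult_nonneg_nonneg less_imp_le[OF Gamma_real_pos])
    also have "complex_of_real ((pi * real n ^ 2) powr (- (Re s / 2)) * Gamma (Re s / 2)) =
        of_real pi powr (- of_real (Re s) / 2) * Gamma (of_real (Re s) / 2) * of_nat n powr (- of_real (Re s))"
      using p[OF that, of "of_real (Re s)"] Gamma_complex_of_real[of "Re s / 2"] that
      by (simp add: powr_of_real[symmetric])
    finally show ?thesis .
  qed
  have sm: "(\<lambda>n. \<integral>v. norm (f n v) \<partial>lborel) summable_on {1..}"
  proof -
    have "(\<lambda>n. norm (of_real pi powr (- of_real (Re s) / 2) * Gamma (of_real (Re s) / 2) :: complex) * norm (of_nat n powr (- of_real (Re s)) :: complex)) summable_on {1..}"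
      by (intro summable_on_cmult_right zeta_terms_summable) (use s in simp)
    then show ?thesis
      by (rule summable_on_cong[THEN iffD1, rotated]) (simp add: nval norm_mult)
  qed
  have sum: "(\<Sum>\<^sub>\<infinity>n\<in>{1..}. f n v) = exp (s / 2 * of_real v) * of_real (omega (exp v))" for v
  proof -
    have "((\<lambda>n. complex_of_real (exp (- pi * exp v * real n ^ 2))) has_sum of_real (omega (exp v))) {1..}"
      by (intro has_sum_of_real omega_has_sum) simp
    then have "((\<lambda>n. exp (s / 2 * of_real v) * complex_of_real (exp (- pi * exp v * real n ^ 2))) has_sum exp (s / 2 * of_real v) * of_real (omega (exp v))) {1..}"
      by (rule has_sum_cmult_right)
    moreover have "exp (s / 2 * of_real v) * complex_of_real (exp (- pi * exp v * real n ^ 2)) = f n v" for n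
      unfolding f_def exp_of_real[symmetric] mult_exp_exp by (simp add: algebra_simps)
    ultimately show ?thesis by (intro infsumI) simp
  qed
  note HS = has_sum_integral[OF fint has_sum_imp_summable[OF pw] sm]
  show "integrable lborel (\<lambda>v. exp (s / 2 * of_real v) * of_real (omega (exp v)))"
    using HS(1) unfolding sum .
  have "((\<lambda>n. of_real pi powr (- s / 2) * Gamma (s / 2) * of_nat n powr (- s)) has_sum
      (\<integral>v. exp (s / 2 * of_real v) * of_real (omega (exp v)) \<partial>lborel)) {1..}"
    using HS(2) unfolding sum by (rule has_sum_cong[THEN iffD1, rotated]) (assumption | erule val)+
  moreover have "((\<lambda>n. of_real pi powr (- s / 2) * Gamma (s / 2) * of_nat n powr (- s)) has_sum
      of_real pi powr (- s / 2) * Gamma (s / 2) * (\<Sum>\<^sub>\<infinity>n\<in>{1..}. of_nat n powr (- s))) {1..}"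
    using abs_summable_summable[OF zeta_terms_summable[OF s]] by (intro has_sum_cmult_right) simp
  ultimately show "(\<integral>v. exp (s / 2 * of_real v) * of_real (omega (exp v)) \<partial>lborel) =
           of_real pi powr (- s / 2) * Gamma (s / 2) * (\<Sum>\<^sub>\<infinity>n\<in>{1..}. of_nat n powr (- s))"
    using has_sum_unique by blast
qed

lemma integral_exp_half_line:
  fixes a :: complex
  assumes "Re a > 0"
  shows "integrable lborel (\<lambda>v. indicator {0<..} v *\<^sub>R exp (- a * of_real v))"
    and "(\<integral>v. indicator {0<..} v *\<^sub>R exp (- a * of_real v) \<partial>lborel) = 1 / a"
proof -
  have ei: "einterval 0 \<infinity> = {0<..}" by (auto simp: einterval_def)
  have real: "set_integrable lborel (einterval 0 \<infinity>) (\<lambda>v. exp (- Re a * v))"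
  proof (rule interval_integral_FTC_nonneg(1)[where F = "\<lambda>v. - exp (- Re a * v) / Re a" and A = "- 1 / Re a" and B = 0])
    show "(((\<lambda>v. - exp (- Re a * v) / Re a) \<circ> real_of_ereal) \<longlongrightarrow> - 1 / Re a) (at_right 0)"
      unfolding zero_ereal_def ereal_tendsto_simps1
      by (rule tendsto_eq_rhs) (rule tendsto_intros | use assms in simp)+
    show "(((\<lambda>v. - exp (- Re a * v) / Re a) \<circ> real_of_ereal) \<longlongrightarrow> 0) (at_left \<infinity>)"
      unfolding ereal_tendsto_simps1 using assms by real_asymp
  qed (use assms in \<open>auto intro!: derivative_eq_intros\<close>)
  have int: "set_integrable lborel (einterval 0 \<infinity>) (\<lambda>v. exp (- a * of_real v))"
    unfolding set_integrable_def
  proof (rule Bochner_Integration.integrable_bound[OF real[unfolded set_integrable_def]])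
    show "(\<lambda>v. indicator (einterval 0 \<infinity>) v *\<^sub>R exp (- a * of_real v)) \<in> borel_measurable lborel"
      by measurable
  qed (auto simp: norm_exp_eq_Re)
  then show "integrable lborel (\<lambda>v. indicator {0<..} v *\<^sub>R exp (- a * of_real v))"
    by (simp add: set_integrable_def ei)
  have anz: "a \<noteq> 0" using assms by auto
  have "(LBINT v=0..\<infinity>. exp (- a * of_real v)) = 0 - (- 1 / a)"
  proof (rule interval_integral_FTC_integrable[where F = "\<lambda>v. - exp (- a * of_real v) / a"])
    fix v
    have "((\<lambda>z. - exp (- a * z) / a) has_field_derivative exp (- a * of_real v)) (at (of_real v))"
      using anz by (auto intro!: derivative_eq_intros)
    from has_vector_derivative_real_field[OF this, of UNIV]
    show "((\<lambda>v. - exp (- a * of_real v) / a) has_vector_derivative exp (- a * of_real v)) (at v)" by simp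
    show "isCont (\<lambda>v. exp (- a * of_real v)) v" by (intro continuous_intros)
  next
    show "(((\<lambda>v. - exp (- a * of_real v) / a) \<circ> real_of_ereal) \<longlongrightarrow> - 1 / a) (at_right 0)"
      unfolding zero_ereal_def ereal_tendsto_simps1
      by (rule tendsto_eq_rhs) (rule tendsto_intros | use anz in simp)+
    have "((\<lambda>v. exp (- Re a * v) / norm a) \<longlongrightarrow> 0) at_top" using assms anz by real_asymp
    then have "((\<lambda>v. - exp (- a * of_real v) / a) \<longlongrightarrow> 0) at_top"
      by (rule Lim_null_comparison[rotated]) (simp add: norm_divide norm_exp_eq_Re)
    then show "(((\<lambda>v. - exp (- a * of_real v) / a) \<circ> real_of_ereal) \<longlongrightarrow> 0) (at_left \<infinity>)"
      unfolding ereal_tendsto_simps1 .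
  qed (use int in auto)
  then show "(\<integral>v. indicator {0<..} v *\<^sub>R exp (- a * of_real v) \<partial>lborel) = 1 / a"
    by (simp add: interval_lebesgue_integral_def set_lebesgue_integral_def ei)
qed

text \<open>Only \<open>v > 0\<close>, that is \<open>u > 1\<close>, is kept; there
  \<open>omega\<close> decays exponentially, so the integral is entire in \<open>z\<close>.\<close>

definition omega_mellin :: "complex \<Rightarrow> complex" where
  "omega_mellin z = (\<integral>v. exp (z * of_real v) * of_real (indicator {0<..} v * omega (exp v)) \<partial>lborel)"

text \<open>The absolute value is removed by
  \<open>exp (c * \<bar>v\<bar>) \<le> exp (c * v) + exp (- c * v)\<close>. It is applied with
  \<open>k = - 4\<close> to the truncated \<open>omega\<close> and with \<open>k = 0\<close> to the
  product of the two generating functions.\<close>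

lemma integrable_exp_abs:
  fixes g :: "real \<Rightarrow> complex" and C k c :: real
  assumes meas: "g \<in> borel_measurable borel"
    and bound: "\<And>v. norm (g v) \<le> C * exp (k * v - exp v - exp (- v))"
  shows "integrable lborel (\<lambda>v. exp (c * \<bar>v\<bar>) * norm (g v))"
proof (rule Bochner_Integration.integrable_bound)
  show "integrable lborel (\<lambda>v. C * (exp ((k + c) * v - 1 * exp v - 1 * exp (- v)) + exp ((k - c) * v - 1 * exp v - 1 * exp (- v))))"
    by (intro integrable_mult_right Bochner_Integration.integrable_add integrable_two_sided_kernel_real) auto
  show "(\<lambda>v. exp (c * \<bar>v\<bar>) * norm (g v)) \<in> borel_measurable lborel"
    using meas by measurable
  show "AE v in lborel. norm (exp (c * \<bar>v\<bar>) * norm (g v)) \<le>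
     norm (C * (exp ((k + c) * v - 1 * exp v - 1 * exp (- v)) + exp ((k - c) * v - 1 * exp v - 1 * exp (- v))))"
  proof (intro AE_I2)
    fix v :: real
    have C: "C \<ge> 0"
    proof -
      have "0 \<le> C * exp (k * v - exp v - exp (- v))" using bound[of v] norm_ge_zero order_trans by blast
      then show ?thesis by (simp add: zero_le_mult_iff)
    qed
    have "exp (c * \<bar>v\<bar>) \<le> exp (c * v) + exp (- c * v)" by (auto simp: abs_if)
    then have "exp (c * \<bar>v\<bar>) * norm (g v) \<le> (exp (c * v) + exp (- c * v)) * (C * exp (k * v - exp v - exp (- v)))"
      using bound[of v] by (intro mult_mono) auto
    also have "\<dots> = C * (exp ((k + c) * v - 1 * exp v - 1 * exp (- v)) + exp ((k - c) * v - 1 * exp v - 1 * exp (- v)))"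
      by (simp add: ring_distribs algebra_simps flip: exp_add)
    finally show "norm (exp (c * \<bar>v\<bar>) * norm (g v)) \<le>
     norm (C * (exp ((k + c) * v - 1 * exp v - 1 * exp (- v)) + exp ((k - c) * v - 1 * exp v - 1 * exp (- v))))"
      using C by simp
  qed
qed

lemma omega_mellin_entire:
  fixes z :: complex
  shows "omega_mellin holomorphic_on UNIV"
  "integrable lborel (\<lambda>v. exp (z * of_real v) * of_real (indicator {0<..} v * omega (exp v)))"
proof -
  define g where "g = (\<lambda>v. complex_of_real (indicator {0<..} v * omega (exp v)))"
  have meas: "g \<in> borel_measurable borel" unfolding g_def by measurable
  \<comment> \<open>The factor \<open>exp 1\<close> pays for \<open>exp (- exp (- v))\<close>, which
    is at least \<open>exp (- 1)\<close> where \<open>g\<close> does not vanish.\<close>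
  have bound: "norm (g v) \<le> decay_const * exp 1 * exp ((- 4) * v - exp v - exp (- v))" for v
  proof (cases "v > 0")
    case True
    have "norm (g v) = omega (exp v)" using True omega_bound(1)[of "exp v"] by (simp add: g_def)
    also have "\<dots> \<le> decay_const * (exp (- exp v) / exp v ^ 4)" by (rule omega_bound) simp
    also have "exp (- exp v) / exp v ^ 4 = exp (- exp v - 4 * v)"
      by (simp add: exp_diff exp_of_nat_mult[of 4 v, simplified])
    also have "decay_const * exp (- exp v - 4 * v) \<le> decay_const * exp (1 + ((- 4) * v - exp v - exp (- v)))"
      using True by (intro mult_left_mono decay_const_nonneg) auto
    also have "\<dots> = decay_const * exp 1 * exp ((- 4) * v - exp v - exp (- v))"
      by (simp only: exp_add mult.assoc)
    finally show ?thesis .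
  qed (auto simp: g_def intro!: mult_nonneg_nonneg decay_const_nonneg)
  note E = integral_exp_entire[OF meas integrable_exp_abs[OF meas bound]]
  show "omega_mellin holomorphic_on UNIV" using E(2) unfolding omega_mellin_def[abs_def] g_def .
  show "integrable lborel (\<lambda>v. exp (z * of_real v) * of_real (indicator {0<..} v * omega (exp v)))"
    using E(1) unfolding g_def .
qed

text \<open>Riemann's argument: split at \<open>v = 0\<close>, reflect the negative half and apply
  \<open>omega_inversion\<close>. The elementary terms of the inversion integrate to the two poles,
  and what remains is symmetric under \<open>s \<mapsto> 1 - s\<close>.\<close>

lemma completed_zeta_split:
  assumes s: "Re s > 1"
  shows "(\<integral>v. exp (s / 2 * of_real v) * of_real (omega (exp v)) \<partial>lborel) =
     omega_mellin (s / 2) + omega_mellin ((1 - s) / 2) + 1 / (s - 1) - 1 / s"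
proof -
  define f where "f = (\<lambda>v. exp (s / 2 * of_real v) * complex_of_real (omega (exp v)))"
  have fint: "integrable lborel f" unfolding f_def by (rule completed_zeta_integral(1)[OF s])
  define g1 where "g1 = (\<lambda>v. indicator {0<..} v *\<^sub>R f v)"
  define g2 where "g2 = (\<lambda>v. indicator {..<0} v *\<^sub>R f v)"
  have g12: "integrable lborel g1" "integrable lborel g2"
    unfolding g1_def g2_def using fint by (auto intro!: integrable_mult_indicator)
  have "AE v in lborel. f v = g1 v + g2 v"
    using AE_lborel_singleton[of 0] by eventually_elim (auto simp: g1_def g2_def indicator_def)
  then have "(\<integral>v. f v \<partial>lborel) = (\<integral>v. g1 v + g2 v \<partial>lborel)"
    using fint g12 by (intro integral_cong_AE) auto
  also have "\<dots> = (\<integral>v. g1 v \<partial>lborel) + (\<integral>v. g2 v \<partial>lborel)"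
    using g12 by simp
  also have "(\<integral>v. g1 v \<partial>lborel) = omega_mellin (s / 2)"
    unfolding omega_mellin_def g1_def f_def by (rule Bochner_Integration.integral_cong) (auto simp: indicator_def)
  also have "(\<integral>v. g2 v \<partial>lborel) = (\<integral>v. g2 (- v) \<partial>lborel)" by (rule lborel_integral_reflect[symmetric])
  also have "\<dots> = (\<integral>v. exp ((1 - s) / 2 * of_real v) * of_real (indicator {0<..} v * omega (exp v)) +
      (indicator {0<..} v *\<^sub>R exp (- ((s - 1) / 2) * of_real v) / 2 - indicator {0<..} v *\<^sub>R exp (- (s / 2) * of_real v) / 2) \<partial>lborel)"
  proof (rule Bochner_Integration.integral_cong)
    fix v :: real
    show "g2 (- v) = exp ((1 - s) / 2 * of_real v) * of_real (indicator {0<..} v * omega (exp v)) +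
      (indicator {0<..} v *\<^sub>R exp (- ((s - 1) / 2) * of_real v) / 2 - indicator {0<..} v *\<^sub>R exp (- (s / 2) * of_real v) / 2)"
    proof (cases "v > 0")
      case True
      have e: "exp ((1 - s) / 2 * of_real v) = exp (- (s / 2) * of_real v) * of_real (exp (v / 2))"
        unfolding exp_of_real[symmetric] mult_exp_exp by (simp add: field_simps)
      have e': "exp (- ((s - 1) / 2) * of_real v) = exp (- (s / 2) * of_real v) * of_real (exp (v / 2))"
        unfolding e[symmetric] by (rule arg_cong[where f = exp]) (simp add: field_simps)
      have "g2 (- v) = exp (- (s / 2) * of_real v) * of_real (omega (exp (- v)))"
        using True by (simp add: g2_def f_def)
      also have "\<dots> = exp (- (s / 2) * of_real v) * of_real (exp (v / 2)) * of_real (omega (exp v)) +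
         (exp (- (s / 2) * of_real v) * of_real (exp (v / 2)) / 2 - exp (- (s / 2) * of_real v) / 2)"
        unfolding omega_inversion[of v] by (simp add: field_simps)
      finally show ?thesis using True unfolding e e' by simp
    qed (auto simp: g2_def)
  qed simp
  also have "\<dots> = omega_mellin ((1 - s) / 2) + (1 / ((s - 1) / 2) / 2 - 1 / (s / 2) / 2)"
  proof -
    have a1: "Re ((s - 1) / 2) > 0" and a2: "Re (s / 2) > 0" using s by auto
    show ?thesis
      unfolding omega_mellin_def
      using omega_mellin_entire(2)[of "(1 - s) / 2"] integral_exp_half_line[OF a1] integral_exp_half_line[OF a2]
      by (subst Bochner_Integration.integral_add; (intro Bochner_Integration.integrable_diff integrable_divide_zero)?; simp)
  qed
  also have "1 / ((s - 1) / 2) / 2 - 1 / (s / 2) / 2 = 1 / (s - 1) - 1 / s"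
  proof -
    have "1 / (t / 2) / 2 = 1 / t" for t :: complex by simp
    then show ?thesis by (simp only:)
  qed
  finally show ?thesis by (simp add: f_def algebra_simps)
qed

text \<open>The last summand is \<open>- rGamma (s/2) / s\<close>, written without the removable singularity at \<open>0\<close>.\<close>

definition zeta_cont :: "complex \<Rightarrow> complex" where
  "zeta_cont s = (if s = 1 then 0 else
     of_real pi powr (s / 2) * (rGamma (s / 2) * (omega_mellin (s / 2) + omega_mellin ((1 - s) / 2) + 1 / (s - 1))
        - rGamma (s / 2 + 1) / 2))"

lemma zeta_cont_holomorphic: "zeta_cont holomorphic_on (- {1})"
proof -
  have h: "(\<lambda>s. omega_mellin (h s)) holomorphic_on A" if "h holomorphic_on A" for h A
    using holomorphic_on_compose[OF that holomorphic_on_subset[OF omega_mellin_entire(1)]] by (simp add: o_def)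
  have "(\<lambda>s. of_real pi powr (s / 2) * (rGamma (s / 2) * (omega_mellin (s / 2) + omega_mellin ((1 - s) / 2) + 1 / (s - 1))
        - rGamma (s / 2 + 1) / 2)) holomorphic_on (- {1})"
    by (intro holomorphic_intros h) auto
  then show ?thesis
    by (rule holomorphic_transform) (auto simp: zeta_cont_def)
qed

lemma zeta_cont_completed:
  assumes "s \<noteq> 0" "s \<noteq> 1"
  shows "zeta_cont s = of_real pi powr (s / 2) * rGamma (s / 2) *
     (omega_mellin (s / 2) + omega_mellin ((1 - s) / 2) + 1 / (s - 1) - 1 / s)"
proof -
  have "rGamma (s / 2 + 1) / 2 = rGamma (s / 2) / s"
    using rGamma_plus1[of "s / 2"] assms by (simp add: field_simps)
  then show ?thesis using assms by (simp add: zeta_cont_def algebra_simps)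
qed

lemma zeta_cont_Dirichlet:
  assumes "Re s > 1"
  shows "((\<lambda>n. of_nat n powr (- s)) has_sum zeta_cont s) {1..}"
proof -
  have s: "s \<noteq> 0" "s \<noteq> 1" using assms by auto
  have "Re (s / 2) > 0" using assms by simp
  then have "s / 2 \<notin> \<int>\<^sub>\<le>\<^sub>0" by (auto elim!: nonpos_Ints_cases)
  then have rG: "rGamma (s / 2) * Gamma (s / 2) = 1" by (simp add: Gamma_def rGamma_eq_zero_iff)
  have "zeta_cont s = of_real pi powr (s / 2) * rGamma (s / 2) *
      (of_real pi powr (- s / 2) * Gamma (s / 2) * (\<Sum>\<^sub>\<infinity>n\<in>{1..}. of_nat n powr (- s)))"
    unfolding zeta_cont_completed[OF s] completed_zeta_split[OF assms, symmetric] completed_zeta_integral(2)[OF assms] ..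
  also have "\<dots> = (of_real pi powr (s / 2) * of_real pi powr (- s / 2)) * (rGamma (s / 2) * Gamma (s / 2)) * (\<Sum>\<^sub>\<infinity>n\<in>{1..}. of_nat n powr (- s))"
    by (simp only: mult_ac)
  also have "\<dots> = (\<Sum>\<^sub>\<infinity>n\<in>{1..}. of_nat n powr (- s))"
    by (simp add: rG powr_minus)
  finally show ?thesis
    using abs_summable_summable[OF zeta_terms_summable[OF assms]] by simp
qed

text \<open>Existence in the definite description is \<open>zeta_cont\<close>. Uniqueness: two
  candidates agree for \<open>Re s > 1\<close>, hence on the connected punctured plane, and the
  value at \<open>1\<close> is prescribed.\<close>

lemma zeta_eq_zeta_cont: "zeta = zeta_cont"
  unfolding zeta_def
proof (rule the_equality, intro conjI allI impI)
  show "zeta_cont holomorphic_on - {1}" by (rule zeta_cont_holomorphic)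
  show 1: "(\<lambda>n. of_nat (Suc n) powr - s) sums zeta_cont s" if "1 < Re s" for s
    using has_sum_imp_sums[OF zeta_cont_Dirichlet[OF that, unfolded has_sum_nat_from_1_iff]] .
  show "zeta_cont 1 = 0" by (simp add: zeta_cont_def)
  fix f assume f: "f holomorphic_on - {1} \<and> (\<forall>s. 1 < Re s \<longrightarrow> (\<lambda>n. of_nat (Suc n) powr - s) sums f s) \<and> f 1 = 0"
  show "f = zeta_cont"
  proof
    fix z
    show "f z = zeta_cont z"
    proof (cases "z = 1")
      case False
      have "f z - zeta_cont z = 0"
      proof (rule analytic_continuation_open[where s = "{s. Re s > 1}" and s' = "- {1}" and f = "\<lambda>z. f z - zeta_cont z" and g = "\<lambda>_. 0"])
        show "open {s. 1 < Re s}" by (rule open_halfspace_Re_gt)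
        show "{s. 1 < Re s} \<noteq> {}" by (auto intro!: exI[of _ "2"])
        show "connected (- {1::complex})" by (intro connected_punctured_universe) auto
        show "(\<lambda>z. f z - zeta_cont z) holomorphic_on - {1}"
          using f zeta_cont_holomorphic by (intro holomorphic_intros) auto
        show "f z - zeta_cont z = 0" if "z \<in> {s. 1 < Re s}" for z
          using f 1[of z] that sums_unique2 by auto
      qed (use False in auto)
      then show ?thesis by simp
    qed (use f in \<open>simp add: zeta_cont_def\<close>)
  qed
qed

lemma zeta_holomorphic: "zeta holomorphic_on (- {1})"
  and zeta_has_sum: "Re s > 1 \<Longrightarrow> ((\<lambda>n. of_nat n powr (- s)) has_sum zeta s) {1..}"
  unfolding zeta_eq_zeta_cont by (rule zeta_cont_holomorphic, rule zeta_cont_Dirichlet)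

lemma rGamma_nonreal: "z \<notin> \<real> \<Longrightarrow> rGamma z \<noteq> 0"
  by (auto simp: rGamma_eq_zero_iff elim!: nonpos_Ints_cases)

text \<open>For nonreal \<open>s\<close> the factor \<open>rGamma (s / 2)\<close> is nonzero, so the
  zero belongs to the completed bracket, which is invariant under
  \<open>s \<mapsto> 1 - s\<close>.\<close>

lemma zeta_zero_reflect:
  assumes "zeta s = 0" "s \<notin> \<real>"
  shows "zeta (1 - s) = 0"
proof -
  have s: "s \<noteq> 0" "s \<noteq> 1" "1 - s \<noteq> 0" "1 - s \<noteq> 1" using assms(2) by auto
  have "s / 2 \<notin> \<real>"
  proof
    assume "s / 2 \<in> \<real>"
    then have "s / 2 * 2 \<in> \<real>" by (intro Reals_mult) auto
    with assms(2) show False by simp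
  qed
  then have "omega_mellin (s / 2) + omega_mellin ((1 - s) / 2) + 1 / (s - 1) - 1 / s = 0"
    using assms(1) rGamma_nonreal[of "s / 2"] unfolding zeta_eq_zeta_cont zeta_cont_completed[OF s(1,2)] by simp
  moreover have "1 / (1 - s - 1) - 1 / (1 - s) = 1 / (s - 1) - 1 / s"
    using s by (simp add: divide_simps)
  ultimately have "omega_mellin ((1 - s) / 2) + omega_mellin (s / 2) + 1 / (1 - s - 1) - 1 / (1 - s) = 0"
    by (simp only: add_diff_eq[symmetric]) (simp only: add_ac)
  then show ?thesis
    unfolding zeta_eq_zeta_cont zeta_cont_completed[OF s(3,4)] by simp
qed

subsection \<open>Theta inversion for the generating functions\<close>

definition alpha_line :: "real \<Rightarrow> real" where
  "alpha_line u = alpha_series (exp (- pi * u))"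

definition beta_line :: "real \<Rightarrow> real" where
  "beta_line u = beta_series (exp (- pi * u))"

text \<open>Reduces to the inversion of \<open>\<theta>3\<close> by \<open>\<theta>2(x) = \<theta>3(x/4) - \<theta>3(x)\<close> and \<open>\<theta>4(u) = 2 \<theta>3(4u) - \<theta>3(u)\<close>.\<close>

lemma beta_line_inversion:
  assumes u: "u > 0"
  shows "beta_line (1 / u) = u\<^sup>2 * theta4 (exp (- pi * u)) ^ 4 / 16"
proof -
  define x where "x = 1 / u"
  have x: "x > 0" using u by (simp add: x_def)
  define q where "q = exp (- pi * x)"
  have q: "0 < q" "q < 1" using x by (auto simp: q_def)
  define E where "E = {j::int. even j}"
  define O' where "O' = {j::int. odd j}"
  have EO: "E \<inter> O' = {}" "E \<union> O' = UNIV" by (auto simp: E_def O'_def)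
  have dbl: "(f has_sum s) E \<longleftrightarrow> ((\<lambda>j. f (2 * j)) has_sum s) UNIV" for f :: "int \<Rightarrow> real" and s
    by (rule has_sum_reindex_bij_witness[where i = "\<lambda>j. 2 * j" and j = "\<lambda>j. j div 2"]) (auto simp: E_def)
  have odd': "(f has_sum s) O' \<longleftrightarrow> ((\<lambda>j. f (2 * j + 1)) has_sum s) UNIV" for f :: "int \<Rightarrow> real" and s
    by (rule has_sum_reindex_bij_witness[where i = "\<lambda>j. 2 * j + 1" and j = "\<lambda>j. j div 2"]) (auto simp: O'_def)

  have "((\<lambda>j::int. exp (- pi * (x / 4) * (of_int j)\<^sup>2)) has_sum theta_line (x / 4)) UNIV"
    using x by (intro theta_line_has_sum) auto
  moreover have "((\<lambda>j::int. exp (- pi * (x / 4) * (of_int j)\<^sup>2)) has_sum theta_line x) E"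
    unfolding dbl using theta_line_has_sum[OF x] by (simp add: power_mult_distrib mult.assoc)
  ultimately have "((\<lambda>j::int. exp (- pi * (x / 4) * (of_int j)\<^sup>2)) has_sum (theta_line (x / 4) - theta_line x)) (UNIV - E)"
    by (rule has_sum_Diff) simp
  moreover have "UNIV - E = O'" by (auto simp: E_def O'_def)
  ultimately have "((\<lambda>j::int. exp (- pi * (x / 4) * (2 * of_int j + 1)\<^sup>2)) has_sum (theta_line (x / 4) - theta_line x)) UNIV"
    using odd' by simp
  \<comment> \<open>Since \<open>(2 * j + 1)\<^sup>2 / 4 = j\<^sup>2 + j + 1 / 4\<close>, the odd
    terms carry a constant factor; its fourth power later cancels the \<open>q\<close> in
    \<open>beta_series_theta2\<close>.\<close>
  moreover have "exp (- pi * (x / 4) * (2 * of_int j + 1)\<^sup>2) = exp (- pi * x / 4) * q powi (j\<^sup>2 + j)" for j :: int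
    unfolding q_def exp_power_int mult_exp_exp by (rule arg_cong[where f = exp]) (simp add: power2_eq_square field_simps)
  ultimately have "((\<lambda>j::int. exp (pi * x / 4) * (exp (- pi * x / 4) * q powi (j\<^sup>2 + j))) has_sum
      exp (pi * x / 4) * (theta_line (x / 4) - theta_line x)) UNIV"
    by (intro has_sum_cmult_right) simp
  moreover have "exp (pi * x / 4) * (exp (- pi * x / 4) * t) = t" for t
    by (simp flip: mult.assoc exp_add)
  ultimately have th2: "((\<lambda>j::int. q powi (j\<^sup>2 + j)) has_sum exp (pi * x / 4) * (theta_line (x / 4) - theta_line x)) UNIV"
    by (simp only:)
  have "beta_line x = q * (exp (pi * x / 4) * (theta_line (x / 4) - theta_line x)) ^ 4 / 16"
    unfolding beta_line_def q_def[symmetric] by (rule beta_series_theta2[OF q th2])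
  also have "\<dots> = (theta_line (x / 4) - theta_line x) ^ 4 / 16"
  proof -
    have "exp (pi * x / 4) ^ 4 = exp (pi * x)" by (simp flip: exp_of_nat_mult)
    then have "q * exp (pi * x / 4) ^ 4 = 1" by (simp add: q_def flip: exp_add)
    then show ?thesis by (simp add: power_mult_distrib flip: mult.assoc)
  qed
  \<comment> \<open>Here \<open>x / 4 = 1 / (4 * u)\<close>, so the first inversion has the factor
    \<open>2 * sqrt u\<close> and the second \<open>sqrt u\<close>.\<close>
  also have "theta_line (x / 4) - theta_line x = sqrt u * (2 * theta_line (4 * u) - theta_line u)"
    using theta_line_inversion[of "4 * u"] theta_line_inversion[OF u] u
    by (simp add: x_def real_sqrt_mult algebra_simps)
  also have "2 * theta_line (4 * u) - theta_line u = theta4 (exp (- pi * u))"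
  proof -
    have all: "((\<lambda>j::int. exp (- pi * u * (of_int j)\<^sup>2)) has_sum theta_line u) UNIV"
      by (rule theta_line_has_sum[OF u])
    have ev: "((\<lambda>j::int. exp (- pi * u * (of_int j)\<^sup>2)) has_sum theta_line (4 * u)) E"
      unfolding dbl using theta_line_has_sum[of "4 * u"] u by (simp add: power_mult_distrib algebra_simps)
    from has_sum_Diff[OF all ev] have "((\<lambda>j::int. exp (- pi * u * (of_int j)\<^sup>2)) has_sum (theta_line u - theta_line (4 * u))) O'"
      using \<open>UNIV - E = O'\<close> by simp
    then have "((\<lambda>j::int. - exp (- pi * u * (of_int j)\<^sup>2)) has_sum - (theta_line u - theta_line (4 * u))) O'"
      by (simp add: has_sum_uminus)
    then have od: "((\<lambda>j::int. (- 1) powi j * exp (- pi * u) powi (j\<^sup>2)) has_sum - (theta_line u - theta_line (4 * u))) O'"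
      by (rule has_sum_cong[THEN iffD1, rotated]) (auto simp: O'_def exp_power_int power_int_minus_left algebra_simps)
    have "((\<lambda>j::int. (- 1) powi j * exp (- pi * u) powi (j\<^sup>2)) has_sum theta_line (4 * u)) E"
      using ev by (rule has_sum_cong[THEN iffD1, rotated]) (auto simp: E_def exp_power_int power_int_minus_left algebra_simps)
    from has_sum_Un_disjoint[OF this od EO(1)] show ?thesis
      unfolding theta4_def EO(2) by (intro infsumI[symmetric]) (simp add: algebra_simps)
  qed
  also have "(sqrt u * theta4 (exp (- pi * u))) ^ 4 = u\<^sup>2 * theta4 (exp (- pi * u)) ^ 4"
  proof -
    have "sqrt u ^ 4 = (sqrt u ^ 2) ^ 2" by (simp flip: power_mult)
    then show ?thesis using u by (simp add: power_mult_distrib)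
  qed
  finally show ?thesis by (simp add: x_def)
qed

lemma a_coeff_le: "real (a_coeff n) \<le> real n ^ 2" and b_coeff_le: "real (b_coeff n) \<le> real n ^ 2"
proof -
  have s: "real (sigma1 n) \<le> real n ^ 2" using sigma1_le[of n] by (simp flip: of_nat_power)
  have "real (a_coeff n) \<le> real (sigma1 n)" by (simp add: a_coeff_eq)
  with s show "real (a_coeff n) \<le> real n ^ 2" by linarith
  show "real (b_coeff n) \<le> real n ^ 2" using s by (simp add: b_coeff_def)
qed

lemma alpha_line_bounds:
  assumes "u > 0"
  shows "0 \<le> alpha_line u" "alpha_line u \<le> decay_const * (exp (- u) / u ^ 4)"
    "0 \<le> beta_line u" "beta_line u \<le> decay_const * (exp (- u) / u ^ 4)"
    "((\<lambda>n. real (a_coeff n) * exp (- pi * u) ^ n) has_sum alpha_line u) {1..}"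
    "((\<lambda>n. real (b_coeff n) * exp (- pi * u) ^ n) has_sum beta_line u) {1..}"
proof -
  have hs: "(w has_sum suminf w) {1..}" if "summable w" "\<And>n. 0 \<le> w n" "w 0 = 0" for w :: "nat \<Rightarrow> real"
  proof -
    have "(w has_sum suminf w) UNIV"
      using that by (intro norm_summable_imp_has_sum) (auto simp: summable_sums)
    then show ?thesis
      by (rule has_sum_cong_neutral[THEN iffD1, rotated -1]) (use that(3) in \<open>auto simp: Suc_le_eq\<close>)
  qed
  have a: "real (a_coeff n) * exp (- pi * u) ^ n \<le> real n ^ 2 * exp (- pi * u) ^ n"
   and b: "real (b_coeff n) * exp (- pi * u) ^ n \<le> real n ^ 2 * exp (- pi * u) ^ n" for n
    using a_coeff_le[of n] b_coeff_le[of n] by (auto intro!: mult_right_mono)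
  note A = exp_series_bound[OF assms _ a] and B = exp_series_bound[OF assms _ b]
  show "0 \<le> alpha_line u" "alpha_line u \<le> decay_const * (exp (- u) / u ^ 4)"
    unfolding alpha_line_def alpha_series_def using A(2,3) by simp_all
  show "0 \<le> beta_line u" "beta_line u \<le> decay_const * (exp (- u) / u ^ 4)"
    unfolding beta_line_def beta_series_def using B(2,3) by simp_all
  show "((\<lambda>n. real (a_coeff n) * exp (- pi * u) ^ n) has_sum alpha_line u) {1..}"
    unfolding alpha_line_def alpha_series_def by (rule hs[OF A(1)]) (simp_all add: a_coeff_def)
  show "((\<lambda>n. real (b_coeff n) * exp (- pi * u) ^ n) has_sum beta_line u) {1..}"
    unfolding beta_line_def beta_series_def by (rule hs[OF B(1)]) (simp_all add: b_coeff_def)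
qed

lemma alpha_line_measurable [measurable]: "(\<lambda>v. alpha_line (exp v)) \<in> borel_measurable borel"
  and beta_line_measurable [measurable]: "(\<lambda>v. beta_line (exp v)) \<in> borel_measurable borel"
  and beta_line_measurable' [measurable]: "(\<lambda>v. beta_line (exp (- v))) \<in> borel_measurable borel"
  unfolding alpha_line_def beta_line_def alpha_series_def beta_series_def by measurable

text \<open>By inversion the function is \<open>theta4 (exp (- pi * exp v)) ^ 4 / 16\<close>. Its
  logarithmic derivative is 4 times that of \<open>theta4\<close>, that is 4 times
  \<open>2 * pi * exp v * alpha_line (exp v)\<close>.\<close>

lemma DERIV_beta_line:
  "((\<lambda>v. exp (- 2 * v) * beta_line (exp (- v))) has_real_derivative
     8 * pi * exp v * alpha_line (exp v) * (exp (- 2 * v) * beta_line (exp (- v)))) (at v)"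
proof -
  define h where "h = (\<lambda>v. theta4 (exp (- pi * exp v)) ^ 4 / 16)"
  have eq: "exp (- 2 * v) * beta_line (exp (- v)) = h v" for v
  proof -
    have "beta_line (exp (- v)) = (exp v)\<^sup>2 * theta4 (exp (- pi * exp v)) ^ 4 / 16"
      using beta_line_inversion[of "exp v"] by (simp add: exp_minus field_simps)
    moreover have "exp (- 2 * v) * (exp v)\<^sup>2 = 1" by (simp flip: exp_of_nat_mult exp_add)
    moreover have "exp (- 2 * v) * ((exp v)\<^sup>2 * t / 16) = exp (- 2 * v) * (exp v)\<^sup>2 * t / 16" for t by simp
    ultimately show ?thesis by (simp only: h_def mult_1)
  qed
  define q where "q = exp (- pi * exp v)"
  have q: "0 < q" "q < 1" by (auto simp: q_def)
  have D1: "((\<lambda>v. exp (- pi * exp v)) has_real_derivative q * (- pi * exp v)) (at v)"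
    by (auto intro!: derivative_eq_intros simp: q_def)
  have D2: "(theta4 has_real_derivative - 2 * alpha_series q * theta4 q / q) (at (exp (- pi * exp v)))"
    unfolding q_def by (rule DERIV_theta4) auto
  have al: "alpha_line (exp v) = alpha_series q" by (simp add: alpha_line_def q_def)
  from DERIV_chain2[OF D2 D1]
  have D3: "((\<lambda>v. theta4 (exp (- pi * exp v))) has_real_derivative 2 * pi * exp v * alpha_line (exp v) * theta4 q) (at v)"
    by (rule DERIV_cong) (use q in \<open>simp add: al\<close>)
  have "(h has_real_derivative real 4 * theta4 q ^ (4 - 1) * (2 * pi * exp v * alpha_line (exp v) * theta4 q) / 16) (at v)"
    unfolding h_def using DERIV_cdivide[OF DERIV_power[OF D3, of 4], of 16] by (simp add: q_def mult_ac)
  then have "(h has_real_derivative 8 * pi * exp v * alpha_line (exp v) * h v) (at v)"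
    by (rule DERIV_cong) (simp add: h_def q_def power_numeral_reduce)
  then show ?thesis unfolding eq .
qed

lemma isCont_alpha_line: "isCont (\<lambda>v. alpha_line (exp v)) v"
proof -
  define q where "q = exp (- pi * exp v)"
  have q: "0 < q" "q < 1" by (auto simp: q_def)
  obtain r where r: "q < r" "r < 1" using dense q by blast
  have "summable (\<lambda>n. real (a_coeff n) * r ^ n)"
    using alpha_series_sums[of r] q r by (auto simp: sums_iff)
  then have "isCont alpha_series q"
    unfolding alpha_series_def[abs_def] using q r by (intro isCont_powser) auto
  then have "isCont alpha_series (exp (- pi * exp v))" by (simp add: q_def)
  then have "isCont (\<lambda>v. alpha_series (exp (- pi * exp v))) v"
    by (rule isCont_o2[rotated]) (intro continuous_intros)
  then show ?thesis by (simp add: alpha_line_def)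
qed

subsection \<open>The Fourier transform as a Mellin integral\<close>

definition product_mellin :: "complex \<Rightarrow> complex" where
  "product_mellin s = (\<integral>v. exp (s * of_real v) * of_real (alpha_line (exp v) * beta_line (exp (- v))) \<partial>lborel)"

text \<open>The factors \<open>exp v ^ 4\<close> and \<open>exp (- v) ^ 4\<close> from the two decay
  bounds cancel, and doubly exponential decay remains in both directions.\<close>

lemma alpha_beta_bound:
  "alpha_line (exp v) * beta_line (exp (- v)) \<le> decay_const\<^sup>2 * exp (0 * v - exp v - exp (- v))"
proof -
  have "alpha_line (exp v) * beta_line (exp (- v)) \<le>
        (decay_const * (exp (- exp v) / exp v ^ 4)) * (decay_const * (exp (- exp (- v)) / exp (- v) ^ 4))"
    by (intro mult_mono alpha_line_bounds mult_nonneg_nonneg decay_const_nonneg) auto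
  also have "\<dots> = decay_const\<^sup>2 * (exp (- exp v) * exp (- exp (- v))) / (exp v * exp (- v)) ^ 4"
  proof -
    have "(D * (a / x)) * (D * (b / y)) = D\<^sup>2 * (a * b) / (x * y)" for D a b x y :: real
      by (simp add: power2_eq_square)
    then show ?thesis unfolding power_mult_distrib .
  qed
  also have "exp v * exp (- v) = 1" by (simp flip: exp_add)
  also have "exp (- exp v) * exp (- exp (- v)) = exp (0 * v - exp v - exp (- v))" by (simp flip: exp_add)
  finally show ?thesis by simp
qed

lemma product_mellin_entire:
  fixes s :: complex
  shows "product_mellin holomorphic_on UNIV"
    and "integrable lborel (\<lambda>v. exp (s * of_real v) * of_real (alpha_line (exp v) * beta_line (exp (- v))))"
proof -
  define g where "g = (\<lambda>v. complex_of_real (alpha_line (exp v) * beta_line (exp (- v))))"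
  have meas: "g \<in> borel_measurable borel" unfolding g_def by measurable
  have "norm (g v) = alpha_line (exp v) * beta_line (exp (- v))" for v
    unfolding g_def norm_of_real by (intro abs_of_nonneg mult_nonneg_nonneg alpha_line_bounds) auto
  then have bound: "norm (g v) \<le> decay_const\<^sup>2 * exp (0 * v - exp v - exp (- v))" for v
    using alpha_beta_bound[of v] by simp
  note E = integral_exp_entire[OF meas integrable_exp_abs[OF meas bound]]
  show "product_mellin holomorphic_on UNIV" using E(2) unfolding product_mellin_def[abs_def] g_def .
  show "integrable lborel (\<lambda>v. exp (s * of_real v) * of_real (alpha_line (exp v) * beta_line (exp (- v))))"
    using E(1) unfolding g_def .
qed

lemma alpha_beta_has_sum:
  "((\<lambda>(d, l). (real (a_coeff d) * exp (- pi * exp v) ^ d) * (real (b_coeff l) * exp (- pi * exp (- v)) ^ l))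
     has_sum alpha_line (exp v) * beta_line (exp (- v))) ({1..} \<times> {1..})"
proof -
  have abs: "(\<lambda>x. norm (f x)) summable_on A" if "(f has_sum s) A" for f :: "nat \<Rightarrow> real" and s A
    using summable_on_iff_abs_summable_on_real[of f A] has_sum_imp_summable[OF that] by simp
  have a: "((\<lambda>n. real (a_coeff n) * exp (- pi * exp v) ^ n) has_sum alpha_line (exp v)) {1..}"
    and b: "((\<lambda>n. real (b_coeff n) * exp (- pi * exp (- v)) ^ n) has_sum beta_line (exp (- v))) {1..}"
    by (rule alpha_line_bounds; simp)+
  show ?thesis by (rule has_sum_product[OF a b abs[OF a] abs[OF b]])
qed

lemma exp_power_term: "exp (- pi * x) ^ n = exp (- (pi * real n * x))" for x :: real
  by (simp add: mult_ac flip: exp_of_nat_mult)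

text \<open>The quarter powers in \<open>G_summand\<close> and \<open>G_term\<close> cancel, and the
  divisor \<open>d\<close> of \<open>j\<close> then contributes the \<open>d\<close>-th term of the
  first series times the \<open>j div d\<close>-th term of the second.\<close>

lemma G_has_sum: "(G_summand v has_sum exp (v / 2) * (alpha_line (exp v) * beta_line (exp (- v)))) {1..}"
proof -
  define f where "f = (\<lambda>d l. exp (v / 2) * ((real (a_coeff d) * exp (- pi * exp v) ^ d) * (real (b_coeff l) * exp (- pi * exp (- v)) ^ l)))"
  have "((\<lambda>(d, l). f d l) has_sum exp (v / 2) * (alpha_line (exp v) * beta_line (exp (- v)))) ({1..} \<times> {1..})"
    using has_sum_cmult_right[OF alpha_beta_has_sum, of "exp (v / 2)" v] by (simp add: f_def case_prod_unfold)
  then have "((\<lambda>n. \<Sum>d | d dvd n. f d (n div d)) has_sum exp (v / 2) * (alpha_line (exp v) * beta_line (exp (- v)))) {1..}"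
    by (rule has_sum_divisors)
  then show ?thesis
  proof (rule has_sum_cong[THEN iffD1, rotated])
    fix n :: nat assume n: "n \<in> {1..}"
    show "(\<Sum>d | d dvd n. f d (n div d)) = G_summand v n"
      unfolding G_summand_def
    proof (rule sum.cong)
      fix d assume "d \<in> {d. d dvd n}"
      then have d: "d dvd n" "d > 0" using n by (auto simp: dvd_pos_nat)
      define x where "x = real n / real d ^ 2"
      have "x > 0" using n d by (simp add: x_def)
      then have "x powr (1 / 4) * x powr (- 1 / 4) = 1" by (simp flip: powr_add)
      then have c: "A * x powr (1 / 4) * (x powr (- 1 / 4) * t * u) = A * t * u" for A t u
        by (metis (no_types, opaque_lifting) mult.assoc mult.commute mult.right_neutral)
      have "real n / real d = real (n div d)" using d by (simp add: real_of_nat_div)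
      then have "exp (- pi * (real d * exp v + real n / real d * exp (- v))) = exp (- pi * exp v) ^ d * exp (- pi * exp (- v)) ^ (n div d)"
        unfolding exp_power_term mult_exp_exp by (simp add: algebra_simps)
      then show "f d (n div d) = real (a_coeff d) * real (b_coeff (n div d)) * (real n / real d ^ 2) powr (1 / 4) * G_term v d n"
        unfolding G_term_def x_def[symmetric] c by (simp add: f_def mult_ac)
    qed simp
  qed
qed

lemma G_sums: "(\<lambda>j. G_summand v (Suc j)) sums (exp (v / 2) * (alpha_line (exp v) * beta_line (exp (- v))))"
  using has_sum_imp_sums[OF G_has_sum[of v, unfolded has_sum_nat_from_1_iff]] .

lemma G_eq: "G v = exp (v / 2) * (alpha_line (exp v) * beta_line (exp (- v)))"
  using G_sums[of v] by (simp add: G_def sums_iff)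

lemma Ghat_integrand_eq:
  "Ghat_integrand t v = exp ((1 / 2 + \<i> * t) * of_real v) * of_real (alpha_line (exp v) * beta_line (exp (- v)))"
proof -
  have "complex_of_real (exp (v / 2)) = exp (of_real v / 2)" by (simp flip: exp_of_real)
  then have "exp (\<i> * t * of_real v) * complex_of_real (exp (v / 2)) = exp ((1 / 2 + \<i> * t) * of_real v)"
    by (simp add: mult_exp_exp algebra_simps)
  then show ?thesis
    unfolding Ghat_integrand_def G_eq of_real_mult[of "exp (v / 2)"] mult.assoc[symmetric] by simp
qed

lemma Ghat_eq: "Ghat t = product_mellin (1 / 2 + \<i> * t)"
  unfolding Ghat_def Ghat_integrand_eq product_mellin_def ..

text \<open>The coefficients and real exponentials in \<open>g\<close> are nonnegative, so the norms
  of the terms add up to the norm of the whole integrand. Its integrability therefore justifies the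
  exchange over all pairs before they are grouped by \<open>n = d * l\<close>.\<close>

lemma bessel_summand_has_sum:
  assumes \<nu>: "1 / 2 + \<i> * \<gamma> \<notin> \<int>"
  shows "(bessel_summand \<gamma> has_sum Ghat \<gamma>) {1..}"
proof -
  define \<nu> where "\<nu> = 1 / 2 + \<i> * \<gamma>"
  define A where "A = {1::nat..} \<times> {1::nat..}"
  define f where "f = (\<lambda>(d, l) v. of_nat (a_coeff d) * of_nat (b_coeff l) *
     exp (\<nu> * of_real v - of_real (pi * real d * exp v) - of_real (pi * real l * exp (- v))))"
  define g where "g = (\<lambda>(d, l) v. (real (a_coeff d) * exp (- pi * exp v) ^ d) * (real (b_coeff l) * exp (- pi * exp (- v)) ^ l))"
  have fg: "f p v = exp (\<nu> * of_real v) * of_real (g p v)" for p v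
  proof -
    obtain d l where p: "p = (d, l)" by (cases p)
    have "exp (\<nu> * of_real v - of_real (pi * real d * exp v) - of_real (pi * real l * exp (- v))) =
       exp (\<nu> * of_real v) * (of_real (exp (- pi * exp v) ^ d) * of_real (exp (- pi * exp (- v)) ^ l))"
      unfolding exp_power_term exp_of_real[symmetric] mult_exp_exp by (simp add: algebra_simps)
    then show ?thesis by (simp add: p f_def g_def mult_ac)
  qed
  have g0: "g p v \<ge> 0" for p v by (cases p) (simp add: g_def)
  have gs: "((\<lambda>p. g p v) has_sum alpha_line (exp v) * beta_line (exp (- v))) A" for v
    using alpha_beta_has_sum[of v] by (simp add: g_def A_def case_prod_unfold)
  have fint: "integrable lborel (f p)" if "p \<in> A" for p
  proof -
    obtain d l where p: "p = (d, l)" by (cases p)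
    then have "d \<ge> 1" "l \<ge> 1" using that by (auto simp: A_def)
    then show ?thesis unfolding p f_def prod.case
      by (intro integrable_mult_right integrable_two_sided_kernel) auto
  qed
  have pw: "((\<lambda>p. norm (f p v)) has_sum norm (exp (\<nu> * of_real v) * of_real (alpha_line (exp v) * beta_line (exp (- v))))) A" for v
  proof -
    have "alpha_line (exp v) * beta_line (exp (- v)) \<ge> 0"
      by (intro mult_nonneg_nonneg alpha_line_bounds) auto
    then show ?thesis
      unfolding fg norm_mult[of "exp (\<nu> * of_real v)"] norm_of_real
      using has_sum_cmult_right[OF gs[of v], of "norm (exp (\<nu> * of_real v))"] g0 by simp
  qed
  have dom: "integrable lborel (\<lambda>v. norm (exp (\<nu> * of_real v) * of_real (alpha_line (exp v) * beta_line (exp (- v)))))"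
    by (intro integrable_norm product_mellin_entire)
  have "((\<lambda>p. \<integral>v. f p v \<partial>lborel) has_sum (\<integral>v. (\<Sum>\<^sub>\<infinity>p\<in>A. f p v) \<partial>lborel)) A"
    by (rule has_sum_integral(2)[OF fint has_sum_imp_summable[OF pw] summable_on_integral_dominated[OF fint pw dom]])
  moreover have "(\<Sum>\<^sub>\<infinity>p\<in>A. f p v) = exp (\<nu> * of_real v) * of_real (alpha_line (exp v) * beta_line (exp (- v)))" for v
    unfolding fg by (intro infsumI has_sum_cmult_right has_sum_of_real gs)
  ultimately have "((\<lambda>p. \<integral>v. f p v \<partial>lborel) has_sum Ghat \<gamma>) A"
    by (simp add: Ghat_eq product_mellin_def \<nu>_def)
  then have "((\<lambda>(d, l). \<integral>v. f (d, l) v \<partial>lborel) has_sum Ghat \<gamma>) A"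
    by (simp add: case_prod_unfold)
  then have "((\<lambda>n. \<Sum>d | d dvd n. \<integral>v. f (d, n div d) v \<partial>lborel) has_sum Ghat \<gamma>) {1..}"
    unfolding A_def by (rule has_sum_divisors)
  then show ?thesis
  proof (rule has_sum_cong[THEN iffD1, rotated])
    fix n :: nat assume n: "n \<in> {1..}"
    show "(\<Sum>d | d dvd n. \<integral>v. f (d, n div d) v \<partial>lborel) = bessel_summand \<gamma> n"
      unfolding bessel_summand_def
    proof (rule sum.cong)
      fix d assume "d \<in> {d. d dvd n}"
      then obtain l where l: "n = d * l" by auto
      have dl: "d > 0" "l > 0" using n l by (auto simp: Suc_le_eq)
      have B: "(\<integral>v. exp (\<nu> * of_real v - of_real (pi * real d * exp v) - of_real (pi * real l * exp (- v))) \<partial>lborel) =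
         of_real (pi * real l / (pi * real d)) powr (\<nu> / 2) * (2 * bessel_K \<nu> (of_real (2 * sqrt (pi * real d * (pi * real l)))))"
        by (rule bessel_K_integral_scaled) (use dl \<nu> in \<open>auto simp: \<nu>_def\<close>)
      have e1: "pi * real l / (pi * real d) = real n / real d ^ 2"
        using dl by (simp add: l power2_eq_square)
      have e2: "2 * sqrt (pi * real d * (pi * real l)) = 2 * pi * sqrt (real n)"
        using dl by (simp add: l real_sqrt_mult algebra_simps)
      have e3: "\<nu> / 2 = 1 / 4 + \<i> * \<gamma> / 2" by (simp add: \<nu>_def add_divide_distrib)
      have "(\<integral>v. f (d, l) v \<partial>lborel) = of_nat (a_coeff d) * of_nat (b_coeff l) *
          (\<integral>v. exp (\<nu> * of_real v - of_real (pi * real d * exp v) - of_real (pi * real l * exp (- v))) \<partial>lborel)"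
        unfolding f_def prod.case by (rule integral_mult_right_zero)
      then have "(\<integral>v. f (d, l) v \<partial>lborel) = of_nat (a_coeff d) * of_nat (b_coeff l) *
          (of_real (real n / real d ^ 2) powr (1 / 4 + \<i> * \<gamma> / 2) * (2 * bessel_K \<nu> (of_real (2 * pi * sqrt (real n)))))"
        unfolding B e1 e2 e3 .
      moreover have "n div d = l" using l dl by simp
      ultimately show "(\<integral>v. f (d, n div d) v \<partial>lborel) = of_nat (a_coeff d) * of_nat (b_coeff (n div d)) *
          of_real (real n / real d ^ 2) powr (1 / 4 + \<i> * \<gamma> / 2) * (2 * bessel_K (1 / 2 + \<i> * \<gamma>) (of_real (2 * pi * sqrt (real n))))"
        by (simp only: mult.assoc \<nu>_def)
    qed simp
  qed
qed

text \<open>\<open>P\<close> is the boundary term. Its exponent \<open>Re s + 1\<close>, the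
  \<open>- 2\<close> in \<open>H\<close> and the 4 from the bound on \<open>beta_line\<close> add up
  to \<open>Re s + 3\<close>; negativity makes \<open>P\<close> integrable and zero at plus
  infinity, while \<open>exp (- exp (- v))\<close> controls minus infinity.\<close>

lemma product_mellin_by_parts:
  assumes s: "Re s < -3"
  shows "8 * of_real pi * product_mellin s = - (s + 1) * (\<integral>v. exp ((1 - s) * of_real v) * of_real (beta_line (exp v)) \<partial>lborel)"
proof -
  define H where "H = (\<lambda>v. exp (- 2 * v) * beta_line (exp (- v)))"
  define P where "P = (\<lambda>v. exp ((s + 1) * of_real v) * complex_of_real (H v))"
  define Q where "Q = (\<lambda>v. exp (s * of_real v) * complex_of_real (alpha_line (exp v) * beta_line (exp (- v))))"
  have Hd: "(H has_real_derivative 8 * pi * exp v * alpha_line (exp v) * H v) (at v)" for v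
    unfolding H_def by (rule DERIV_beta_line)
  have PQ: "exp ((s + 1) * of_real v) * of_real (8 * pi * exp v * alpha_line (exp v) * H v) = 8 * of_real pi * Q v" for v
  proof -
    have "exp ((s + 1) * of_real v) * (of_real (exp v) * of_real (exp (- 2 * v))) = exp (s * of_real v)"
      unfolding exp_of_real[symmetric] mult_exp_exp by (simp add: algebra_simps)
    then show ?thesis by (simp add: Q_def H_def mult_ac)
  qed
  have Pd: "(P has_vector_derivative (s + 1) * P v + 8 * of_real pi * Q v) (at v)" for v
  proof -
    have "((\<lambda>z. exp ((s + 1) * z)) has_field_derivative (s + 1) * exp ((s + 1) * of_real v)) (at (of_real v))"
      by (auto intro!: derivative_eq_intros)
    from has_vector_derivative_real_field[OF this, of UNIV]
    have "((\<lambda>v. exp ((s + 1) * of_real v)) has_vector_derivative (s + 1) * exp ((s + 1) * of_real v)) (at v)" by simp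
    from has_vector_derivative_mult[OF this has_vector_derivative_of_real[OF Hd[of v]]] show ?thesis
      unfolding P_def PQ[symmetric] by (simp add: algebra_simps)
  qed
  have Pb: "norm (P v) \<le> decay_const * exp ((Re s + 3) * v - exp (- v))" for v
  proof -
    have "norm (P v) = exp ((Re s + 1) * v) * (exp (- 2 * v) * beta_line (exp (- v)))"
      using alpha_line_bounds(3)[of "exp (- v)"] by (simp add: P_def H_def norm_mult norm_exp_eq_Re)
    also have "\<dots> \<le> exp ((Re s + 1) * v) * (exp (- 2 * v) * (decay_const * (exp (- exp (- v)) / exp (- v) ^ 4)))"
      by (intro mult_left_mono alpha_line_bounds) auto
    also have "exp (- exp (- v)) / exp (- v) ^ 4 = exp (- exp (- v)) * exp (4 * v)"
      by (simp add: exp_minus field_simps flip: exp_of_nat_mult)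
    also have "exp ((Re s + 1) * v) * (exp (- 2 * v) * (decay_const * (exp (- exp (- v)) * exp (4 * v)))) =
       decay_const * (exp ((Re s + 1) * v) * exp (- 2 * v) * exp (- exp (- v)) * exp (4 * v))"
      by (simp only: mult_ac)
    also have "exp ((Re s + 1) * v) * exp (- 2 * v) * exp (- exp (- v)) * exp (4 * v) = exp ((Re s + 3) * v - exp (- v))"
      unfolding mult_exp_exp by (simp add: algebra_simps)
    finally show ?thesis .
  qed
  have Pcont: "continuous_on UNIV P"
    using Pd by (intro continuous_on_vector_derivative[of UNIV P]) (auto intro: has_vector_derivative_at_within)
  have Pint: "integrable lborel P"
  proof (rule Bochner_Integration.integrable_bound)
    show "integrable lborel (\<lambda>v. decay_const * exp ((- (Re s + 3)) * (- v) - 1 * exp (- v)))"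
      by (intro integrable_mult_right lborel_integrable_reflect[where f = "\<lambda>v. exp ((- (Re s + 3)) * v - 1 * exp v)"] Gamma_integral_line_real) (use s in auto)
    show "P \<in> borel_measurable lborel" using borel_measurable_continuous_onI[OF Pcont] by simp
    show "AE v in lborel. norm (P v) \<le> norm (decay_const * exp ((- (Re s + 3)) * (- v) - 1 * exp (- v)))"
      using Pb decay_const_nonneg by (auto simp: abs_mult algebra_simps)
  qed
  have Qint: "integrable lborel Q" unfolding Q_def by (rule product_mellin_entire)
  have "(\<integral>v. (s + 1) * P v + 8 * of_real pi * Q v \<partial>lborel) = 0 - 0"
  proof (rule integral_FTC_line[OF Pd])
    show "integrable lborel (\<lambda>v. (s + 1) * P v + 8 * of_real pi * Q v)"
      by (intro Bochner_Integration.integrable_add integrable_mult_right Pint Qint)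
    have "((\<lambda>v. decay_const * exp ((Re s + 3) * v - exp (- v))) \<longlongrightarrow> 0) at_top" using s by real_asymp
    then show "(P \<longlongrightarrow> 0) at_top" by (rule Lim_null_comparison[rotated]) (use Pb in simp)
    have "((\<lambda>v. decay_const * exp ((Re s + 3) * v - exp (- v))) \<longlongrightarrow> 0) at_bot" using s by real_asymp
    then show "(P \<longlongrightarrow> 0) at_bot" by (rule Lim_null_comparison[rotated]) (use Pb in simp)
    show "isCont (\<lambda>v. (s + 1) * P v + 8 * of_real pi * Q v) v" for v
    proof -
      have "isCont P v" using Pcont by (simp add: continuous_on_eq_continuous_at)
      moreover have "isCont H v" using Hd[of v] by (rule DERIV_isCont)
      ultimately show ?thesis
        unfolding PQ[symmetric] by (intro continuous_intros isCont_alpha_line)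
    qed
  qed
  then have "(s + 1) * (\<integral>v. P v \<partial>lborel) + 8 * of_real pi * product_mellin s = 0"
    using Pint Qint by (simp add: product_mellin_def Q_def)
  moreover have "(\<integral>v. P v \<partial>lborel) = (\<integral>v. exp ((1 - s) * of_real v) * of_real (beta_line (exp v)) \<partial>lborel)"
  proof -
    have "P (- v) = exp ((1 - s) * of_real v) * of_real (beta_line (exp v))" for v
    proof -
      have "exp ((s + 1) * of_real (- v)) * of_real (exp (- 2 * (- v))) = exp ((1 - s) * of_real v)"
        unfolding exp_of_real[symmetric] mult_exp_exp by (simp add: algebra_simps)
      then show ?thesis by (simp add: P_def H_def flip: mult.assoc)
    qed
    with lborel_integral_reflect[of P] show ?thesis by simp
  qed
  ultimately show ?thesis by (simp only: add_eq_0_iff mult_minus_left)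
qed

section \<open>Dirichlet series of the coefficients b and the formula for the transform\<close>

lemma odd_zeta_has_sum:
  assumes "Re w > 1"
  shows "((\<lambda>n. if odd n then of_nat n powr (- w) else 0) has_sum (1 - 2 powr (- w)) * zeta w) {1..}"
proof -
  have all: "((\<lambda>n. of_nat n powr (- w)) has_sum zeta w) {1..}" by (rule zeta_has_sum[OF assms])
  have "((\<lambda>n. 2 powr (- w) * of_nat n powr (- w)) has_sum 2 powr (- w) * zeta w) {1..}"
    by (intro has_sum_cmult_right all)
  moreover have "2 powr (- w) * of_nat n powr (- w) = of_nat (2 * n) powr (- w)" for n
    using powr_times_real[of 2 "of_nat n" "- w"] by simp
  ultimately have "((\<lambda>n. of_nat (2 * n) powr (- w)) has_sum 2 powr (- w) * zeta w) {1..}" by simp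
  moreover have "((\<lambda>n. of_nat (2 * n) powr (- w)) has_sum 2 powr (- w) * zeta w) {1..} \<longleftrightarrow>
      ((\<lambda>n. of_nat n powr (- w)) has_sum 2 powr (- w) * zeta w) {n\<in>{1..}. even n}"
    by (rule has_sum_reindex_bij_witness[where j = "\<lambda>n. 2 * n" and i = "\<lambda>n. n div 2"]) auto
  ultimately have "((\<lambda>n. of_nat n powr (- w)) has_sum 2 powr (- w) * zeta w) {n\<in>{1..}. even n}" by simp
  from has_sum_Diff[OF all this]
  have "((\<lambda>n. of_nat n powr (- w)) has_sum zeta w - 2 powr (- w) * zeta w) ({1..} - {n\<in>{1..}. even n})" by auto
  then have "((\<lambda>n. if odd n then of_nat n powr (- w) else 0) has_sum zeta w - 2 powr (- w) * zeta w) {1..}"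
    by (rule has_sum_cong_neutral[THEN iffD1, rotated -1]) auto
  then show ?thesis by (simp add: algebra_simps)
qed

text \<open>\<open>b\<close> is the Dirichlet convolution of the identity and the constant 1, both
  restricted to odd arguments. For even \<open>n\<close> every factorisation contains an even
  factor, so the convolution vanishes as \<open>b\<close> does.\<close>

lemma b_coeff_Dirichlet:
  assumes w: "Re w > 2"
  shows "((\<lambda>n. of_nat (b_coeff n) * of_nat n powr (- w)) has_sum
           ((1 - 2 powr (1 - w)) * zeta (w - 1)) * ((1 - 2 powr (- w)) * zeta w)) {1..}"
proof -
  define oz where "oz = (\<lambda>w n. if odd n then complex_of_nat n powr (- w) else 0)"
  have os: "(oz (w - 1) has_sum (1 - 2 powr (- (w - 1))) * zeta (w - 1)) {1..}"
           "(oz w has_sum (1 - 2 powr (- w)) * zeta w) {1..}"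
    unfolding oz_def using w by (intro odd_zeta_has_sum; simp)+
  have oa: "(\<lambda>n. norm (oz z n)) summable_on {1..}" if "Re z > 1" for z
    by (rule summable_on_comparison_test[OF zeta_terms_summable[OF that]]) (auto simp: oz_def)
  have "((\<lambda>(d, l). oz (w - 1) d * oz w l) has_sum
      ((1 - 2 powr (- (w - 1))) * zeta (w - 1)) * ((1 - 2 powr (- w)) * zeta w)) ({1..} \<times> {1..})"
    by (intro has_sum_product os oa) (use w in auto)
  then have "((\<lambda>n. \<Sum>d | d dvd n. oz (w - 1) d * oz w (n div d)) has_sum
      ((1 - 2 powr (- (w - 1))) * zeta (w - 1)) * ((1 - 2 powr (- w)) * zeta w)) {1..}"
    by (rule has_sum_divisors)
  moreover have "(\<Sum>d | d dvd n. oz (w - 1) d * oz w (n div d)) = of_nat (b_coeff n) * of_nat n powr (- w)"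
    if n: "n \<in> {1..}" for n
  proof (cases "odd n")
    case True
    have "(\<Sum>d | d dvd n. oz (w - 1) d * oz w (n div d)) = (\<Sum>d | d dvd n. of_nat d * of_nat n powr (- w))"
    proof (rule sum.cong)
      fix d assume "d \<in> {d. d dvd n}"
      then obtain l where l: "n = d * l" by auto
      then have dl: "d > 0" "l > 0" "odd d" "odd l" using n True by (auto simp: Suc_le_eq)
      have "of_nat d powr (- (w - 1)) = of_nat d * complex_of_nat d powr (- w)"
        using powr_add[of "of_nat d" 1 "- w"] dl by simp
      moreover have "of_nat n powr (- w) = complex_of_nat d powr (- w) * of_nat l powr (- w)"
        using powr_times_real[of "of_nat d" "of_nat l" "- w"] by (simp add: l)
      ultimately show "oz (w - 1) d * oz w (n div d) = of_nat d * of_nat n powr (- w)"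
        using dl by (simp add: oz_def l)
    qed simp
    also have "\<dots> = of_nat (b_coeff n) * of_nat n powr (- w)"
      using True by (simp add: b_coeff_def sigma1_def sum_distrib_right)
    finally show ?thesis .
  next
    case False
    have "oz (w - 1) d * oz w (n div d) = 0" if "d dvd n" for d
    proof -
      from \<open>d dvd n\<close> obtain l where l: "n = d * l" by (rule dvdE)
      then have "d > 0" "even d \<or> even l" using n False by (auto intro: Nat.gr0I)
      then show ?thesis by (auto simp: oz_def l)
    qed
    then have "(\<Sum>d | d dvd n. oz (w - 1) d * oz w (n div d)) = 0"
      by (intro sum.neutral) blast
    then show ?thesis using False by (simp add: b_coeff_def)
  qed
  ultimately have "((\<lambda>n. of_nat (b_coeff n) * of_nat n powr (- w)) has_sum
      ((1 - 2 powr (- (w - 1))) * zeta (w - 1)) * ((1 - 2 powr (- w)) * zeta w)) {1..}"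
    by (subst (asm) has_sum_cong) auto
  then show ?thesis by simp
qed

text \<open>The condition on \<open>w\<close> comes from the factor \<open>u ^ 4\<close> in the
  bound on \<open>beta_line\<close>; with \<open>w = 1 - s\<close> it is exactly
  \<open>Re s < -3\<close>.\<close>

lemma beta_mellin:
  assumes w: "Re w > 4" and D: "((\<lambda>l. of_nat (b_coeff l) * of_nat l powr (- w)) has_sum D) {1..}"
  shows "(\<integral>v. exp (w * of_real v) * of_real (beta_line (exp v)) \<partial>lborel) = of_real pi powr (- w) * Gamma w * D"
proof -
  define f where "f = (\<lambda>l v. of_nat (b_coeff l) * exp (w * of_real v - of_real (pi * real l * exp v)))"
  have fint: "integrable lborel (f l)" if "l \<in> {1..}" for l
    unfolding f_def using that w by (intro integrable_mult_right Gamma_integral_line_scaled(1)) auto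
  have fe: "f l v = exp (w * of_real v) * complex_of_real (real (b_coeff l) * exp (- pi * exp v) ^ l)" for l v
  proof -
    have "exp (w * of_real v - of_real (pi * real l * exp v)) = exp (w * of_real v) * of_real (exp (- pi * exp v) ^ l)"
      unfolding exp_power_term exp_of_real[symmetric] mult_exp_exp by simp
    then show ?thesis by (simp add: f_def mult_ac)
  qed
  have nf: "norm (f l v) = exp (Re w * v) * (real (b_coeff l) * exp (- pi * exp v) ^ l)" for l v
    unfolding fe norm_mult[of "exp (w * of_real v)"] norm_of_real by (simp add: norm_exp_eq_Re)
  have pw: "((\<lambda>l. norm (f l v)) has_sum (exp (Re w * v) * beta_line (exp v))) {1..}" for v
    unfolding nf by (intro has_sum_cmult_right alpha_line_bounds) simp
  have sum: "(\<Sum>\<^sub>\<infinity>l\<in>{1..}. f l v) = exp (w * of_real v) * of_real (beta_line (exp v))" for v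
    unfolding fe by (intro infsumI has_sum_cmult_right has_sum_of_real alpha_line_bounds) simp
  have powr: "of_real (pi * real l) powr (- w) = of_real pi powr (- w) * of_nat l powr (- w)" for l
    using powr_times_real[of "of_real pi" "of_real (real l)" "- w"] by simp
  have val: "(\<integral>v. f l v \<partial>lborel) = of_real pi powr (- w) * Gamma w * (of_nat (b_coeff l) * of_nat l powr (- w))"
    if "l \<in> {1..}" for l
  proof -
    have "(\<integral>v. f l v \<partial>lborel) = of_nat (b_coeff l) * (of_real (pi * real l) powr (- w) * Gamma w)"
      unfolding f_def using that w by (simp only: integral_mult_right_zero) (subst Gamma_integral_line_scaled(2); simp)
    then show ?thesis unfolding powr by (simp only: mult_ac)
  qed
  have dom: "integrable lborel (\<lambda>v. exp (Re w * v) * beta_line (exp v))"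
  proof (rule Bochner_Integration.integrable_bound)
    show "integrable lborel (\<lambda>v. decay_const * exp ((Re w - 4) * v - 1 * exp v))"
      using w by (intro integrable_mult_right Gamma_integral_line_real) auto
    have "exp (Re w * v) * beta_line (exp v) \<le> decay_const * exp ((Re w - 4) * v - 1 * exp v)" for v
    proof -
      have "exp (Re w * v) * beta_line (exp v) \<le> exp (Re w * v) * (decay_const * (exp (- exp v) / exp v ^ 4))"
        by (intro mult_left_mono alpha_line_bounds) auto
      also have "\<dots> = decay_const * (exp (Re w * v) * exp (- exp v) / exp v ^ 4)" by simp
      also have "exp (Re w * v) * exp (- exp v) / exp v ^ 4 = exp ((Re w - 4) * v - 1 * exp v)"
        by (simp add: algebra_simps flip: exp_of_nat_mult exp_add exp_diff)
      finally show ?thesis .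
    qed
    moreover have "exp (Re w * v) * beta_line (exp v) \<ge> 0" for v
      using alpha_line_bounds(3)[of "exp v"] by simp
    ultimately show "AE v in lborel. norm (exp (Re w * v) * beta_line (exp v)) \<le> norm (decay_const * exp ((Re w - 4) * v - 1 * exp v))"
      by (intro AE_I2) (metis abs_ge_self abs_of_nonneg order_trans real_norm_def)
  qed measurable
  have "((\<lambda>l. \<integral>v. f l v \<partial>lborel) has_sum (\<integral>v. (\<Sum>\<^sub>\<infinity>l\<in>{1..}. f l v) \<partial>lborel)) {1..}"
    by (rule has_sum_integral(2)[OF fint has_sum_imp_summable[OF pw] summable_on_integral_dominated[OF fint pw dom]])
  then have "((\<lambda>l. of_real pi powr (- w) * Gamma w * (of_nat (b_coeff l) * of_nat l powr (- w))) has_sum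
      (\<integral>v. exp (w * of_real v) * of_real (beta_line (exp v)) \<partial>lborel)) {1..}"
    unfolding sum by (rule has_sum_cong[THEN iffD1, rotated]) (rule val)
  from has_sum_unique[OF this has_sum_cmult_right[OF D]] show ?thesis .
qed

text \<open>For \<open>Re s < -3\<close> this is integration by parts combined with
  \<open>beta_mellin\<close>. The excluded points are where \<open>zeta (1 - s)\<close> and
  \<open>zeta (- s)\<close> meet the pole; removing two points keeps the plane connected, so the
  identity theorem applies.\<close>

lemma product_mellin_zeta:
  assumes s: "s \<noteq> 0" "s \<noteq> -1"
  shows "8 * of_real pi * product_mellin s * rGamma (1 - s) =
    - (s + 1) * of_real pi powr (s - 1) * (((1 - 2 powr s) * zeta (- s)) * ((1 - 2 powr (s - 1)) * zeta (1 - s)))"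
    (is "?L s = ?R s")
proof -
  have z: "(\<lambda>s. zeta (h s)) holomorphic_on A" if "h holomorphic_on A" "\<And>z. z \<in> A \<Longrightarrow> h z \<noteq> 1" for h A
  proof -
    have "h ` A \<subseteq> - {1}" using that(2) by auto
    from holomorphic_on_compose_gen[OF that(1) zeta_holomorphic this] show ?thesis by (simp add: o_def)
  qed
  have "?L s - ?R s = 0"
  proof (rule analytic_continuation_open[where s = "{s. Re s < -3}" and s' = "- {0, -1}" and f = "\<lambda>s. ?L s - ?R s" and g = "\<lambda>_. 0"])
    show "open {s. Re s < -3}" by (rule open_halfspace_Re_lt)
    show "{s. Re s < -3} \<noteq> {}" by (auto intro!: exI[of _ "-4"])
    have "connected (UNIV - {0, -1::complex})"
      by (intro connected_open_delete_finite) auto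
    then show "connected (- {0, -1::complex})" by (simp add: Compl_eq_Diff_UNIV)
    have "product_mellin holomorphic_on - {0, -1}" using product_mellin_entire(1) by (rule holomorphic_on_subset) simp
    then show "(\<lambda>s. ?L s - ?R s) holomorphic_on - {0, -1}"
      by (intro holomorphic_intros z) (auto simp: minus_equation_iff[of _ 1])
    show "?L s - ?R s = 0" if "s \<in> {s. Re s < -3}" for s
    proof -
      have s: "Re s < -3" using that by simp
      define D where "D = ((1 - 2 powr s) * zeta (- s)) * ((1 - 2 powr (s - 1)) * zeta (1 - s))"
      have "((\<lambda>n. of_nat (b_coeff n) * of_nat n powr (- (1 - s))) has_sum D) {1..}"
        using b_coeff_Dirichlet[of "1 - s"] s by (simp add: D_def)
      from beta_mellin[OF _ this] s
      have "8 * of_real pi * product_mellin s = - (s + 1) * (of_real pi powr (- (1 - s)) * Gamma (1 - s) * D)"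
        unfolding product_mellin_by_parts[OF s] by simp
      moreover have "Gamma (1 - s) * rGamma (1 - s) = 1"
      proof -
        have "1 - s \<notin> \<int>\<^sub>\<le>\<^sub>0" using s by (auto elim!: nonpos_Ints_cases simp: complex_eq_iff)
        then show ?thesis by (simp add: Gamma_def rGamma_eq_zero_iff)
      qed
      moreover have "a * (p * g * d) * r = a * p * d * (g * r)" for a p g d r :: complex by (simp only: mult_ac)
      ultimately have "?L s = - (s + 1) * of_real pi powr (- (1 - s)) * D * 1" by (simp only:)
      then show ?thesis by (simp add: D_def)
    qed
  qed (use s in auto)
  then show ?thesis by simp
qed

text \<open>The factor \<open>zeta (1 - \<rho>)\<close> vanishes by reflection, and
  \<open>rGamma (1 - \<rho>)\<close> can be cancelled because \<open>1 - \<rho>\<close> is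
  nonreal.\<close>

lemma Ghat_zero:
  assumes "1 / 2 + \<i> * \<gamma> \<in> nonreal_zeta_zeros"
  shows "Ghat \<gamma> = 0"
proof -
  define \<rho> where "\<rho> = 1 / 2 + \<i> * \<gamma>"
  have \<rho>: "zeta \<rho> = 0" "\<rho> \<notin> \<real>" using assms by (auto simp: nonreal_zeta_zeros_def \<rho>_def)
  have "\<rho> \<noteq> 0" "\<rho> \<noteq> -1" using \<rho>(2) by auto
  then have "8 * of_real pi * product_mellin \<rho> * rGamma (1 - \<rho>) = 0"
    using product_mellin_zeta[of \<rho>] zeta_zero_reflect[OF \<rho>] by simp
  moreover have "1 - \<rho> \<notin> \<real>"
  proof
    assume "1 - \<rho> \<in> \<real>"
    from Reals_diff[OF Reals_1 this] have "\<rho> \<in> \<real>" by simp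
    with \<rho>(2) show False by simp
  qed
  ultimately have "product_mellin \<rho> = 0" using rGamma_nonreal[of "1 - \<rho>"] by simp
  then show ?thesis by (simp add: Ghat_eq \<rho>_def)
qed

theorem theorem1:
  shows "(\<forall>v. summable (\<lambda>j. G_summand v (Suc j))) \<and>
         (\<forall>t. integrable lborel (Ghat_integrand t)) \<and>
         (\<forall>\<rho> \<gamma>. \<rho> \<in> nonreal_zeta_zeros \<longrightarrow> \<rho> = 1 / 2 + \<i> * \<gamma> \<longrightarrow>
            summable (\<lambda>j. bessel_summand \<gamma> (Suc j)) \<and>
            Ghat \<gamma> = (\<Sum>j. bessel_summand \<gamma> (Suc j)) \<and>
            (\<Sum>j. bessel_summand \<gamma> (Suc j)) = 0) \<and>
         (Ghat has_sum 0) {\<gamma>. 1 / 2 + \<i> * \<gamma> \<in> nonreal_zeta_zeros}"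
proof (intro conjI allI impI)
  show "summable (\<lambda>j. G_summand v (Suc j))" for v
    using G_sums by (rule sums_summable)
  show "integrable lborel (Ghat_integrand t)" for t
    unfolding Ghat_integrand_eq[abs_def] by (rule product_mellin_entire)
  \<comment> \<open>Every term is zero, so the unordered sum converges whatever the distribution of
    the zeros.\<close>
  show "(Ghat has_sum 0) {\<gamma>. 1 / 2 + \<i> * \<gamma> \<in> nonreal_zeta_zeros}"
    by (rule has_sum_0) (simp add: Ghat_zero)
  fix \<rho> \<gamma> assume \<rho>: "\<rho> \<in> nonreal_zeta_zeros" "\<rho> = 1 / 2 + \<i> * \<gamma>"
  \<comment> \<open>A nonreal order is not an integer, which selects the closed-form branch of
    \<open>bessel_K\<close> rather than the limit.\<close>
  have "\<rho> \<notin> \<int>" using \<rho>(1) by (auto simp: nonreal_zeta_zeros_def elim!: Ints_cases)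
  then have "(bessel_summand \<gamma> has_sum Ghat \<gamma>) {1..}"
    using \<rho>(2) by (intro bessel_summand_has_sum) simp
  then have "(\<lambda>j. bessel_summand \<gamma> (Suc j)) sums Ghat \<gamma>"
    unfolding has_sum_nat_from_1_iff by (rule has_sum_imp_sums)
  moreover have "Ghat \<gamma> = 0" using \<rho> by (intro Ghat_zero) simp
  ultimately show "summable (\<lambda>j. bessel_summand \<gamma> (Suc j))" "Ghat \<gamma> = (\<Sum>j. bessel_summand \<gamma> (Suc j))"
    "(\<Sum>j. bessel_summand \<gamma> (Suc j)) = 0"
    by (auto simp: sums_iff)
qed
end
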